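(* Let $(A,\Lambda)$ be any associative form ring with $1$, let $n\ge 4$, and let $(I_i,\Gamma_i)$, $i=1,\ldots,m$, be form ideals of $(A,\Lambda)$. Consider an arbitrary arrangement of brackets $\llbracket\ldots\rrbracket$ with the cut point $s$. Then $$\Big\llbracket\operatorname{EU}(2n,I_1,\Gamma_1),\operatorname{EU}(2n,I_2,\Gamma_2),\ldots,\operatorname{EU}(2n,I_m,\Gamma_m)\Big\rrbracket=$$ $$\Big[\operatorname{EU}\big(2n,(I_1,\Gamma_1)\circ\ldots\circ(I_s,\Gamma_s)\big),\operatorname{EU}\big(2n,(I_{s+1},\Gamma_{s+1})\circ\ldots\circ(I_m,\Gamma_m)\big)\Big],$$ where the bracketing of symmetrised products on the right hand side coincides with the bracketing of the commutators on the left hand side.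
   Context: Form rings. $A$ is an associative ring with $1$ with an involution $a\mapsto\bar a$ (additive, $\overline{ab}=\bar b\,\bar a$, $\bar{\bar a}=a$), and $\lambda\in\operatorname{Cent}(A)$ is fixed with $\lambda\bar\lambda=1$. Put $\Lambda_{\min}=\{c-\lambda\bar c\mid c\in A\}$, $\Lambda_{\max}=\{c\in A\mid c=-\lambda\bar c\}$. A form parameter $\Lambda$ is an additive subgroup with $\Lambda_{\min}\subseteq\Lambda\subseteq\Lambda_{\max}$ and $c\Lambda\bar c\subseteq\Lambda$ for all $c\in A$; then $(A,\Lambda)$ is a form ring. Form ideals. For a two-sided ideal $I$ with $\bar I=I$ put $\Gamma_{\max}(I)=I\cap\Lambda$ and $\Gamma_{\min}(I)=\{a-\lambda\bar a\mid a\in I\}+\langle ac\bar a\mid a\in I,c\in\Lambda\rangle$ ($\langle\cdot\rangle$ = additive subgroup generated). A form ideal $(I,\Gamma)$ consists of such an $I$ and an additive subgroup $\Gamma$ with $\Gamma_{\min}(I)\subseteq\Gamma\subseteq\Gamma_{\max}(I)$ and $c\Gamma\bar c\subseteq\Gamma$ for all $c\in A$. The symmetrised product (in general non-associative) is $(I,\Gamma)\circ(J,\Delta)=(IJ+JI,\ \Gamma_{\min}(IJ+JI)+{}^J\Gamma+{}^I\Delta)$, where ${}^J\Gamma=\langle b\gamma\bar b\mid b\in J,\gamma\in\Gamma\rangle$, ${}^I\Delta=\langle a\delta\bar a\mid a\in I,\delta\in\Delta\rangle$. Elementary subgroups. $\Omega=\{1,\dots,n,-n,\dots,-1\}$ indexes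 rows and columns of $2n\times 2n$ matrices; $\varepsilon(i)$ is the sign of $i$. For $i\ne\pm j$, $c\in A$: $T_{ij}(c)=e+ce_{ij}-\lambda^{(\varepsilon(j)-\varepsilon(i))/2}\bar c\,e_{-j,-i}$. For $c\in\lambda^{-(\varepsilon(i)+1)/2}\Lambda$: $T_{i,-i}(c)=e+ce_{i,-i}$. For a form ideal write $(I,\Gamma)_{ij}=I$ if $i\ne\pm j$ and $(I,\Gamma)_{i,-i}=\lambda^{-(\varepsilon(i)+1)/2}\Gamma$. $\operatorname{EU}(2n,A,\Lambda)$ is generated by all $T_{ij}(c)$, $c\in(A,\Lambda)_{ij}$; $\operatorname{EU}(2n,I,\Gamma)$ is the normal closure in $\operatorname{EU}(2n,A,\Lambda)$ of the subgroup generated by all $T_{ij}(a)$, $a\in(I,\Gamma)_{ij}$. Multiple commutators. $[x,y]=xyx^{-1}y^{-1}$ and $[H,K]$ is the subgroup generated by commutators. For subgroups $H_1,\dots,H_m$ ($m\ge 2$), $\llbracket H_1,\ldots,H_m\rrbracket$ denotes the iterated mutual commutator subgroup formed with some fixed arbitrary placement of brackets (a full binary bracketing of $H_1,\dots,H_m$ in this order). It can be uniquely written as $[\llbracket H_1,\ldots,H_s\rrbracket,\llbracket H_{s+1},\ldots,H_m\rrbracket]$ with $1\le s\le m-1$ (the bracketing of a single subgroup being the subgroup itself); this $s$ is the cut point. The product $(I_1,\Gamma_1)\circ\ldots\circ(I_s,\Gamma_s)$ is bracketed as $\llbracket H_1,\ldots,H_s\rrbracket$, and $(I_{s+1},\Gamma_{s+1})\circ\ldots\circ(I_m,\Gamma_m)$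 as $\llbracket H_{s+1},\ldots,H_m\rrbracket$. *)

theory Defs
  imports
    "HOL-Algebra.Generated_Groups"
    "HOL-Library.Set_Algebras"
    "HOL-Computational_Algebra.Group_Closure"
begin

section \<open>Form rings\<close>

text \<open>
  The sort \<open>{ring, monoid_mult}\<close> describes associative rings with 1. Unlike the class
  \<open>ring_1\<close> it does not exclude the zero ring.
\<close>

record 'a form_data =
  bar :: "'a \<Rightarrow> 'a"
  lam :: 'a
  Lam :: "'a set"

definition add_subgroup :: "'a::ab_group_add set \<Rightarrow> bool" where
  "add_subgroup S \<longleftrightarrow> 0 \<in> S \<and> (\<forall>x\<in>S. \<forall>y\<in>S. x + y \<in> S) \<and> (\<forall>x\<in>S. - x \<in> S)"

definition Lam_min :: "('a::{ring, monoid_mult}) form_data \<Rightarrow> 'a set" where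
  "Lam_min F = {c - lam F * bar F c | c. True}"

definition Lam_max :: "('a::{ring, monoid_mult}) form_data \<Rightarrow> 'a set" where
  "Lam_max F = {c. c = - (lam F * bar F c)}"

locale form_ring =
  fixes F :: "('a::{ring, monoid_mult}) form_data"
  assumes bar_add: "bar F (a + b) = bar F a + bar F b"
    and bar_mult: "bar F (a * b) = bar F b * bar F a"
    and bar_bar: "bar F (bar F a) = a"
    and lam_central: "lam F * a = a * lam F"
    and lam_bar_lam: "lam F * bar F (lam F) = 1"
    and add_subgroup_Lam: "add_subgroup (Lam F)"
    and Lam_min_le: "Lam_min F \<subseteq> Lam F"
    and Lam_le_max: "Lam F \<subseteq> Lam_max F"
    and Lam_closed: "d \<in> Lam F \<Longrightarrow> c * d * bar F c \<in> Lam F"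

section \<open>Form ideals and their symmetrised product\<close>

definition two_sided_ideal :: "('a::{ring, monoid_mult}) set \<Rightarrow> bool" where
  "two_sided_ideal J \<longleftrightarrow> add_subgroup J \<and> (\<forall>x\<in>J. \<forall>a. a * x \<in> J \<and> x * a \<in> J)"

definition Gamma_max :: "('a::{ring, monoid_mult}) form_data \<Rightarrow> 'a set \<Rightarrow> 'a set" where
  "Gamma_max F J = J \<inter> Lam F"

text \<open>Throughout, \<open>+\<close> on sets is the elementwise sum.\<close>

definition Gamma_min :: "('a::{ring, monoid_mult}) form_data \<Rightarrow> 'a set \<Rightarrow> 'a set" where
  "Gamma_min F J =
     {a - lam F * bar F a | a. a \<in> J}
     + group_closure {a * c * bar F a | a c. a \<in> J \<and> c \<in> Lam F}"

fun form_ideal :: "('a::{ring, monoid_mult}) form_data \<Rightarrow> 'a set \<times> 'a set \<Rightarrow> bool" where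
  "form_ideal F (J, \<Gamma>) \<longleftrightarrow>
     two_sided_ideal J \<and> bar F ` J = J \<and>
     add_subgroup \<Gamma> \<and> Gamma_min F J \<subseteq> \<Gamma> \<and> \<Gamma> \<subseteq> Gamma_max F J \<and>
     (\<forall>c. \<forall>g\<in>\<Gamma>. c * g * bar F c \<in> \<Gamma>)"

definition ideal_mult :: "('a::{ring, monoid_mult}) set \<Rightarrow> 'a set \<Rightarrow> 'a set" where
  "ideal_mult J K = group_closure {a * b | a b. a \<in> J \<and> b \<in> K}"

definition twist :: "('a::{ring, monoid_mult}) form_data \<Rightarrow> 'a set \<Rightarrow> 'a set \<Rightarrow> 'a set" where
  "twist F J \<Gamma> = group_closure {b * g * bar F b | b g. b \<in> J \<and> g \<in> \<Gamma>}"

fun form_prod :: "('a::{ring, monoid_mult}) form_data \<Rightarrow>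
    'a set \<times> 'a set \<Rightarrow> 'a set \<times> 'a set \<Rightarrow> 'a set \<times> 'a set" where
  "form_prod F (J, \<Gamma>) (K, \<Delta>) =
     (let P = ideal_mult J K + ideal_mult K J
      in (P, Gamma_min F P + twist F K \<Gamma> + twist F J \<Delta>))"

section \<open>The general linear group\<close>

text \<open>
  Matrices with rows and columns indexed by \<open>\<Omega> = {1, \<dots>, n, -n, \<dots>, -1}\<close> are functions of
  two integers that vanish outside \<open>\<Omega> \<times> \<Omega>\<close>.
\<close>

definition Omega :: "nat \<Rightarrow> int set" where
  "Omega n = {i. i \<noteq> 0 \<and> \<bar>i\<bar> \<le> int n}"

type_synonym 'a matrix = "int \<Rightarrow> int \<Rightarrow> 'a"

definition mat_one :: "nat \<Rightarrow> ('a::{ring, monoid_mult}) matrix" where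
  "mat_one n = (\<lambda>p q. if p = q \<and> p \<in> Omega n then 1 else 0)"

definition mat_monoid :: "nat \<Rightarrow> ('a::{ring, monoid_mult}) matrix monoid" where
  "mat_monoid n =
     \<lparr>carrier = {M. \<forall>p q. p \<notin> Omega n \<or> q \<notin> Omega n \<longrightarrow> M p q = 0},
      monoid.mult = (\<lambda>M N p q. \<Sum>k\<in>Omega n. M p k * N k q),
      one = mat_one n\<rparr>"

definition GL :: "nat \<Rightarrow> ('a::{ring, monoid_mult}) matrix monoid" where
  "GL n = units_of (mat_monoid n)"

lemma finite_Omega [simp]: "finite (Omega n)"
  by (rule finite_subset[of _ "{- int n..int n}"]) (auto simp: Omega_def)

lemma monoid_mat_monoid: "monoid (mat_monoid n :: ('a::{ring, monoid_mult}) matrix monoid)"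
proof (rule monoidI)
  fix M N L :: "'a matrix"
  show "M \<otimes>\<^bsub>mat_monoid n\<^esub> N \<otimes>\<^bsub>mat_monoid n\<^esub> L = M \<otimes>\<^bsub>mat_monoid n\<^esub> (N \<otimes>\<^bsub>mat_monoid n\<^esub> L)"
    by (simp add: mat_monoid_def sum_distrib_left sum_distrib_right mult.assoc)
       (intro ext, rule sum.swap)
next
  fix M :: "'a matrix"
  assume M: "M \<in> carrier (mat_monoid n)"
  have "(\<Sum>k\<in>Omega n. mat_one n p k * M k q) = M p q" for p q
  proof -
    have "(\<Sum>k\<in>Omega n. mat_one n p k * M k q) = (\<Sum>k\<in>Omega n. if p = k then M k q else 0)"
      by (rule sum.cong) (auto simp: mat_one_def)
    then show ?thesis
      using M by (simp add: mat_monoid_def)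
  qed
  then show "\<one>\<^bsub>mat_monoid n\<^esub> \<otimes>\<^bsub>mat_monoid n\<^esub> M = M"
    by (simp add: mat_monoid_def)
  have "(\<Sum>k\<in>Omega n. M p k * mat_one n k q) = M p q" for p q
  proof -
    have "(\<Sum>k\<in>Omega n. M p k * mat_one n k q) = (\<Sum>k\<in>Omega n. if k = q then M p k else 0)"
      by (rule sum.cong) (auto simp: mat_one_def)
    then show ?thesis
      using M by (simp add: mat_monoid_def)
  qed
  then show "M \<otimes>\<^bsub>mat_monoid n\<^esub> \<one>\<^bsub>mat_monoid n\<^esub> = M"
    by (simp add: mat_monoid_def)
qed (auto simp: mat_monoid_def mat_one_def)

lemma group_GL: "group (GL n)"
  unfolding GL_def by (rule monoid.units_group[OF monoid_mat_monoid])

section \<open>Elementary subgroups\<close>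

text \<open>Integral powers of \<open>\<lambda>\<close>, using that \<open>\<lambda>\<close> is invertible with inverse \<open>bar \<lambda>\<close>.\<close>

definition lam_pow :: "('a::{ring, monoid_mult}) form_data \<Rightarrow> int \<Rightarrow> 'a" where
  "lam_pow F k = (if 0 \<le> k then lam F ^ nat k else bar F (lam F) ^ nat (- k))"

definition mat_unit :: "('a::{ring, monoid_mult}) \<Rightarrow> int \<Rightarrow> int \<Rightarrow> 'a matrix" where
  "mat_unit c i j = (\<lambda>p q. if p = i \<and> q = j then c else 0)"

text \<open>
  \<open>sgn i\<close> is the sign \<open>\<epsilon>(i)\<close>; all divisions by 2 below are exact. The first case is the long
  root transvection \<open>T\<^sub>i\<^sub>,\<^sub>-\<^sub>i(c)\<close>.
\<close>

definition trv :: "('a::{ring, monoid_mult}) form_data \<Rightarrow> nat \<Rightarrow> int \<Rightarrow> int \<Rightarrow> 'a \<Rightarrow> 'a matrix" where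
  "trv F n i j c =
     (if j = - i then (\<lambda>p q. mat_one n p q + mat_unit c i (- i) p q)
      else (\<lambda>p q. mat_one n p q + mat_unit c i j p q
              - mat_unit (lam_pow F ((sgn j - sgn i) div 2) * bar F c) (- j) (- i) p q))"

fun root_part :: "('a::{ring, monoid_mult}) form_data \<Rightarrow> 'a set \<times> 'a set \<Rightarrow> int \<Rightarrow> int \<Rightarrow> 'a set" where
  "root_part F (J, \<Gamma>) i j =
     (if j = - i then (\<lambda>g. lam_pow F (- ((sgn i + 1) div 2)) * g) ` \<Gamma> else J)"

definition elem_gens :: "('a::{ring, monoid_mult}) form_data \<Rightarrow> nat \<Rightarrow> 'a set \<times> 'a set \<Rightarrow> 'a matrix set" where
  "elem_gens F n P =
     {trv F n i j c | i j c. i \<in> Omega n \<and> j \<in> Omega n \<and> i \<noteq> j \<and> c \<in> root_part F P i j}"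

definition EU_abs :: "('a::{ring, monoid_mult}) form_data \<Rightarrow> nat \<Rightarrow> 'a matrix set" where
  "EU_abs F n = generate (GL n) (elem_gens F n (UNIV, Lam F))"

definition normal_closure :: "('g, 'b) monoid_scheme \<Rightarrow> 'g set \<Rightarrow> 'g set \<Rightarrow> 'g set" where
  "normal_closure G H S = \<Inter>{N. N \<lhd> G\<lparr>carrier := H\<rparr> \<and> S \<subseteq> N}"

definition EU :: "('a::{ring, monoid_mult}) form_data \<Rightarrow> nat \<Rightarrow> 'a set \<times> 'a set \<Rightarrow> 'a matrix set" where
  "EU F n P = normal_closure (GL n) (EU_abs F n) (generate (GL n) (elem_gens F n P))"

section \<open>Multiple commutators\<close>

definition commutator_subgroup :: "('g, 'b) monoid_scheme \<Rightarrow> 'g set \<Rightarrow> 'g set \<Rightarrow> 'g set" where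
  "commutator_subgroup G H K =
     generate G {x \<otimes>\<^bsub>G\<^esub> y \<otimes>\<^bsub>G\<^esub> inv\<^bsub>G\<^esub> x \<otimes>\<^bsub>G\<^esub> inv\<^bsub>G\<^esub> y | x y. x \<in> H \<and> y \<in> K}"

text \<open>
  A full bracketing is the shape of a binary tree whose leaves, from left to right, stand for
  the arguments. \<open>bracketed f b xs\<close> combines the list \<open>xs\<close> (of length \<open>leaves b\<close>) by the binary
  operation \<open>f\<close> according to the bracketing \<open>b\<close>.
\<close>

datatype bracketing = Single | Br bracketing bracketing

fun leaves :: "bracketing \<Rightarrow> nat" where
  "leaves Single = 1"
| "leaves (Br l r) = leaves l + leaves r"

fun bracketed :: "('b \<Rightarrow> 'b \<Rightarrow> 'b) \<Rightarrow> bracketing \<Rightarrow> 'b list \<Rightarrow> 'b" where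
  "bracketed f Single xs = hd xs"
| "bracketed f (Br l r) xs =
     f (bracketed f l (take (leaves l) xs)) (bracketed f r (drop (leaves l) xs))"

end

theory Submission
  imports Defs "HOL-Library.Function_Algebras"
begin

text \<open>
  Write \<open>E(P)\<close> for the relative elementary subgroup of a form ideal \<open>P\<close>. By induction on the
  bracketing it is enough to show, for all form ideals \<open>P\<close>, \<open>Q\<close>, \<open>K\<close>, \<open>L\<close>,
  that \<open>[[E(P), E(Q)], E(K)] = [E(P \<circ> Q), E(K)]\<close> and
  \<open>[[E(P), E(Q)], [E(K), E(L)]] = [E(P \<circ> Q), E(K \<circ> L)]\<close>
  (\<open>commutator_EE_triple\<close> and \<open>commutator_EE_quadruple\<close>). The inclusions from right to left hold
  because \<open>E(P \<circ> Q)\<close> is contained in \<open>[E(P), E(Q)]\<close>, which is read off from the Steinberg relations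
  (\<open>EE_form_prod_subset\<close>).

  For the other inclusions the point is that \<open>[E(P), E(Q)]\<close> is only slightly larger than
  \<open>E(P \<circ> Q)\<close>. Modulo \<open>E(P \<circ> Q)\<close> elementary root elements of levels \<open>P\<close> and \<open>Q\<close> commute unless their
  roots are opposite; the commutators \<open>[T\<^sub>i\<^sub>j(a), T\<^sub>j\<^sub>i(b)]\<close> of opposite ones are central modulo
  \<open>E(P \<circ> Q)\<close> (\<open>comm_opposite_central\<close>), they can be moved from any root to any other one
  (\<open>opp_comm_mem_all\<close>), and together with \<open>E(P \<circ> Q)\<close> they generate everything (\<open>EE_commute_mod\<close>). Hence
  for any two indices \<open>p\<close>, \<open>q\<close> the group \<open>[E(P), E(Q)]\<close> is generated by \<open>E(P \<circ> Q)\<close> and by commutators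
  that live in the block of the indices \<open>\<plusminus>p\<close>, \<open>\<plusminus>q\<close> (\<open>commutator_EE_subset\<close>). This is where \<open>n \<ge> 4\<close>
  enters: a given root element \<open>T\<^sub>h\<^sub>k(c)\<close> of \<open>E(K)\<close> involves at most two indices up to sign, so that \<open>p\<close>
  and \<open>q\<close> can be chosen off \<open>\<plusminus>h\<close>, \<open>\<plusminus>k\<close>; then \<open>T\<^sub>h\<^sub>k(c)\<close> commutes with the block, and only
  \<open>[E(P \<circ> Q), T\<^sub>h\<^sub>k(c)]\<close> is left. For the quadruple commutator the two factors are placed in the disjoint
  blocks \<open>{1, 2}\<close> and \<open>{3, 4}\<close>.

  Two facts about normal closures support this. First, \<open>E(P)\<close> is generated as a group by the
  conjugates of \<open>T\<^sub>i\<^sub>j(p)\<close> by the opposite \<open>T\<^sub>j\<^sub>i(c)\<close> (\<open>normal_conj_gens\<close>). Secondly, any root element is a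
  product of root elements and their conjugates in which neither the given root nor its opposite
  occurs (\<open>T_mem_generate_off_gens\<close>). What remains is bookkeeping of roots, and it is done by
  parabolic subgroups: an odd integer function \<open>f\<close> on the indices grades the roots by
  \<open>f i - f j\<close>, and root elements of degree zero normalise the subgroup generated by those of
  positive degree. The commutator relations enter these arguments through the single graded formula
  \<open>comm_mem_unip\<close>.

  All arguments take place in an abstract group that satisfies the Steinberg relations; matrices
  only appear in the verification of these relations.
\<close>

section \<open>Commutators modulo a normal subgroup\<close>

context group
begin

definition conjg :: "'a \<Rightarrow> 'a \<Rightarrow> 'a" where
  "conjg g x = g \<otimes> x \<otimes> inv g"

definition comm :: "'a \<Rightarrow> 'a \<Rightarrow> 'a" where
  "comm x y = x \<otimes> y \<otimes> inv x \<otimes> inv y"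

text \<open>
  The preimage of the centraliser of the image of \<open>X\<close> in the quotient by \<open>N\<close>. Calculations modulo
  \<open>N\<close> are expressed by membership in such sets, which avoids elements of quotient groups.
\<close>

definition centralizer_mod :: "'a set \<Rightarrow> 'a set \<Rightarrow> 'a set" where
  "centralizer_mod N X = {g \<in> carrier G. \<forall>x\<in>X. comm g x \<in> N}"

lemma inv_mult_cancel: "\<lbrakk>x \<in> carrier G; y \<in> carrier G\<rbrakk> \<Longrightarrow> inv x \<otimes> (x \<otimes> y) = y"
  by (simp flip: m_assoc)

lemma mult_inv_cancel: "\<lbrakk>x \<in> carrier G; y \<in> carrier G\<rbrakk> \<Longrightarrow> x \<otimes> (inv x \<otimes> y) = y"
  by (simp flip: m_assoc)

lemmas group_word = conjg_def comm_def m_assoc inv_mult_group inv_mult_cancel mult_inv_cancel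

lemma conjg_closed [simp]: "\<lbrakk>g \<in> carrier G; x \<in> carrier G\<rbrakk> \<Longrightarrow> conjg g x \<in> carrier G"
  by (simp add: conjg_def)

lemma comm_closed [simp]: "\<lbrakk>g \<in> carrier G; x \<in> carrier G\<rbrakk> \<Longrightarrow> comm g x \<in> carrier G"
  by (simp add: comm_def)

lemma conjg_mult:
  "\<lbrakk>g \<in> carrier G; x \<in> carrier G; y \<in> carrier G\<rbrakk> \<Longrightarrow> conjg g (x \<otimes> y) = conjg g x \<otimes> conjg g y"
  by (simp add: group_word)

lemma conjg_inv:
  "\<lbrakk>g \<in> carrier G; x \<in> carrier G\<rbrakk> \<Longrightarrow> conjg g (inv x) = inv (conjg g x)"
  by (simp add: group_word)

lemma conjg_one [simp]: "g \<in> carrier G \<Longrightarrow> conjg g \<one> = \<one>"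
  by (simp add: group_word)

lemma conjg_by_one [simp]: "x \<in> carrier G \<Longrightarrow> conjg \<one> x = x"
  by (simp add: group_word)

lemma conjg_conjg:
  "\<lbrakk>g \<in> carrier G; h \<in> carrier G; x \<in> carrier G\<rbrakk> \<Longrightarrow> conjg g (conjg h x) = conjg (g \<otimes> h) x"
  by (simp add: group_word)

lemma conjg_by_conjg:
  "\<lbrakk>h \<in> carrier G; g \<in> carrier G; x \<in> carrier G\<rbrakk>
    \<Longrightarrow> conjg h (conjg g x) = conjg (conjg h g) (conjg h x)"
  by (simp add: group_word)

lemma conjg_comm:
  "\<lbrakk>g \<in> carrier G; x \<in> carrier G; y \<in> carrier G\<rbrakk>
    \<Longrightarrow> conjg g (comm x y) = comm (conjg g x) (conjg g y)"
  by (simp add: group_word)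

lemma conjg_eq_comm_mult:
  "\<lbrakk>g \<in> carrier G; x \<in> carrier G\<rbrakk> \<Longrightarrow> conjg g x = comm g x \<otimes> x"
  by (simp add: group_word)

lemma comm_eq_mult_conjg:
  "\<lbrakk>g \<in> carrier G; x \<in> carrier G\<rbrakk> \<Longrightarrow> comm g x = g \<otimes> conjg x (inv g)"
  by (simp add: group_word)

lemma inv_comm: "\<lbrakk>x \<in> carrier G; y \<in> carrier G\<rbrakk> \<Longrightarrow> inv (comm x y) = comm y x"
  by (simp add: group_word)

lemma comm_eq_one_iff: "\<lbrakk>x \<in> carrier G; y \<in> carrier G\<rbrakk> \<Longrightarrow> comm x y = \<one> \<longleftrightarrow> x \<otimes> y = y \<otimes> x"
  using inv_solve_right'[of \<one> "x \<otimes> y" "y \<otimes> x"] by (auto simp: comm_def m_assoc inv_mult_group)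

lemma comm_mult_left:
  "\<lbrakk>x \<in> carrier G; y \<in> carrier G; z \<in> carrier G\<rbrakk>
    \<Longrightarrow> comm (x \<otimes> y) z = conjg x (comm y z) \<otimes> comm x z"
  by (simp add: group_word)

lemma comm_inv_left:
  "\<lbrakk>x \<in> carrier G; z \<in> carrier G\<rbrakk> \<Longrightarrow> comm (inv x) z = conjg (inv x) (inv (comm x z))"
  by (simp add: group_word)

text \<open>
  The identity holds in the free group, hence by reduction of words.
\<close>

lemma Hall_Witt:
  assumes "x \<in> carrier G" "y \<in> carrier G" "z \<in> carrier G"
  shows "conjg y (comm x (comm (inv y) z)) \<otimes>
         (conjg z (comm y (comm (inv z) x)) \<otimes> conjg x (comm z (comm (inv x) y))) = \<one>"
  using assms by (simp add: group_word)

lemma conjg_generate_mem: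
  assumes "g \<in> carrier G" "S \<subseteq> carrier G" "subgroup K G"
    and "\<And>s. s \<in> S \<Longrightarrow> conjg g s \<in> K"
    and "x \<in> generate G S"
  shows "conjg g x \<in> K"
  using assms(5)
proof induction
  case one
  then show ?case using assms by (simp add: subgroup.one_closed)
next
  case (incl h)
  then show ?case using assms by simp
next
  case (inv h)
  then have "h \<in> carrier G" using assms by auto
  then show ?case using inv assms by (simp add: conjg_inv subgroup.m_inv_closed)
next
  case (eng h k)
  then have "h \<in> carrier G" "k \<in> carrier G"
    using generate_in_carrier[OF assms(2)] by auto
  then show ?case using eng assms by (simp add: conjg_mult subgroup.m_closed)
qed

lemma generate_subsetI:
  assumes "subgroup K G" "S \<subseteq> K" shows "generate G S \<subseteq> K"
  using generate_subgroup_incl[OF assms(2,1)] .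

text \<open>
  As the generators are closed under inverses, invariance under the generators themselves suffices.
\<close>

lemma generate_mem_induct_conjg:
  assumes S: "S \<subseteq> carrier G" and inv: "\<And>s. s \<in> S \<Longrightarrow> inv s \<in> S"
    and L: "L \<subseteq> carrier G"
    and conj: "\<And>s x. s \<in> S \<Longrightarrow> x \<in> L \<Longrightarrow> conjg s x \<in> L"
    and "g \<in> generate G S" "x \<in> L"
  shows "conjg g x \<in> L"
  using assms(5,6)
proof (induction arbitrary: x)
  case one
  then show ?case using L by auto
next
  case (incl h)
  then show ?case by (rule conj)
next
  case (inv h)
  then show ?case using assms(2) conj by blast
next
  case (eng h k)
  then have "h \<in> carrier G" "k \<in> carrier G" "x \<in> carrier G"
    using generate_in_carrier[OF S] L by auto
  then have "conjg (h \<otimes> k) x = conjg h (conjg k x)" by (simp add: conjg_conjg)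
  then show ?case using eng by auto
qed

lemma normal_conjgI:
  assumes "subgroup N G" "\<And>g x. g \<in> carrier G \<Longrightarrow> x \<in> N \<Longrightarrow> conjg g x \<in> N"
  shows "N \<lhd> G"
  using assms by (simp add: normal_inv_iff conjg_def)

lemma normal_conjgD:
  assumes "N \<lhd> G" "g \<in> carrier G" "x \<in> N" shows "conjg g x \<in> N"
  using normal.inv_op_closed2[OF assms] by (simp add: conjg_def)

lemma normal_subset_carrier: "N \<lhd> G \<Longrightarrow> N \<subseteq> carrier G"
  by (simp add: normal_imp_subgroup subgroup.subset)

lemma conjg_mem_normal_iff:
  assumes "N \<lhd> G" "g \<in> carrier G" "x \<in> carrier G"
  shows "conjg g x \<in> N \<longleftrightarrow> x \<in> N"
proof
  assume "conjg g x \<in> N"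
  then have "conjg (inv g) (conjg g x) \<in> N" using normal_conjgD assms by simp
  then show "x \<in> N" using assms by (simp add: conjg_conjg)
qed (use normal_conjgD assms in auto)

lemma comm_mem_normal_sym:
  assumes "N \<lhd> G" "x \<in> carrier G" "y \<in> carrier G" "comm x y \<in> N"
  shows "comm y x \<in> N"
  using assms inv_comm[of x y] subgroup.m_inv_closed[OF normal_imp_subgroup[OF assms(1)]] by metis

lemma comm_mem_normal_left:
  assumes "N \<lhd> G" "x \<in> N" "y \<in> carrier G"
  shows "comm x y \<in> N"
proof -
  have "x \<in> carrier G" using assms normal_subset_carrier by auto
  then have "comm x y = x \<otimes> conjg y (inv x)" using assms by (simp add: comm_eq_mult_conjg)
  then show ?thesis using assms normal_conjgD[OF assms(1)] normal_imp_subgroup[OF assms(1)]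
    by (simp add: subgroup.m_closed subgroup.m_inv_closed)
qed

lemma centralizer_mod_memD: "g \<in> centralizer_mod N X \<Longrightarrow> x \<in> X \<Longrightarrow> comm g x \<in> N"
  by (simp add: centralizer_mod_def)

lemma subgroup_centralizer_mod:
  assumes N: "N \<lhd> G" and X: "X \<subseteq> carrier G"
  shows "subgroup (centralizer_mod N X) G"
proof (rule subgroupI)
  note sg = normal_imp_subgroup[OF N]
  show "centralizer_mod N X \<subseteq> carrier G" by (auto simp: centralizer_mod_def)
  have "\<one> \<in> centralizer_mod N X"
    using X by (auto simp: centralizer_mod_def comm_def subgroup.one_closed[OF sg] subset_iff)
  then show "centralizer_mod N X \<noteq> {}" by blast
  fix a assume a: "a \<in> centralizer_mod N X"
  show "inv a \<in> centralizer_mod N X"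
    using a X normal_conjgD[OF N] subgroup.m_inv_closed[OF sg]
    by (auto simp: centralizer_mod_def comm_inv_left subset_iff)
  fix b assume "b \<in> centralizer_mod N X"
  then show "a \<otimes> b \<in> centralizer_mod N X"
    using a X normal_conjgD[OF N] subgroup.m_closed[OF sg]
    by (auto simp: centralizer_mod_def comm_mult_left subset_iff)
qed

lemma centralizer_mod_swap:
  assumes "N \<lhd> G" "X \<subseteq> carrier G" "X \<subseteq> centralizer_mod N Y" "Y \<subseteq> carrier G"
  shows "Y \<subseteq> centralizer_mod N X"
  using assms comm_mem_normal_sym[OF assms(1)] unfolding centralizer_mod_def by blast

lemma generate_subset_centralizer_mod:
  assumes "N \<lhd> G" "X \<subseteq> carrier G" "Y \<subseteq> centralizer_mod N X"
  shows "generate G Y \<subseteq> centralizer_mod N X"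
  using assms generate_subsetI subgroup_centralizer_mod by blast

lemma centralizer_mod_generate:
  assumes N: "N \<lhd> G" and X: "X \<subseteq> carrier G"
  shows "centralizer_mod N (generate G X) = centralizer_mod N X"
proof
  show "centralizer_mod N (generate G X) \<subseteq> centralizer_mod N X"
    by (auto simp: centralizer_mod_def generate.incl)
  have c: "centralizer_mod N X \<subseteq> carrier G" by (auto simp: centralizer_mod_def)
  have "X \<subseteq> centralizer_mod N (centralizer_mod N X)"
    by (rule centralizer_mod_swap[OF N c order_refl X])
  then have "generate G X \<subseteq> centralizer_mod N (centralizer_mod N X)"
    by (rule generate_subset_centralizer_mod[OF N c])
  then show "centralizer_mod N X \<subseteq> centralizer_mod N (generate G X)"
    using centralizer_mod_swap[OF N generate_incl[OF X] _ c] by blast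
qed

text \<open>
  Conjugation can be moved from one partner of a commutator to the other. This is the standard
  way below to get rid of a conjugation that is awkward for one of the two elements.
\<close>

lemma conjg_mem_centralizer_mod_iff:
  assumes N: "N \<lhd> G" and "x \<in> carrier G" "y \<in> carrier G" "g \<in> carrier G"
  shows "conjg g x \<in> centralizer_mod N {y} \<longleftrightarrow> conjg (inv g) y \<in> centralizer_mod N {x}"
proof -
  have eq: "comm (conjg g x) y = conjg g (comm x (conjg (inv g) y))"
    using assms by (simp add: group_word)
  have "comm (conjg g x) y \<in> N \<longleftrightarrow> comm x (conjg (inv g) y) \<in> N"
    unfolding eq using assms by (intro conjg_mem_normal_iff) auto
  also have "\<dots> \<longleftrightarrow> comm (conjg (inv g) y) x \<in> N"
    using comm_mem_normal_sym[OF N] assms by (meson conjg_closed inv_closed)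
  finally show ?thesis using assms by (simp add: centralizer_mod_def)
qed

text \<open>
  This is what allows the passage from a generating set of \<open>Y\<close> to its normal closure: if \<open>Y\<close>
  centralises the normal subgroup \<open>X\<close> modulo \<open>N\<close>, so does the normal closure of \<open>Y\<close>.
\<close>

lemma normal_centralizer_mod:
  assumes N: "N \<lhd> G" and X: "X \<lhd> G"
  shows "centralizer_mod N X \<lhd> G"
proof (rule normal_conjgI)
  have Xc: "X \<subseteq> carrier G" using X by (rule normal_subset_carrier)
  then show "subgroup (centralizer_mod N X) G" by (rule subgroup_centralizer_mod[OF N])
  fix g x assume g: "g \<in> carrier G" and x: "x \<in> centralizer_mod N X"
  then have xc: "x \<in> carrier G" by (simp add: centralizer_mod_def)
  have "comm (conjg g x) y \<in> N" if y: "y \<in> X" for y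
  proof -
    have yc: "y \<in> carrier G" using y Xc by blast
    have "conjg (inv g) y \<in> X" using X g y by (simp add: normal_conjgD)
    then have "conjg g (comm x (conjg (inv g) y)) \<in> N"
      using x g N by (simp add: normal_conjgD centralizer_mod_def)
    moreover have "comm (conjg g x) y = conjg g (comm x (conjg (inv g) y))"
      using g xc yc by (simp add: group_word)
    ultimately show ?thesis by simp
  qed
  then show "conjg g x \<in> centralizer_mod N X" using g xc by (simp add: centralizer_mod_def)
qed

text \<open>
  The three subgroups lemma for single elements: by the Hall--Witt identity, modulo \<open>N\<close>, one of the
  three double commutators is trivial as soon as the two others are.
\<close>

lemma comm_comm_mem_normal:
  assumes N: "N \<lhd> G" and xyz: "x \<in> carrier G" "y \<in> carrier G" "z \<in> carrier G"
    and a: "comm y (comm (inv z) x) \<in> N" and b: "comm z (comm (inv x) y) \<in> N"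
  shows "comm x (comm (inv y) z) \<in> N"
proof -
  define A where "A = conjg y (comm x (comm (inv y) z))"
  define B where "B = conjg z (comm y (comm (inv z) x)) \<otimes> conjg x (comm z (comm (inv x) y))"
  have AB: "A \<otimes> B = \<one>" "A \<in> carrier G" "B \<in> carrier G"
    unfolding A_def B_def using Hall_Witt xyz by auto
  have "B \<in> N" unfolding B_def
    using xyz a b N by (simp add: normal_conjgD subgroup.m_closed normal_imp_subgroup)
  moreover have "A = inv B" using AB by (metis inv_equality)
  ultimately have "A \<in> N" using normal_imp_subgroup[OF N] subgroup.m_inv_closed by metis
  then show ?thesis unfolding A_def using conjg_mem_normal_iff[OF N] xyz by simp
qed

lemma commutator_subgroup_eq: "commutator_subgroup G H K = generate G {comm x y | x y. x \<in> H \<and> y \<in> K}"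
  by (simp add: commutator_subgroup_def comm_def)

lemma commutator_subgroup_subset_iff:
  assumes "N \<lhd> G" "H \<subseteq> carrier G" "K \<subseteq> carrier G"
  shows "commutator_subgroup G H K \<subseteq> N \<longleftrightarrow> H \<subseteq> centralizer_mod N K"
proof
  assume "commutator_subgroup G H K \<subseteq> N"
  then show "H \<subseteq> centralizer_mod N K"
    using assms(2) by (auto simp: commutator_subgroup_eq centralizer_mod_def intro: generate.incl)
next
  assume "H \<subseteq> centralizer_mod N K"
  then show "commutator_subgroup G H K \<subseteq> N"
    unfolding commutator_subgroup_eq using normal_imp_subgroup[OF assms(1)]
    by (intro generate_subsetI) (auto simp: centralizer_mod_def)
qed

lemma commutator_subgroup_mono:
  "\<lbrakk>H \<subseteq> H'; K \<subseteq> K'\<rbrakk> \<Longrightarrow> commutator_subgroup G H K \<subseteq> commutator_subgroup G H' K'"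
  unfolding commutator_subgroup_eq by (rule mono_generate) auto

lemma comm_mem_commutator_subgroup: "\<lbrakk>x \<in> H; y \<in> K\<rbrakk> \<Longrightarrow> comm x y \<in> commutator_subgroup G H K"
  unfolding commutator_subgroup_eq by (rule generate.incl) auto

lemma normal_commutator_subgroup:
  assumes H: "H \<lhd> G" and K: "K \<lhd> G"
  shows "commutator_subgroup G H K \<lhd> G"
proof (rule normal_conjgI)
  let ?S = "{comm x y | x y. x \<in> H \<and> y \<in> K}"
  have Hc: "H \<subseteq> carrier G" "K \<subseteq> carrier G" using H K normal_subset_carrier by auto
  then have S: "?S \<subseteq> carrier G" by (auto simp: subset_iff)
  show sg: "subgroup (commutator_subgroup G H K) G"
    unfolding commutator_subgroup_eq by (rule generate_is_subgroup[OF S])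
  fix g x assume g: "g \<in> carrier G" and x: "x \<in> commutator_subgroup G H K"
  show "conjg g x \<in> commutator_subgroup G H K"
  proof (rule conjg_generate_mem[OF g S sg _ x[unfolded commutator_subgroup_eq]])
    fix s assume "s \<in> ?S"
    then obtain a b where ab: "s = comm a b" "a \<in> H" "b \<in> K" by auto
    then have "conjg g s = comm (conjg g a) (conjg g b)" using g Hc by (auto simp: conjg_comm subset_iff)
    then show "conjg g s \<in> commutator_subgroup G H K"
      using ab g H K by (auto intro!: comm_mem_commutator_subgroup normal_conjgD)
  qed
qed

lemma commutator_subgroup_commute:
  assumes H: "H \<lhd> G" and K: "K \<lhd> G"
  shows "commutator_subgroup G H K = commutator_subgroup G K H"
proof -
  have "commutator_subgroup G H K \<subseteq> commutator_subgroup G K H" if "H \<lhd> G" "K \<lhd> G" for H K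
  proof -
    have c: "H \<subseteq> carrier G" "K \<subseteq> carrier G" using that normal_subset_carrier by auto
    have n: "commutator_subgroup G K H \<lhd> G" using that normal_commutator_subgroup by auto
    have "K \<subseteq> centralizer_mod (commutator_subgroup G K H) H"
      using commutator_subgroup_subset_iff[OF n c(2,1)] by simp
    then show ?thesis
      using centralizer_mod_swap[OF n c(2) _ c(1)] commutator_subgroup_subset_iff[OF n c] by blast
  qed
  then show ?thesis using assms by blast
qed

lemma normal_generate_Un_central:
  assumes N: "N \<lhd> G" and C: "C \<subseteq> carrier G" "C \<subseteq> centralizer_mod N (carrier G)"
  shows "generate G (N \<union> C) \<lhd> G"
proof (rule normal_conjgI)
  have S: "N \<union> C \<subseteq> carrier G" using N C normal_subset_carrier by auto
  show sg: "subgroup (generate G (N \<union> C)) G" by (rule generate_is_subgroup[OF S])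
  fix g x assume g: "g \<in> carrier G" and x: "x \<in> generate G (N \<union> C)"
  show "conjg g x \<in> generate G (N \<union> C)"
  proof (rule conjg_generate_mem[OF g S sg _ x])
    fix s assume s: "s \<in> N \<union> C"
    show "conjg g s \<in> generate G (N \<union> C)"
    proof (cases "s \<in> N")
      case True
      then show ?thesis using normal_conjgD[OF N g] by (blast intro: generate.incl)
    next
      case False
      then have sC: "s \<in> C" using s by blast
      then have "comm g s \<in> N" using C g comm_mem_normal_sym[OF N] centralizer_mod_memD by blast
      then have "comm g s \<otimes> s \<in> generate G (N \<union> C)" using sC
        by (intro generate.eng generate.incl) auto
      then show ?thesis using g sC C by (auto simp: conjg_eq_comm_mult)
    qed
  qed
qed

end

section \<open>Form ideals and their symmetrised products\<close>

lemma add_subgroupD: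
  assumes "add_subgroup S"
  shows "0 \<in> S" "\<And>x y. x \<in> S \<Longrightarrow> y \<in> S \<Longrightarrow> x + y \<in> S"
    "\<And>x. x \<in> S \<Longrightarrow> - x \<in> S" "\<And>x y. x \<in> S \<Longrightarrow> y \<in> S \<Longrightarrow> x - y \<in> S"
  using assms unfolding add_subgroup_def by (blast, blast, blast, metis diff_conv_add_uminus)

lemma add_subgroup_group_closure: "add_subgroup (group_closure S)"
  by (simp add: add_subgroup_def group_closure_add)

lemma add_subgroup_set_plus:
  assumes A: "add_subgroup A" and B: "add_subgroup B"
  shows "add_subgroup (A + B)"
  unfolding add_subgroup_def
proof (intro conjI ballI)
  have "0 + 0 \<in> A + B" using assms by (intro set_plus_intro add_subgroupD(1))
  then show "0 \<in> A + B" by simp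
next
  fix x y assume "x \<in> A + B" "y \<in> A + B"
  then obtain a b c d where "x = a + b" "y = c + d" "a \<in> A" "c \<in> A" "b \<in> B" "d \<in> B"
    by (auto elim!: set_plus_elim)
  moreover have "a + b + (c + d) = (a + c) + (b + d)" by (simp add: algebra_simps)
  ultimately show "x + y \<in> A + B" using A B by (metis set_plus_intro add_subgroupD(2))
next
  fix x assume "x \<in> A + B"
  then obtain a b where "x = a + b" "a \<in> A" "b \<in> B" by (auto elim!: set_plus_elim)
  moreover have "- (a + b) = - a + - b" by simp
  ultimately show "- x \<in> A + B" using A B by (metis set_plus_intro add_subgroupD(3))
qed

lemma set_plus_subset_iff:
  assumes "add_subgroup A" "add_subgroup B" "add_subgroup M"
  shows "A + B \<subseteq> M \<longleftrightarrow> A \<subseteq> M \<and> B \<subseteq> M"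
proof
  assume s: "A + B \<subseteq> M"
  have "a \<in> M" if "a \<in> A" for a
    using set_plus_intro[OF that add_subgroupD(1)[OF assms(2)]] s by auto
  moreover have "b \<in> M" if "b \<in> B" for b
    using set_plus_intro[OF add_subgroupD(1)[OF assms(1)] that] s by auto
  ultimately show "A \<subseteq> M \<and> B \<subseteq> M" by blast
next
  assume "A \<subseteq> M \<and> B \<subseteq> M"
  then show "A + B \<subseteq> M" using assms(3) by (auto elim!: set_plus_elim dest: add_subgroupD(2))
qed

lemma group_closure_subset_iff:
  assumes "add_subgroup M" shows "group_closure S \<subseteq> M \<longleftrightarrow> S \<subseteq> M"
proof
  assume "group_closure S \<subseteq> M" then show "S \<subseteq> M" by (auto intro: group_closure.base)
next
  assume S: "S \<subseteq> M"
  have "x \<in> M" if "x \<in> group_closure S" for x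
    using that S assms by induction (auto dest: add_subgroupD)
  then show "group_closure S \<subseteq> M" by blast
qed

lemma two_sided_idealD:
  assumes "two_sided_ideal J"
  shows "add_subgroup J" "\<And>x a. x \<in> J \<Longrightarrow> a * x \<in> J" "\<And>x a. x \<in> J \<Longrightarrow> x * a \<in> J"
  using assms by (auto simp: two_sided_ideal_def)

lemma two_sided_ideal_set_plus:
  assumes "two_sided_ideal J" "two_sided_ideal K" shows "two_sided_ideal (J + K)"
  unfolding two_sided_ideal_def
proof (intro conjI ballI allI)
  show "add_subgroup (J + K)" using assms by (simp add: add_subgroup_set_plus two_sided_idealD)
  fix x a assume "x \<in> J + K"
  then obtain y z where "x = y + z" "y \<in> J" "z \<in> K" by (auto elim!: set_plus_elim)
  then show "a * x \<in> J + K" "x * a \<in> J + K"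
    using assms by (simp_all add: distrib_left distrib_right set_plus_intro two_sided_idealD)
qed

lemma two_sided_ideal_ideal_mult:
  assumes "two_sided_ideal J" "two_sided_ideal K" shows "two_sided_ideal (ideal_mult J K)"
proof -
  define S where "S = {a * b |a b. a \<in> J \<and> b \<in> K}"
  have sg: "add_subgroup {x. a * x \<in> group_closure S}" "add_subgroup {x. x * a \<in> group_closure S}" for a
    by (auto simp: add_subgroup_def distrib_left distrib_right group_closure_add)
  have "a * x \<in> S" "x * a \<in> S" if x: "x \<in> S" for a x
  proof -
    obtain y z where yz: "x = y * z" "y \<in> J" "z \<in> K" using x by (auto simp: S_def)
    show "a * x \<in> S" using yz two_sided_idealD(2)[OF assms(1)] unfolding S_def
      by (intro CollectI exI[of _ "a * y"] exI[of _ z]) (simp add: mult.assoc)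
    show "x * a \<in> S" using yz two_sided_idealD(3)[OF assms(2)] unfolding S_def
      by (intro CollectI exI[of _ y] exI[of _ "z * a"]) (simp add: mult.assoc)
  qed
  note S_mult = this
  have "group_closure S \<subseteq> {x. a * x \<in> group_closure S}" for a
    unfolding group_closure_subset_iff[OF sg(1)]
    by (intro subsetI CollectI group_closure.base insertI2 S_mult)
  moreover have "group_closure S \<subseteq> {x. x * a \<in> group_closure S}" for a
    unfolding group_closure_subset_iff[OF sg(2)]
    by (intro subsetI CollectI group_closure.base insertI2 S_mult)
  ultimately show ?thesis
    unfolding two_sided_ideal_def ideal_mult_def S_def[symmetric] by (auto simp: add_subgroup_group_closure)
qed

context form_ring
begin

abbreviation lm :: 'a where "lm \<equiv> lam F"
abbreviation br :: "'a \<Rightarrow> 'a" where "br \<equiv> bar F"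

lemma bar_zero [simp]: "br 0 = 0"
  using bar_add[of 0 0] by simp

lemma bar_minus [simp]: "br (- a) = - br a"
  using bar_add[of a "- a"] by (simp add: eq_neg_iff_add_eq_0 add.commute)

lemma bar_one [simp]: "br 1 = 1"
  using bar_mult[of 1 "br 1"] by (simp add: bar_bar)

lemma bar_lam_lam: "br lm * lm = 1"
  using lam_bar_lam lam_central by metis

lemma bar_lam_central: "br lm * a = a * br lm"
proof -
  have "br (lm * br a) = br (br a * lm)" by (simp add: lam_central)
  then show ?thesis by (simp add: bar_mult bar_bar)
qed

lemma lam_cancel: "lm * (br lm * a) = a" "br lm * (lm * a) = a"
  by (simp_all add: lam_bar_lam bar_lam_lam flip: mult.assoc)

text \<open>
  Products are normalised by moving \<open>\<lambda>\<close> and its inverse to the front; the side conditions stop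
  the rewriting from exchanging them with each other for ever.
\<close>

lemma lam_to_front:
  assumes "NO_MATCH lm a" "NO_MATCH (br lm) a"
  shows "a * lm = lm * a" "a * br lm = br lm * a" "a * (lm * b) = lm * (a * b)" "a * (br lm * b) = br lm * (a * b)"
proof -
  show c: "a * lm = lm * a" "a * br lm = br lm * a" by (rule lam_central[symmetric], rule bar_lam_central[symmetric])
  show "a * (lm * b) = lm * (a * b)" "a * (br lm * b) = br lm * (a * b)"
    by (simp_all add: c flip: mult.assoc)
qed

lemmas lam_simps = lam_bar_lam bar_lam_lam lam_cancel lam_to_front

lemma lam_pow_simps [simp]:
  "lam_pow F 0 = 1" "lam_pow F 1 = lm" "lam_pow F (- 1) = br lm"
  by (simp_all add: lam_pow_def)

text \<open>
  Up to sign, the entry of \<open>T\<^sub>i\<^sub>j(c)\<close> in position \<open>(-j, -i)\<close>.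
\<close>

definition dual_entry :: "int \<Rightarrow> int \<Rightarrow> 'a \<Rightarrow> 'a" where
  "dual_entry i j c = lam_pow F ((sgn j - sgn i) div 2) * br c"

lemma dual_entry_cases:
  assumes "i \<noteq> 0" "j \<noteq> 0"
  shows "dual_entry i j c = (if sgn i = sgn j then br c else if i > 0 then br lm * br c else lm * br c)"
  using assms by (auto simp: dual_entry_def sgn_if)

lemma dual_entry_add: "dual_entry i j (a + b) = dual_entry i j a + dual_entry i j b"
  by (simp add: dual_entry_def bar_add distrib_left)

lemma dual_entry_minus [simp]: "dual_entry i j (- a) = - dual_entry i j a"
  by (simp add: dual_entry_def)

lemma dual_entry_zero [simp]: "dual_entry i j 0 = 0"
  by (simp add: dual_entry_def)

lemma dual_entry_dual_entry [simp]:
  assumes "i \<noteq> 0" "j \<noteq> 0" shows "dual_entry (- j) (- i) (dual_entry i j c) = c"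
  using assms by (auto simp: dual_entry_cases sgn_if bar_mult bar_bar mult.assoc lam_simps)

abbreviation whole :: "'a set \<times> 'a set" where "whole \<equiv> (UNIV, Lam F)"

abbreviation part :: "'a set \<times> 'a set \<Rightarrow> int \<Rightarrow> int \<Rightarrow> 'a set" where
  "part \<equiv> root_part F"

lemma part_short: "j \<noteq> - i \<Longrightarrow> part P i j = fst P"
  by (cases P) simp

text \<open>
  The power of \<open>\<lambda>\<close> that relates the coefficients of a long root element to \<open>\<Gamma>\<close> depends only on the
  sign of the index, and multiplying with \<open>\<lambda>\<close> undoes it.
\<close>

lemma mem_part_long_iff:
  assumes "i \<noteq> 0"
  shows "c \<in> part P i (- i) \<longleftrightarrow> (if i > 0 then lm * c else c) \<in> snd P"
proof (cases P)
  case (Pair J \<Gamma>)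
  show ?thesis
  proof (cases "i > 0")
    case True
    have "c \<in> (\<lambda>g. br lm * g) ` \<Gamma> \<longleftrightarrow> lm * c \<in> \<Gamma>"
    proof
      assume "lm * c \<in> \<Gamma>"
      then have "br lm * (lm * c) \<in> (\<lambda>g. br lm * g) ` \<Gamma>" by (rule imageI)
      then show "c \<in> (\<lambda>g. br lm * g) ` \<Gamma>" by (simp add: lam_cancel)
    qed (auto simp: lam_cancel)
    with True show ?thesis by (simp add: Pair)
  qed (use assms in \<open>auto simp: Pair sgn_if\<close>)
qed

lemma form_ideal_iff:
  "form_ideal F P \<longleftrightarrow> two_sided_ideal (fst P) \<and> br ` fst P = fst P \<and>
     add_subgroup (snd P) \<and> Gamma_min F (fst P) \<subseteq> snd P \<and> snd P \<subseteq> fst P \<inter> Lam F \<and>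
     (\<forall>c. \<forall>g\<in>snd P. c * g * br c \<in> snd P)"
  by (cases P) (simp add: Gamma_max_def)

declare form_ideal.simps [simp del] root_part.simps [simp del] form_prod.simps [simp del]

lemma add_subgroup_traces:
  assumes "add_subgroup J" shows "add_subgroup {a - lm * br a | a. a \<in> J}"
  unfolding add_subgroup_def
proof (intro conjI ballI)
  show "0 \<in> {a - lm * br a | a. a \<in> J}"
    using add_subgroupD(1)[OF assms] by (intro CollectI exI[of _ 0]) simp
next
  fix x y assume "x \<in> {a - lm * br a | a. a \<in> J}" "y \<in> {a - lm * br a | a. a \<in> J}"
  then obtain a b where "x = a - lm * br a" "y = b - lm * br b" "a \<in> J" "b \<in> J" by auto
  then show "x + y \<in> {a - lm * br a | a. a \<in> J}" using assms
    by (intro CollectI exI[of _ "a + b"]) (simp add: add_subgroupD bar_add distrib_left)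
next
  fix x assume "x \<in> {a - lm * br a | a. a \<in> J}"
  then obtain a where "x = a - lm * br a" "a \<in> J" by auto
  then show "- x \<in> {a - lm * br a | a. a \<in> J}" using assms
    by (intro CollectI exI[of _ "- a"]) (simp add: add_subgroupD)
qed

lemma Gamma_min_subset_iff:
  assumes "add_subgroup J" "add_subgroup M"
  shows "Gamma_min F J \<subseteq> M \<longleftrightarrow>
    (\<forall>a\<in>J. a - lm * br a \<in> M) \<and> (\<forall>a\<in>J. \<forall>c\<in>Lam F. a * c * br a \<in> M)"
  unfolding Gamma_min_def
    set_plus_subset_iff[OF add_subgroup_traces[OF assms(1)] add_subgroup_group_closure assms(2)]
    group_closure_subset_iff[OF assms(2)]
  by blast

lemma form_idealD:
  assumes "form_ideal F P"
  shows "two_sided_ideal (fst P)" "add_subgroup (fst P)" "add_subgroup (snd P)"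
    "\<And>a. a \<in> fst P \<Longrightarrow> br a \<in> fst P"
    "\<And>a b. a \<in> fst P \<Longrightarrow> a * b \<in> fst P" "\<And>a b. a \<in> fst P \<Longrightarrow> b * a \<in> fst P"
    "\<And>g. g \<in> snd P \<Longrightarrow> g \<in> fst P" "\<And>g. g \<in> snd P \<Longrightarrow> g \<in> Lam F"
    "\<And>c g. g \<in> snd P \<Longrightarrow> c * g * br c \<in> snd P"
    "\<And>a. a \<in> fst P \<Longrightarrow> a - lm * br a \<in> snd P"
    "\<And>a c. a \<in> fst P \<Longrightarrow> c \<in> Lam F \<Longrightarrow> a * c * br a \<in> snd P"
proof -
  show t: "two_sided_ideal (fst P)" "add_subgroup (fst P)" "add_subgroup (snd P)"
    using assms by (simp_all add: form_ideal_iff two_sided_idealD)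
  show "\<And>a. a \<in> fst P \<Longrightarrow> br a \<in> fst P"
    "\<And>g. g \<in> snd P \<Longrightarrow> g \<in> fst P" "\<And>g. g \<in> snd P \<Longrightarrow> g \<in> Lam F"
    "\<And>c g. g \<in> snd P \<Longrightarrow> c * g * br c \<in> snd P"
    using assms by (auto simp: form_ideal_iff)
  show "\<And>a b. a \<in> fst P \<Longrightarrow> a * b \<in> fst P" "\<And>a b. a \<in> fst P \<Longrightarrow> b * a \<in> fst P"
    using two_sided_idealD[OF t(1)] by auto
  show "\<And>a. a \<in> fst P \<Longrightarrow> a - lm * br a \<in> snd P"
    "\<And>a c. a \<in> fst P \<Longrightarrow> c \<in> Lam F \<Longrightarrow> a * c * br a \<in> snd P"
    using assms Gamma_min_subset_iff[OF t(2,3)] by (auto simp: form_ideal_iff)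
qed

lemma Lam_eq: "c \<in> Lam F \<Longrightarrow> c = - (lm * br c)"
  using Lam_le_max by (auto simp: Lam_max_def)

lemma form_ideal_whole: "form_ideal F whole"
proof -
  have "br ` UNIV = UNIV" using bar_bar by (metis surjI)
  moreover have "c - lm * br c \<in> Lam F" for c using Lam_min_le by (auto simp: Lam_min_def)
  moreover have "add_subgroup (UNIV :: 'a set)" by (simp add: add_subgroup_def)
  ultimately show ?thesis
    using Gamma_min_subset_iff[of UNIV "Lam F"]
    by (simp add: form_ideal_iff two_sided_ideal_def add_subgroup_Lam Lam_closed)
qed

lemma part_zero: "form_ideal F P \<Longrightarrow> i \<noteq> 0 \<Longrightarrow> 0 \<in> part P i j"
  by (cases "j = - i") (auto simp: mem_part_long_iff part_short form_idealD add_subgroupD)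

lemma part_add: "form_ideal F P \<Longrightarrow> i \<noteq> 0 \<Longrightarrow> a \<in> part P i j \<Longrightarrow> b \<in> part P i j \<Longrightarrow> a + b \<in> part P i j"
  by (cases "j = - i")
    (auto simp: mem_part_long_iff part_short form_idealD add_subgroupD distrib_left split: if_splits)

lemma part_minus: "form_ideal F P \<Longrightarrow> i \<noteq> 0 \<Longrightarrow> a \<in> part P i j \<Longrightarrow> - a \<in> part P i j"
  by (cases "j = - i")
    (auto simp: mem_part_long_iff part_short form_idealD add_subgroupD split: if_splits)

lemma part_subset_fst:
  assumes "form_ideal F P" "i \<noteq> 0" "a \<in> part P i j" shows "a \<in> fst P"
proof (cases "j = - i")
  case True
  show ?thesis
  proof (cases "i > 0")
    case True
    then have "br lm * (lm * a) \<in> fst P"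
      using assms \<open>j = - i\<close> by (simp add: mem_part_long_iff form_idealD)
    then show ?thesis by (simp add: lam_simps)
  qed (use assms True in \<open>simp add: mem_part_long_iff form_idealD\<close>)
qed (use assms in \<open>simp add: part_short\<close>)

lemma part_subset_whole:
  assumes "form_ideal F P" "i \<noteq> 0" "a \<in> part P i j" shows "a \<in> part whole i j"
  using assms by (cases "j = - i") (auto simp: mem_part_long_iff part_short form_idealD split: if_splits)

lemma part_same_sign:
  assumes "i \<noteq> 0" "sgn i = sgn k" shows "part P i (- i) = part P k (- k)"
  using assms by (auto simp: mem_part_long_iff sgn_if split: if_splits)

lemma dual_entry_mem:
  assumes "form_ideal F P" "a \<in> fst P" shows "dual_entry i j a \<in> fst P"
  using assms by (simp add: dual_entry_def form_idealD)

text \<open>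
  The conditions under which elementary commutators between \<open>P\<close> and \<open>Q\<close> have coefficients in \<open>W\<close>.
  Besides \<open>W = P \<circ> Q\<close> they hold for \<open>Q\<close> the whole form ring and \<open>W = P\<close>, so that one commutator
  formula serves both the symmetrised product and the action of the absolute group.
\<close>

definition prod_le :: "'a set \<times> 'a set \<Rightarrow> 'a set \<times> 'a set \<Rightarrow> 'a set \<times> 'a set \<Rightarrow> bool" where
  "prod_le P Q W \<longleftrightarrow> form_ideal F P \<and> form_ideal F Q \<and> form_ideal F W \<and>
     (\<forall>a\<in>fst P. \<forall>b\<in>fst Q. a * b \<in> fst W \<and> b * a \<in> fst W) \<and>
     (\<forall>b\<in>fst Q. \<forall>g\<in>snd P. b * g * br b \<in> snd W) \<and>
     (\<forall>a\<in>fst P. \<forall>d\<in>snd Q. a * d * br a \<in> snd W)"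

lemma prod_le_sym: "prod_le P Q W \<Longrightarrow> prod_le Q P W"
  by (auto simp: prod_le_def)

lemma prod_le_whole: "form_ideal F P \<Longrightarrow> prod_le P whole P"
  by (auto simp: prod_le_def form_ideal_whole form_idealD)

lemma prod_le_mult_mem: "prod_le P Q W \<Longrightarrow> a \<in> fst P \<Longrightarrow> b \<in> fst Q \<Longrightarrow> a * b \<in> fst W"
  by (auto simp: prod_le_def)

text \<open>
  For negative \<open>i\<close> the coefficient is the trace of \<open>x\<close>; for positive \<open>i\<close>, multiplication with \<open>\<lambda>\<close> turns
  it into minus the trace of the conjugate of \<open>x\<close>.
\<close>

lemma trace_mem_part:
  assumes W: "form_ideal F W" and x: "x \<in> fst W" and i: "i \<noteq> 0"
  shows "x - dual_entry i (- i) x \<in> part W i (- i)"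
proof (cases "i > 0")
  case True
  have "br x - lm * br (br x) \<in> snd W" using W x by (simp add: form_idealD)
  then have "- (br x - lm * br (br x)) \<in> snd W" using W by (simp only: add_subgroupD form_idealD)
  then show ?thesis using True W x
    by (simp add: mem_part_long_iff dual_entry_cases right_diff_distrib bar_bar lam_simps)
next
  case False
  then show ?thesis using i W x
    by (auto simp: mem_part_long_iff dual_entry_cases form_idealD)
qed

text \<open>
  These are the two coefficients in the commutator of a long with a short root element.
  The powers of \<open>\<lambda>\<close> add up in such a way that the second one corresponds to minus the twist of an
  element of the form parameter of \<open>P\<close> by the conjugate of \<open>b\<close>.
\<close>

lemma prod_le_long_mem:
  assumes PQ: "prod_le P Q W" and a: "a \<in> part P i (- i)" and b: "b \<in> fst Q"
    and ij: "i \<noteq> 0" "j \<noteq> 0"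
  shows "a * b \<in> fst W" "- (dual_entry (- i) j b * a * b) \<in> part W (- j) j"
proof -
  have F: "form_ideal F P" "form_ideal F Q" "form_ideal F W" using PQ by (auto simp: prod_le_def)
  have "a \<in> fst P" using F a ij part_subset_fst by blast
  then show "a * b \<in> fst W" using PQ b by (simp add: prod_le_mult_mem)
  define g where "g = (if i > 0 then lm * a else a)"
  have g: "g \<in> snd P" using a ij by (simp add: g_def mem_part_long_iff)
  have "br b * g * br (br b) \<in> snd W" using PQ g b F(2) by (simp add: prod_le_def form_idealD)
  then have "- (br b * g * b) \<in> snd W"
    using add_subgroupD(3)[OF form_idealD(3)[OF F(3)]] by (simp add: bar_bar)
  moreover have "(if - j > 0 then lm * - (dual_entry (- i) j b * a * b)
      else - (dual_entry (- i) j b * a * b)) = - (br b * g * b)"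
    using ij by (auto simp: g_def dual_entry_cases sgn_if mult.assoc lam_simps)
  moreover have "- (dual_entry (- i) j b * a * b) \<in> part W (- j) (- (- j)) \<longleftrightarrow>
      (if - j > 0 then lm * - (dual_entry (- i) j b * a * b)
      else - (dual_entry (- i) j b * a * b)) \<in> snd W"
    using ij by (intro mem_part_long_iff) auto
  ultimately show "- (dual_entry (- i) j b * a * b) \<in> part W (- j) j" by (simp only: minus_minus)
qed

lemma twist_subset_iff:
  "add_subgroup M \<Longrightarrow> twist F J \<Gamma> \<subseteq> M \<longleftrightarrow> (\<forall>b\<in>J. \<forall>g\<in>\<Gamma>. b * g * br b \<in> M)"
  by (auto simp: twist_def group_closure_subset_iff)

lemma add_subgroup_twist: "add_subgroup (twist F J \<Gamma>)"
  by (simp add: twist_def add_subgroup_group_closure)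

lemma add_subgroup_Gamma_min: "add_subgroup J \<Longrightarrow> add_subgroup (Gamma_min F J)"
  by (simp add: Gamma_min_def add_subgroup_set_plus add_subgroup_traces add_subgroup_group_closure)

lemma form_prod_eq:
  "form_prod F P Q =
    (ideal_mult (fst P) (fst Q) + ideal_mult (fst Q) (fst P),
     Gamma_min F (ideal_mult (fst P) (fst Q) + ideal_mult (fst Q) (fst P))
       + twist F (fst Q) (snd P) + twist F (fst P) (snd Q))"
  by (cases P, cases Q) (simp add: form_prod.simps Let_def)

lemma fst_form_prod_subset_iff:
  assumes "add_subgroup M"
  shows "fst (form_prod F P Q) \<subseteq> M \<longleftrightarrow> (\<forall>a\<in>fst P. \<forall>b\<in>fst Q. a * b \<in> M \<and> b * a \<in> M)"
  using assms
  by (auto simp: form_prod_eq ideal_mult_def set_plus_subset_iff add_subgroup_group_closure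
      group_closure_subset_iff)

lemma snd_form_prod_subset_iff:
  assumes "form_ideal F P" "form_ideal F Q" "add_subgroup M"
  shows "snd (form_prod F P Q) \<subseteq> M \<longleftrightarrow> Gamma_min F (fst (form_prod F P Q)) \<subseteq> M \<and>
    (\<forall>b\<in>fst Q. \<forall>g\<in>snd P. b * g * br b \<in> M) \<and> (\<forall>a\<in>fst P. \<forall>d\<in>snd Q. a * d * br a \<in> M)"
  using assms
  by (simp add: form_prod_eq set_plus_subset_iff add_subgroup_twist add_subgroup_Gamma_min
      add_subgroup_set_plus ideal_mult_def add_subgroup_group_closure twist_subset_iff)

lemma fst_form_prod_ideal:
  assumes "form_ideal F P" "form_ideal F Q" shows "two_sided_ideal (fst (form_prod F P Q))"
  using assms by (simp add: form_prod_eq two_sided_ideal_set_plus two_sided_ideal_ideal_mult form_idealD)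

lemma snd_form_prod_subgroup:
  assumes "form_ideal F P" "form_ideal F Q" shows "add_subgroup (snd (form_prod F P Q))"
  using assms two_sided_idealD(1)[OF fst_form_prod_ideal[OF assms]]
  by (simp add: form_prod_eq add_subgroup_twist add_subgroup_Gamma_min add_subgroup_set_plus)

text \<open>
  Both components are spanned by explicit elements, and every closure property carves out an
  additive subgroup, so that it need only be checked on the spanning elements.
\<close>

lemma form_ideal_form_prod:
  assumes P: "form_ideal F P" and Q: "form_ideal F Q"
  shows "form_ideal F (form_prod F P Q)"
proof -
  let ?K = "fst (form_prod F P Q)" and ?T = "snd (form_prod F P Q)"
  note K = two_sided_idealD[OF fst_form_prod_ideal[OF P Q]]
  note T = snd_form_prod_subgroup[OF P Q]
  have prods: "a * b \<in> ?K" "b * a \<in> ?K" if "a \<in> fst P" "b \<in> fst Q" for a b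
    using fst_form_prod_subset_iff[OF K(1), of P Q] that by auto
  have "?K \<subseteq> {x. br x \<in> ?K}"
  proof (subst fst_form_prod_subset_iff)
    show "add_subgroup {x. br x \<in> ?K}"
      using K(1) by (auto simp: add_subgroup_def bar_add)
    show "\<forall>a\<in>fst P. \<forall>b\<in>fst Q. a * b \<in> {x. br x \<in> ?K} \<and> b * a \<in> {x. br x \<in> ?K}"
      using form_idealD(4)[OF P] form_idealD(4)[OF Q] by (simp add: bar_mult prods)
  qed
  then have bar: "br ` ?K = ?K" by (auto simp: image_iff) (metis bar_bar mem_Collect_eq subsetD)
  have gens: "Gamma_min F ?K \<subseteq> ?T" "\<forall>b\<in>fst Q. \<forall>g\<in>snd P. b * g * br b \<in> ?T"
    "\<forall>a\<in>fst P. \<forall>d\<in>snd Q. a * d * br a \<in> ?T"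
    using snd_form_prod_subset_iff[OF P Q T] by auto
  have min: "\<forall>a\<in>?K. a - lm * br a \<in> ?T" "\<forall>a\<in>?K. \<forall>c\<in>Lam F. a * c * br a \<in> ?T"
    using gens(1) by (auto simp: Gamma_min_subset_iff[OF K(1) T])
  have sg: "add_subgroup (?K \<inter> Lam F)"
    using K(1) add_subgroup_Lam by (auto simp: add_subgroup_def)
  have "?T \<subseteq> ?K \<inter> Lam F"
    unfolding snd_form_prod_subset_iff[OF P Q sg]
  proof (intro conjI)
    have "br a \<in> ?K" if "a \<in> ?K" for a using bar that by blast
    then show "Gamma_min F ?K \<subseteq> ?K \<inter> Lam F"
      unfolding Gamma_min_subset_iff[OF K(1) sg]
      using K(2,3) form_idealD(10)[OF form_ideal_whole] add_subgroupD(4)[OF K(1)]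
      by (simp add: Lam_closed)
    show "\<forall>b\<in>fst Q. \<forall>g\<in>snd P. b * g * br b \<in> ?K \<inter> Lam F"
      "\<forall>a\<in>fst P. \<forall>d\<in>snd Q. a * d * br a \<in> ?K \<inter> Lam F"
      using P Q by (simp_all add: Lam_closed form_idealD K(3) prods)
  qed
  moreover have "c * g * br c \<in> ?T" if "g \<in> ?T" for c g
  proof -
    have eq: "c * (a * d * br a) * br c = (c * a) * d * br (c * a)" for a d
      by (simp add: bar_mult mult.assoc)
    have sg: "add_subgroup {g. c * g * br c \<in> ?T}"
      using T by (auto simp: add_subgroup_def distrib_left distrib_right)
    have "?T \<subseteq> {g. c * g * br c \<in> ?T}"
      unfolding snd_form_prod_subset_iff[OF P Q sg]
    proof (intro conjI)
      have "c * (a - lm * br a) * br c = c * a * br c - lm * br (c * a * br c)" for a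
        by (simp add: bar_mult bar_bar right_diff_distrib left_diff_distrib mult.assoc lam_simps)
      then show "Gamma_min F ?K \<subseteq> {g. c * g * br c \<in> ?T}"
        using min K by (auto simp: Gamma_min_subset_iff[OF K(1) sg] eq)
      show "\<forall>b\<in>fst Q. \<forall>g\<in>snd P. b * g * br b \<in> {g. c * g * br c \<in> ?T}"
        "\<forall>a\<in>fst P. \<forall>d\<in>snd Q. a * d * br a \<in> {g. c * g * br c \<in> ?T}"
        using gens P Q by (auto simp: eq form_idealD)
    qed
    then show ?thesis using that by blast
  qed
  ultimately show ?thesis
    using T bar gens(1) fst_form_prod_ideal[OF P Q] by (simp add: form_ideal_iff)
qed

lemma prod_le_form_prod:
  assumes "form_ideal F P" "form_ideal F Q" shows "prod_le P Q (form_prod F P Q)"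
  using assms form_ideal_form_prod[OF assms]
    fst_form_prod_subset_iff[of "fst (form_prod F P Q)" P Q]
    snd_form_prod_subset_iff[OF assms, of "snd (form_prod F P Q)"]
  by (auto simp: prod_le_def form_idealD)

end

section \<open>Steinberg relations\<close>

text \<open>
  The group \<open>G\<close> stands for the absolute elementary group and \<open>T i j a\<close> for its root elements. The
  assumptions are the Steinberg relations; nothing else about matrices is needed.
\<close>

locale unitary_steinberg = form_ring F + group G
  for F :: "('a::{ring, monoid_mult}) form_data" and G :: "('g, 'b) monoid_scheme" (structure) +
  fixes n :: nat and T :: "int \<Rightarrow> int \<Rightarrow> 'a \<Rightarrow> 'g"
  assumes four_le: "4 \<le> n"
    and T_closed: "\<lbrakk>i \<in> Omega n; j \<in> Omega n; i \<noteq> j; a \<in> part whole i j\<rbrakk> \<Longrightarrow> T i j a \<in> carrier G"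
    and carrier_eq: "carrier G =
      generate G {T i j a | i j a. i \<in> Omega n \<and> j \<in> Omega n \<and> i \<noteq> j \<and> a \<in> part whole i j}"
    and T_add: "\<lbrakk>i \<in> Omega n; j \<in> Omega n; i \<noteq> j; a \<in> part whole i j; b \<in> part whole i j\<rbrakk>
      \<Longrightarrow> T i j (a + b) = T i j a \<otimes> T i j b"
    and T_dual: "\<lbrakk>i \<in> Omega n; j \<in> Omega n; \<bar>i\<bar> \<noteq> \<bar>j\<bar>\<rbrakk>
      \<Longrightarrow> T (- j) (- i) (- dual_entry i j a) = T i j a"
    and T_commute: "\<lbrakk>i \<in> Omega n; j \<in> Omega n; i \<noteq> j; h \<in> Omega n; k \<in> Omega n; h \<noteq> k;
        h \<noteq> j; h \<noteq> - i; k \<noteq> i; k \<noteq> - j; a \<in> part whole i j; b \<in> part whole h k\<rbrakk>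
      \<Longrightarrow> T i j a \<otimes> T h k b = T h k b \<otimes> T i j a"
    and T_comm_short: "\<lbrakk>i \<in> Omega n; j \<in> Omega n; k \<in> Omega n; \<bar>i\<bar> \<noteq> \<bar>j\<bar>; \<bar>j\<bar> \<noteq> \<bar>k\<bar>; \<bar>i\<bar> \<noteq> \<bar>k\<bar>\<rbrakk>
      \<Longrightarrow> comm (T i j a) (T j k b) = T i k (a * b)"
    and T_comm_long: "\<lbrakk>i \<in> Omega n; j \<in> Omega n; \<bar>i\<bar> \<noteq> \<bar>j\<bar>\<rbrakk>
      \<Longrightarrow> comm (T i j a) (T j (- i) b) = T i (- i) (a * b - dual_entry i (- i) (a * b))"
    and T_comm_long_short: "\<lbrakk>i \<in> Omega n; j \<in> Omega n; \<bar>i\<bar> \<noteq> \<bar>j\<bar>; a \<in> part whole i (- i)\<rbrakk>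
      \<Longrightarrow> comm (T i (- i) a) (T (- i) j b) = T i j (a * b) \<otimes> T (- j) j (- (dual_entry (- i) j b * a * b))"
begin

definition root :: "int \<Rightarrow> int \<Rightarrow> bool" where
  "root i j \<longleftrightarrow> i \<in> Omega n \<and> j \<in> Omega n \<and> i \<noteq> j"

text \<open>
  \<open>(i, j)\<close> and \<open>(-j, -i)\<close> are two names of one root, by the relation \<open>T_dual\<close>. The opposite root is
  \<open>(j, i)\<close>, so that \<open>same_root j i h k\<close> says that \<open>(i, j)\<close> and \<open>(h, k)\<close> are opposite.
\<close>

definition same_root :: "int \<Rightarrow> int \<Rightarrow> int \<Rightarrow> int \<Rightarrow> bool" where
  "same_root i j h k \<longleftrightarrow> (h = i \<and> k = j) \<or> (h = - j \<and> k = - i)"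

text \<open>
  An odd function on the indices is a cocharacter: it grades the root \<open>(i, j)\<close> by \<open>f i - f j\<close>, which
  is well defined because \<open>(-j, -i)\<close> gets the same degree.
\<close>

definition odd_fun :: "(int \<Rightarrow> int) \<Rightarrow> bool" where
  "odd_fun f \<longleftrightarrow> (\<forall>x. f (- x) = - f x)"

definition elem :: "'a set \<times> 'a set \<Rightarrow> 'g set" where
  "elem P = {T i j a | i j a. root i j \<and> a \<in> part P i j}"

text \<open>
  The unrelativised elementary subgroup, that is, before taking the normal closure.
\<close>

definition FU :: "'a set \<times> 'a set \<Rightarrow> 'g set" where
  "FU P = generate G (elem P)"

text \<open>
  The level \<open>P\<close> subgroup of the unipotent radical of the parabolic subgroup defined by \<open>f\<close>.
\<close>

definition unip :: "(int \<Rightarrow> int) \<Rightarrow> 'a set \<times> 'a set \<Rightarrow> 'g set" where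
  "unip f P = generate G {T i j a | i j a. root i j \<and> f j < f i \<and> a \<in> part P i j}"

lemma Omega_simps [simp]: "- i \<in> Omega n \<longleftrightarrow> i \<in> Omega n" "0 \<notin> Omega n"
  by (auto simp: Omega_def)

lemma rootD: "root i j \<Longrightarrow> i \<in> Omega n" "root i j \<Longrightarrow> j \<in> Omega n" "root i j \<Longrightarrow> i \<noteq> j"
  "root i j \<Longrightarrow> i \<noteq> 0" "root i j \<Longrightarrow> j \<noteq> 0"
  by (auto simp: root_def)

lemma root_swap: "root i j \<Longrightarrow> root j i"
  by (auto simp: root_def)

lemma root_dual: "root (- j) (- i) \<longleftrightarrow> root i j"
  by (auto simp: root_def)

lemma root_long [simp]: "root i (- i) \<longleftrightarrow> i \<in> Omega n" "root (- i) i \<longleftrightarrow> i \<in> Omega n"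
  by (auto simp: root_def)

lemma root_mem_whole:
  "\<lbrakk>form_ideal F P; root i j; a \<in> part P i j\<rbrakk> \<Longrightarrow> a \<in> part whole i j"
  using part_subset_whole rootD(4) by blast

lemma T_in_carrier [simp, intro]:
  "\<lbrakk>form_ideal F P; root i j; a \<in> part P i j\<rbrakk> \<Longrightarrow> T i j a \<in> carrier G"
  using T_closed root_mem_whole rootD by metis

lemma T_in_carrier_whole [simp, intro]: "\<lbrakk>root i j; a \<in> part whole i j\<rbrakk> \<Longrightarrow> T i j a \<in> carrier G"
  using form_ideal_whole by blast

lemma T_zero: "root i j \<Longrightarrow> T i j 0 = \<one>"
proof -
  assume r: "root i j"
  have z: "0 \<in> part whole i j" using r by (simp add: part_zero[OF form_ideal_whole] rootD)
  then have "T i j 0 \<otimes> T i j 0 = T i j 0" using T_add[of i j 0 0] r by (simp add: rootD)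
  then show ?thesis using l_cancel_one[of "T i j 0" "T i j 0"] r z by auto
qed

lemma T_minus:
  assumes "root i j" "a \<in> part whole i j" shows "T i j (- a) = inv (T i j a)"
proof -
  have m: "- a \<in> part whole i j" using assms by (simp add: part_minus[OF form_ideal_whole] rootD)
  then have "T i j (- a) \<otimes> T i j a = T i j 0" using T_add[of i j "- a" a] assms by (simp add: rootD)
  then have "T i j (- a) \<otimes> T i j a = \<one>" using assms by (simp add: T_zero)
  then show ?thesis using assms m inv_equality[of "T i j (- a)" "T i j a"] by auto
qed

lemma dual_rep:
  assumes P: "form_ideal F P" and "root i j" "same_root i j h k" "a \<in> part P h k"
  obtains b where "b \<in> part P i j" "T h k a = T i j b"
proof (cases "h = i \<and> k = j")
  case True
  then show ?thesis using assms that by blast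
next
  case False
  then have hk: "h = - j" "k = - i" "j \<noteq> - i" using assms(3) by (auto simp: same_root_def)
  then have "- dual_entry h k a \<in> part P i j"
    using assms(4) P by (auto simp: part_short dual_entry_mem form_idealD add_subgroupD)
  moreover have "T h k a = T i j (- dual_entry h k a)"
    using T_dual[of h k a] hk assms(2) by (auto simp: root_def)
  ultimately show ?thesis using that by blast
qed

lemma elem_carrier: "form_ideal F P \<Longrightarrow> elem P \<subseteq> carrier G"
  by (auto simp: elem_def)

lemma T_mem_elem: "root i j \<Longrightarrow> a \<in> part P i j \<Longrightarrow> T i j a \<in> elem P"
  by (auto simp: elem_def)

lemma T_mem_FU: "root i j \<Longrightarrow> a \<in> part P i j \<Longrightarrow> T i j a \<in> FU P"
  by (auto simp: FU_def intro: generate.incl T_mem_elem)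

lemma T_mem_unip: "root i j \<Longrightarrow> f j < f i \<Longrightarrow> a \<in> part P i j \<Longrightarrow> T i j a \<in> unip f P"
  by (auto simp: unip_def intro: generate.incl)

lemma subgroup_FU: "form_ideal F P \<Longrightarrow> subgroup (FU P) G"
  unfolding FU_def by (rule generate_is_subgroup[OF elem_carrier])

lemma unip_gens_carrier:
  "form_ideal F P \<Longrightarrow> {T i j a | i j a. root i j \<and> f j < f i \<and> a \<in> part P i j} \<subseteq> carrier G"
  by auto

lemma subgroup_unip: "form_ideal F P \<Longrightarrow> subgroup (unip f P) G"
  unfolding unip_def by (rule generate_is_subgroup[OF unip_gens_carrier])

lemma unip_subset_FU: "unip f P \<subseteq> FU P"
  unfolding unip_def FU_def elem_def by (rule mono_generate) blast

lemma FU_whole: "FU whole = carrier G"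
  unfolding FU_def elem_def root_def carrier_eq by simp

lemma comm_eq_oneI:
  assumes "root i j" "root h k" "h \<noteq> j" "h \<noteq> - i" "k \<noteq> i" "k \<noteq> - j"
    "a \<in> part whole i j" "b \<in> part whole h k"
  shows "comm (T i j a) (T h k b) = \<one>"
  using T_commute[of i j h k a b] assms by (simp add: comm_eq_one_iff rootD)

section \<open>The graded commutator formula\<close>

lemma comm_short_mem_unip:
  assumes PQ: "prod_le P Q W" and f: "odd_fun f"
    and ij: "root i j" "j \<noteq> - i" and jk: "root j k" "k \<noteq> - j" and ki: "k \<noteq> i"
    and a: "a \<in> fst P" and b: "b \<in> fst Q" and pos: "f k < f i"
  shows "comm (T i j a) (T j k b) \<in> unip f W"
proof -
  have W: "form_ideal F W" using PQ by (simp add: prod_le_def)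
  have ab: "a * b \<in> fst W" using PQ a b by (rule prod_le_mult_mem)
  have neq: "\<bar>i\<bar> \<noteq> \<bar>j\<bar>" "\<bar>j\<bar> \<noteq> \<bar>k\<bar>" using ij jk by (auto simp: root_def)
  show ?thesis
  proof (cases "k = - i")
    case True
    have "comm (T i j a) (T j k b) = T i (- i) (a * b - dual_entry i (- i) (a * b))"
      using T_comm_long[of i j a b] neq ij True by (simp add: root_def)
    moreover have "a * b - dual_entry i (- i) (a * b) \<in> part W i (- i)"
      using trace_mem_part[OF W ab] ij by (simp add: rootD)
    ultimately show ?thesis using T_mem_unip[of i "- i"] ij pos True by (simp add: rootD)
  next
    case False
    then have "comm (T i j a) (T j k b) = T i k (a * b)"
      using T_comm_short[of i j k a b] neq ij jk ki by (auto simp: root_def)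
    moreover have "root i k" using ij jk ki by (simp add: root_def)
    ultimately show ?thesis using T_mem_unip[of i k] pos ab False by (simp add: part_short)
  qed
qed

lemma comm_long_short_mem_unip:
  assumes PQ: "prod_le P Q W" and f: "odd_fun f"
    and i: "i \<in> Omega n" and ij: "root (- i) j" "j \<noteq> i"
    and a: "a \<in> part P i (- i)" and b: "b \<in> fst Q"
    and pos: "0 \<le> f i" "0 \<le> - f i - f j" "0 < f i - f j"
  shows "comm (T i (- i) a) (T (- i) j b) \<in> unip f W"
proof -
  have W: "form_ideal F W" "form_ideal F P" using PQ by (auto simp: prod_le_def)
  have nz: "i \<noteq> 0" "j \<noteq> 0" using ij by (auto simp: root_def)
  have neq: "\<bar>i\<bar> \<noteq> \<bar>j\<bar>" using ij by (auto simp: root_def)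
  have r: "root i j" "root (- j) j" using ij i by (auto simp: root_def)
  have eq: "comm (T i (- i) a) (T (- i) j b) =
      T i j (a * b) \<otimes> T (- j) j (- (dual_entry (- i) j b * a * b))"
    using T_comm_long_short[of i j a b] neq i ij a nz part_subset_whole[OF W(2), of i a "- i"]
    by (simp add: root_def)
  have "T i j (a * b) \<in> unip f W"
    using T_mem_unip[OF r(1)] pos prod_le_long_mem(1)[OF PQ a b nz] neq by (auto simp: part_short)
  moreover have "f j < f (- j)" using pos f by (simp add: odd_fun_def)
  then have "T (- j) j (- (dual_entry (- i) j b * a * b)) \<in> unip f W"
    using T_mem_unip[OF r(2)] prod_le_long_mem(2)[OF PQ a b nz] by simp
  ultimately show ?thesis unfolding eq using subgroup_unip[OF W(1)] by (simp add: subgroup.m_closed)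
qed

text \<open>
  For consecutive roots exactly one of the Steinberg relations computes the commutator, depending on
  whether \<open>j = - i\<close>, \<open>k = - i\<close> or neither. If the second root is the long one, the roots have to be
  exchanged first.
\<close>

lemma comm_chain_mem_unip_aux:
  assumes PQ: "prod_le P Q W" and f: "odd_fun f"
    and ij: "root i j" and jk: "root j k" and short: "k \<noteq> - j"
    and a: "a \<in> part P i j" and b: "b \<in> part Q j k"
    and pos: "f j \<le> f i" "f k \<le> f j" "f k < f i"
  shows "comm (T i j a) (T j k b) \<in> unip f W"
proof (cases "j = - i")
  case True
  then show ?thesis
    using comm_long_short_mem_unip[OF PQ f, of i k a b] assms
    by (auto simp: part_short odd_fun_def root_def)
next
  case False
  then show ?thesis
    using comm_short_mem_unip[OF PQ f ij _ jk short, of a b] a b pos short by (auto simp: part_short)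
qed

lemma comm_chain_mem_unip:
  assumes PQ: "prod_le P Q W" and f: "odd_fun f"
    and ij: "root i j" and jk: "root j k"
    and a: "a \<in> part P i j" and b: "b \<in> part Q j k"
    and pos: "f j \<le> f i" "f k \<le> f j" "f k < f i"
  shows "comm (T i j a) (T j k b) \<in> unip f W"
proof (cases "k = - j")
  case False
  then show ?thesis using comm_chain_mem_unip_aux assms by blast
next
  case True
  have F: "form_ideal F P" "form_ideal F Q" "form_ideal F W" using PQ by (auto simp: prod_le_def)
  have ne: "j \<noteq> - i" using pos True by auto
  obtain a' where a': "a' \<in> part P (- j) (- i)" "T i j a = T (- j) (- i) a'"
    using dual_rep[OF F(1), of "- j" "- i" i j a] a ij ne
    by (auto simp: root_dual same_root_def)
  have "comm (T j k b) (T (- j) (- i) a') \<in> unip f W"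
    using comm_chain_mem_unip_aux[OF prod_le_sym[OF PQ] f jk, of "- i" b a'] True a' b ij ne pos f
    by (auto simp: root_dual odd_fun_def)
  then have "inv (comm (T j k b) (T i j a)) \<in> unip f W"
    using a'(2) subgroup_unip[OF F(3)] by (simp add: subgroup.m_inv_closed)
  then show ?thesis using F a b ij jk by (simp add: inv_comm)
qed

text \<open>
  The Chevalley commutator formula in graded form: all roots in the commutator are combinations of
  the two given roots with positive coefficients, hence of positive degree. The two names of each
  root and the symmetry of the commutator reduce all cases with a nontrivial commutator to that of
  two roots \<open>(i, j)\<close> and \<open>(j, k)\<close>.
\<close>

lemma comm_mem_unip:
  assumes PQ: "prod_le P Q W" and f: "odd_fun f"
    and ij: "root i j" and hk: "root h k" and a: "a \<in> part P i j" and b: "b \<in> part Q h k"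
    and pos: "f j \<le> f i" "f k \<le> f h" "f j + f k < f i + f h"
  shows "comm (T i j a) (T h k b) \<in> unip f W"
proof -
  have F: "form_ideal F P" "form_ideal F Q" "form_ideal F W" using PQ by (auto simp: prod_le_def)
  have chain: "comm (T x y c) (T y z d) \<in> unip f W \<and> comm (T y z d) (T x y c) \<in> unip f W"
    if "prod_le P' Q' W" "root x y" "root y z" "c \<in> part P' x y" "d \<in> part Q' y z"
      "f y \<le> f x" "f z \<le> f y" "f z < f x" for P' Q' x y z c d
  proof -
    have F': "form_ideal F P'" "form_ideal F Q'" using that by (auto simp: prod_le_def)
    have "comm (T x y c) (T y z d) \<in> unip f W" using comm_chain_mem_unip[OF that(1) f] that by blast
    moreover from this have "inv (comm (T x y c) (T y z d)) \<in> unip f W"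
      using subgroup_unip[OF F(3)] by (simp add: subgroup.m_inv_closed)
    ultimately show ?thesis using F' that by (simp add: inv_comm)
  qed
  note fodd = f[unfolded odd_fun_def, rule_format]
  consider "h = j" | "k = i" | "h = - i" "j \<noteq> - i" | "k = - j" "k \<noteq> - h"
    | "h \<noteq> j" "k \<noteq> i" "h \<noteq> - i" "k \<noteq> - j" by auto
  then show ?thesis
  proof cases
    case 1
    then show ?thesis using chain[OF PQ ij, of k a b] hk a b pos by auto
  next
    case 2
    then show ?thesis using chain[OF prod_le_sym[OF PQ] hk, of j b a] ij a b pos by auto
  next
    case 3
    obtain a' where "a' \<in> part P (- j) (- i)" "T i j a = T (- j) (- i) a'"
      using dual_rep[OF F(1), of "- j" "- i" i j a] a ij by (auto simp: root_dual same_root_def)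
    then show ?thesis
      using chain[OF PQ, of "- j" "- i" k a' b] hk b pos ij 3 by (auto simp: root_dual fodd)
  next
    case 4
    obtain b' where "b' \<in> part Q (- k) (- h)" "T h k b = T (- k) (- h) b'"
      using dual_rep[OF F(2), of "- k" "- h" h k b] b hk by (auto simp: root_dual same_root_def)
    then show ?thesis
      using chain[OF PQ ij, of "- h" a b'] hk a pos 4
      by (auto simp: fodd root_def)
  next
    case 5
    then have "comm (T i j a) (T h k b) = \<one>"
      using comm_eq_oneI[OF ij hk] a b ij hk F root_mem_whole by blast
    then show ?thesis using subgroup_unip[OF F(3)] by (simp add: subgroup.one_closed)
  qed
qed

text \<open>
  Roots that are not proportional are separated by a cocharacter that vanishes on the first one: some
  coordinate function, up to sign, does it unless the indices of the second root occur, up to sign, in the first one.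
\<close>

lemma exists_parabolic:
  assumes ij: "root i j" and hk: "root h k"
    and ne: "\<not> same_root i j h k" "\<not> same_root j i h k"
  shows "\<exists>f. odd_fun f \<and> f i = f j \<and> f k < f h"
proof -
  define d :: "int \<Rightarrow> int \<Rightarrow> int" where
    "d x y = (if y = x then 1 else if y = - x then - 1 else 0)" for x y
  have odd: "odd_fun (d x)" if "x \<noteq> 0" for x
    using that by (auto simp: odd_fun_def d_def)
  have nz: "i \<noteq> 0" "j \<noteq> 0" "h \<noteq> 0" "k \<noteq> 0" "i \<noteq> j" "h \<noteq> k"
    using ij hk by (auto dest: rootD)
  have d_self: "d x x = 1" for x by (simp add: d_def)
  have d_neg: "d x (- x) = - 1" if "x \<noteq> 0" for x using that by (simp add: d_def)
  have d_off: "d x y = 0" if "\<bar>y\<bar> \<noteq> \<bar>x\<bar>" for x y using that by (auto simp: d_def)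
  have d_less: "d x y < 1" if "y \<noteq> x" for x y using that by (simp add: d_def)
  consider "\<bar>h\<bar> \<noteq> \<bar>i\<bar>" "\<bar>h\<bar> \<noteq> \<bar>j\<bar>" | "\<bar>k\<bar> \<noteq> \<bar>i\<bar>" "\<bar>k\<bar> \<noteq> \<bar>j\<bar>"
    | "\<bar>h\<bar> = \<bar>i\<bar> \<or> \<bar>h\<bar> = \<bar>j\<bar>" "\<bar>k\<bar> = \<bar>i\<bar> \<or> \<bar>k\<bar> = \<bar>j\<bar>" by blast
  then show ?thesis
  proof cases
    case 1
    then have "d h i = d h j" "d h k < d h h" using nz by (simp_all add: d_off d_self d_less)
    then show ?thesis using odd[OF nz(3)] by blast
  next
    case 2
    then have "- d k i = - d k j" "- d k k < - d k h" using nz by (simp_all add: d_off d_self d_less)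
    moreover have "odd_fun (\<lambda>x. - d k x)" using odd[OF nz(4)] by (auto simp: odd_fun_def)
    ultimately show ?thesis by (intro exI[of _ "\<lambda>x. - d k x"]) blast
  next
    case 3
    have mem: "h \<in> {i, - i, j, - j}" "k \<in> {i, - i, j, - j}" using 3 by (auto simp: abs_eq_iff)
    have "j \<noteq> - i"
      using mem nz ne by (auto simp: same_root_def)
    then have ij': "\<bar>i\<bar> \<noteq> \<bar>j\<bar>" using nz by (auto simp: abs_eq_iff)
    note vals = d_self d_neg[OF nz(1)] d_neg[OF nz(2)] d_off[of j i] d_off[of "- j" i]
      d_off[of i j] d_off[of "- i" j]
    \<comment> \<open>both roots lie in the plane of two indices, and \<open>g\<close> spans the orthogonal complement of \<open>(i, j)\<close> there\<close>
    define g where "g x = d i x + d j x" for x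
    have g: "g i = 1" "g (- i) = - 1" "g j = 1" "g (- j) = - 1"
      using ij' by (simp_all add: g_def vals)
    have "odd_fun g" using odd[OF nz(1)] odd[OF nz(2)] by (simp add: odd_fun_def g_def)
    moreover have "odd_fun (\<lambda>x. - g x)" using \<open>odd_fun g\<close> by (simp add: odd_fun_def)
    moreover have "g k \<noteq> g h"
    proof
      assume eq: "g k = g h"
      have "h \<in> {i, j} \<and> k \<in> {i, j} \<or> h \<in> {- i, - j} \<and> k \<in> {- i, - j}"
        using mem eq g by fastforce
      then show False using nz ne by (auto simp: same_root_def)
    qed
    then have "g k < g h \<or> - g k < - g h" by linarith
    ultimately show ?thesis using g(1,3) by metis
  qed
qed

text \<open>
  Only opposite roots cannot lie in a common half-space; for equal roots the root itself serves as
  cocharacter.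
\<close>

lemma exists_parabolic_pos:
  assumes ij: "root i j" and hk: "root h k" and ne: "\<not> same_root j i h k"
  shows "\<exists>f. odd_fun f \<and> f j \<le> f i \<and> f k < f h"
proof (cases "same_root i j h k")
  case True
  define f :: "int \<Rightarrow> int" where
    "f x = (if x = i then 1 else if x = - i then - 1 else 0) + (if x = j then - 1 else if x = - j then 1 else 0)" for x
  have "odd_fun f" using ij by (auto simp: f_def odd_fun_def root_def)
  moreover have "f j < f i" using rootD[OF ij] by (auto simp: f_def)
  ultimately show ?thesis using True
    by (intro exI[of _ f]) (auto simp: same_root_def odd_fun_def)
next
  case False
  then obtain f where "odd_fun f \<and> f i = f j \<and> f k < f h"
    using exists_parabolic[OF ij hk] ne by blast
  then show ?thesis by (intro exI[of _ f]) auto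
qed

lemma comm_mem_FU:
  assumes "prod_le P Q W" "root i j" "root h k" "\<not> same_root j i h k"
    "a \<in> part P i j" "b \<in> part Q h k"
  shows "comm (T i j a) (T h k b) \<in> FU W"
proof -
  obtain f where f: "odd_fun f" "f j \<le> f i" "f k < f h"
    using exists_parabolic_pos[OF assms(2-4)] by blast
  have "comm (T i j a) (T h k b) \<in> unip f W"
    by (rule comm_mem_unip[OF assms(1) f(1) assms(2,3,5,6) f(2)]) (use f in auto)
  then show ?thesis using unip_subset_FU by blast
qed

section \<open>Avoiding a root\<close>

lemma exists_new_index:
  assumes "finite A" "card A < n"
  shows "\<exists>k\<in>Omega n. k > 0 \<and> k \<notin> A"
proof -
  have "\<not> {1..int n} \<subseteq> A"
  proof
    assume "{1..int n} \<subseteq> A"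
    from card_mono[OF assms(1) this] assms(2) show False by simp
  qed
  then obtain k where "k \<in> {1..int n}" "k \<notin> A" by blast
  then show ?thesis by (intro bexI[of _ k]) (auto simp: Omega_def)
qed

lemma exists_index_off:
  assumes "i \<in> Omega n" "j \<in> Omega n"
  obtains k where "k \<in> Omega n" "sgn k = sgn i" "\<bar>k\<bar> \<noteq> \<bar>i\<bar>" "\<bar>k\<bar> \<noteq> \<bar>j\<bar>"
proof -
  have "card {\<bar>i\<bar>, \<bar>j\<bar>} \<le> 2" by (simp add: card_insert_if)
  then obtain k where k: "k \<in> Omega n" "k > 0" "k \<notin> {\<bar>i\<bar>, \<bar>j\<bar>}"
    using exists_new_index[of "{\<bar>i\<bar>, \<bar>j\<bar>}"] four_le by auto
  have "i \<noteq> 0" using assms by (metis Omega_simps(2))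
  show ?thesis
    by (rule that[of "sgn i * k"]) (use k \<open>i \<noteq> 0\<close> in \<open>auto simp: sgn_if\<close>)
qed

lemma T_short_split:
  assumes "i \<in> Omega n" "j \<in> Omega n" "k \<in> Omega n" "\<bar>i\<bar> \<noteq> \<bar>j\<bar>" "\<bar>j\<bar> \<noteq> \<bar>k\<bar>" "\<bar>i\<bar> \<noteq> \<bar>k\<bar>"
  shows "T i j a = T i k a \<otimes> conjg (T k j 1) (T i k (- a))"
proof -
  have r: "root i k" "root k j" using assms by (auto simp: root_def)
  have m: "x \<in> part whole i k" "y \<in> part whole k j" for x y using assms by (auto simp: part_short)
  have "T i j a = comm (T i k a) (T k j 1)"
    using T_comm_short[of i k j a 1] assms by auto
  also have "\<dots> = T i k a \<otimes> conjg (T k j 1) (T i k (- a))"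
    using r m by (simp add: comm_eq_mult_conjg T_minus)
  finally show ?thesis .
qed

text \<open>
  In general a long root element cannot be expressed by short ones, as \<open>\<Gamma>\<close> need not consist of traces. It is
  instead moved from the long root of another index \<open>k\<close> by a short root element with coefficient 1;
  equal signs of \<open>i\<close> and \<open>k\<close> keep powers of \<open>\<lambda>\<close> out of the formula.
\<close>

lemma T_long_split:
  assumes "i \<in> Omega n" "k \<in> Omega n" "sgn k = sgn i" "\<bar>k\<bar> \<noteq> \<bar>i\<bar>" and a: "a \<in> part whole i (- i)"
  shows "T i (- i) a =
    T k (- i) a \<otimes> (T k (- k) (- a) \<otimes> conjg (T (- k) (- i) 1) (T k (- k) a))"
proof -
  have nz: "i \<noteq> 0" "k \<noteq> 0" using assms by (auto simp: Omega_def)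
  have a': "a \<in> part whole k (- k)" using a part_same_sign[of i k] nz assms by simp
  then have ma: "- a \<in> part whole k (- k)" using nz by (simp add: part_minus[OF form_ideal_whole])
  have r: "root k (- k)" "root (- k) (- i)" "root k (- i)" "root i (- i)"
    using assms by (auto simp: root_def)
  have m: "x \<in> part whole (- k) (- i)" "x \<in> part whole k (- i)" for x
    using assms nz by (auto simp: part_short)
  have d: "dual_entry (- k) (- i) 1 = 1" using nz assms by (simp add: dual_entry_cases sgn_minus)
  have "comm (T k (- k) (- a)) (T (- k) (- i) 1) = T k (- i) (- a) \<otimes> T i (- i) a"
    using T_comm_long_short[of k "- i" "- a" 1] assms ma d by (simp add: minus_equation_iff)
  then have "T i (- i) a = T k (- i) a \<otimes> comm (T k (- k) (- a)) (T (- k) (- i) 1)"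
    using r m a T_minus[OF r(3) m(2), of a] by (simp add: mult_inv_cancel)
  also have "comm (T k (- k) (- a)) (T (- k) (- i) 1)
      = T k (- k) (- a) \<otimes> conjg (T (- k) (- i) 1) (T k (- k) a)"
    using r m ma a' T_minus[OF r(1) a'] by (simp add: comm_eq_mult_conjg)
  finally show ?thesis .
qed

text \<open>
  Root elements of level \<open>P\<close>, and their conjugates by arbitrary root elements, in which only roots not
  proportional to \<open>(i, j)\<close> occur.
\<close>

definition off_gens :: "'a set \<times> 'a set \<Rightarrow> int \<Rightarrow> int \<Rightarrow> 'g set" where
  "off_gens P i j =
    {T h k b | h k b. root h k \<and> \<not> same_root i j h k \<and> \<not> same_root j i h k \<and> b \<in> part P h k} \<union>
    {conjg (T x y d) (T h k b) | x y d h k b. root h k \<and> \<not> same_root i j h k \<and> \<not> same_root j i h k \<and>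
       root x y \<and> \<not> same_root i j x y \<and> \<not> same_root j i x y \<and> b \<in> part P h k \<and> d \<in> part whole x y}"

lemma off_gens_carrier: "form_ideal F P \<Longrightarrow> off_gens P i j \<subseteq> carrier G"
  by (auto simp: off_gens_def)

text \<open>
  For such an element a cocharacter that vanishes on \<open>(i, j)\<close> is available for each of the roots
  involved. Statements about \<open>T i j a\<close> that are out of reach of the commutator formula, because the
  opposite root is also present, are proved through this decomposition.
\<close>

lemma T_mem_generate_off_gens:
  assumes P: "form_ideal F P" and ij: "root i j" and a: "a \<in> part P i j"
  shows "T i j a \<in> generate G (off_gens P i j)"
proof -
  have off1: "T h k b \<in> generate G (off_gens P i j)"
    if "root h k" "\<not> same_root i j h k" "\<not> same_root j i h k" "b \<in> part P h k" for h k b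
    unfolding off_gens_def using that by (intro generate.incl UnI1) blast
  have off2: "conjg (T x y d) (T h k b) \<in> generate G (off_gens P i j)"
    if "root h k" "\<not> same_root i j h k" "\<not> same_root j i h k" "b \<in> part P h k"
      "root x y" "\<not> same_root i j x y" "\<not> same_root j i x y" "d \<in> part whole x y" for h k b x y d
    unfolding off_gens_def using that
    by (intro generate.incl UnI2 CollectI exI[of _ x] exI[of _ y] exI[of _ d] exI[of _ h] exI[of _ k] exI[of _ b])
      simp
  obtain k where k: "k \<in> Omega n" "sgn k = sgn i" "\<bar>k\<bar> \<noteq> \<bar>i\<bar>" "\<bar>k\<bar> \<noteq> \<bar>j\<bar>"
    using exists_index_off[of i j] rootD[OF ij] by blast
  have nz: "i \<noteq> 0" "j \<noteq> 0" using ij by (auto dest: rootD)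
  have sg: "add_subgroup (fst P)" using P by (rule form_idealD)
  show ?thesis
  proof (cases "j = - i")
    case False
    then have ne: "\<bar>i\<bar> \<noteq> \<bar>j\<bar>" using ij by (auto simp: root_def)
    have "T i k a \<in> generate G (off_gens P i j)"
      by (rule off1) (use k ne a in \<open>auto simp: root_def same_root_def part_short rootD[OF ij]\<close>)
    moreover have "conjg (T k j 1) (T i k (- a)) \<in> generate G (off_gens P i j)"
      by (rule off2)
        (use k ne a sg in \<open>auto simp: root_def same_root_def part_short rootD[OF ij] add_subgroupD\<close>)
    ultimately show ?thesis
      using T_short_split[of i j k a] k ne rootD[OF ij] by (simp add: generate.eng)
  next
    case True
    have a': "a \<in> part P k (- k)" using a part_same_sign[of i k P] nz k True by simp
    have ma: "- a \<in> part P k (- k)" using a' nz k by (intro part_minus[OF P]) auto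
    have aI: "a \<in> fst P" using part_subset_fst[OF P nz(1)] a by blast
    have 1: "T k (- i) a \<in> generate G (off_gens P i j)"
      by (rule off1) (use k aI True in \<open>auto simp: root_def same_root_def part_short rootD[OF ij]\<close>)
    have 2: "T k (- k) (- a) \<in> generate G (off_gens P i j)"
      by (rule off1) (use k ma True in \<open>auto simp: root_def same_root_def rootD[OF ij]\<close>)
    have 3: "conjg (T (- k) (- i) 1) (T k (- k) a) \<in> generate G (off_gens P i j)"
      by (rule off2)
        (use k a' True in \<open>auto simp: root_def same_root_def part_short rootD[OF ij]\<close>)
    have "T i (- i) a = T k (- i) a \<otimes> (T k (- k) (- a) \<otimes> conjg (T (- k) (- i) 1) (T k (- k) a))"
      using T_long_split[of i k a] k rootD[OF ij] True a part_subset_whole[OF P nz(1)] by auto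
    then show ?thesis using 1 2 3 True by (simp add: generate.eng)
  qed
qed

section \<open>Generators of relative elementary subgroups\<close>

lemma prod_le_whole_left: "form_ideal F P \<Longrightarrow> prod_le whole P P"
  by (rule prod_le_sym[OF prod_le_whole])

lemma T_inv_gens:
  assumes "form_ideal F P" "root i j" "a \<in> part P i j"
  shows "inv (T i j a) = T i j (- a)" "- a \<in> part P i j"
  using assms T_minus root_mem_whole part_minus rootD(4) by metis+

lemma off_gens_swap: "off_gens P i j = off_gens P j i"
  unfolding off_gens_def by (intro arg_cong2[where f = "(\<union>)"] Collect_cong) blast+

lemma conjg_T_unip:
  assumes P: "form_ideal F P" and f: "odd_fun f" and ij: "root i j" "f j \<le> f i"
    and d: "d \<in> part whole i j" and x: "x \<in> unip f P"
  shows "conjg (T i j d) x \<in> unip f P"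
proof (rule conjg_generate_mem[OF T_in_carrier_whole[OF ij(1) d] unip_gens_carrier[OF P, of f]
      subgroup_unip[OF P] _ x[unfolded unip_def]])
  fix s assume "s \<in> {T i j a |i j a. root i j \<and> f j < f i \<and> a \<in> part P i j}"
  then obtain h k p where s: "s = T h k p" "root h k" "f k < f h" "p \<in> part P h k" by auto
  have "comm (T i j d) s \<in> unip f P"
    unfolding s(1) by (rule comm_mem_unip[OF prod_le_whole_left[OF P] f ij(1) s(2) d s(4)]) (use ij s in auto)
  moreover have "s \<in> unip f P" using s T_mem_unip by blast
  ultimately show "conjg (T i j d) s \<in> unip f P"
    using subgroup_unip[OF P] s ij d P by (auto simp: conjg_eq_comm_mult subgroup.m_closed)
qed

lemma conjg_unip_induct:
  assumes X: "X \<subseteq> carrier G"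
    and step: "\<And>h k d x. \<lbrakk>root h k; f k < f h; d \<in> part whole h k; x \<in> X\<rbrakk> \<Longrightarrow> conjg (T h k d) x \<in> X"
    and v: "v \<in> unip f whole" and x: "x \<in> X"
  shows "conjg v x \<in> X"
proof (rule generate_mem_induct_conjg[OF unip_gens_carrier[OF form_ideal_whole, of f] _ X _ v[unfolded unip_def] x])
  fix s assume s: "s \<in> {T i j a |i j a. root i j \<and> f j < f i \<and> a \<in> part whole i j}"
  show "inv s \<in> {T i j a |i j a. root i j \<and> f j < f i \<and> a \<in> part whole i j}"
    using s T_inv_gens[OF form_ideal_whole] by blast
  show "conjg s x \<in> X" if "x \<in> X" for x
    using s step that by blast
qed

lemma unip_carrier: "form_ideal F P \<Longrightarrow> unip f P \<subseteq> carrier G"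
  using subgroup.subset[OF subgroup_unip] .

lemma conjg_unip_unip:
  assumes P: "form_ideal F P" and f: "odd_fun f" and v: "v \<in> unip f whole" and x: "x \<in> unip f P"
  shows "conjg v x \<in> unip f P"
  by (rule conjg_unip_induct[OF unip_carrier[OF P] _ v x]) (use conjg_T_unip[OF P f] in auto)

text \<open>
  The set of all \<open>v\<close> with this property is closed under products because the unipotent radical of
  level \<open>P\<close> is normalised by the one of absolute level.
\<close>

lemma comm_unip_T:
  assumes P: "form_ideal F P" and f: "odd_fun f" and ij: "root i j" "f i = f j"
    and a: "a \<in> part P i j" and v: "v \<in> unip f whole"
  shows "comm v (T i j a) \<in> unip f P"
proof -
  note t = T_in_carrier[OF P ij(1) a]
  note sg = subgroup_unip[OF P, of f]
  note wc = unip_gens_carrier[OF form_ideal_whole, of f]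
  have base: "comm (T h k d) (T i j a) \<in> unip f P"
    if "root h k" "f k < f h" "d \<in> part whole h k" for h k d
    by (rule comm_mem_unip[OF prod_le_whole_left[OF P] f that(1) ij(1) that(3) a]) (use ij that in auto)
  show ?thesis
    using v[unfolded unip_def]
  proof induction
    case one
    then show ?case using t subgroup.one_closed[OF sg] by (simp add: comm_def)
  next
    case (incl h)
    then show ?case using base by blast
  next
    case (inv h)
    then obtain x y d where h: "inv h = T x y (- d)" "root x y" "f y < f x" "- d \<in> part whole x y"
      using T_inv_gens[OF form_ideal_whole] by blast
    then show ?case using base by simp
  next
    case (eng h k)
    have c: "h \<in> carrier G" "k \<in> carrier G" using eng generate_in_carrier[OF wc] by auto
    have "h \<in> unip f whole" using eng by (simp add: unip_def)
    then have "conjg h (comm k (T i j a)) \<in> unip f P" using conjg_unip_unip[OF P f] eng by blast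
    then show ?case using c t eng sg by (simp add: comm_mult_left subgroup.m_closed)
  qed
qed

text \<open>
  Choose a cocharacter that vanishes on \<open>(i, j)\<close> and is positive on \<open>(h, k)\<close>. Conjugation with
  \<open>T j i c\<close> preserves the unipotent radical, so it may be transferred to \<open>T h k d\<close> without leaving
  the radical.
\<close>

lemma comm_T_conj_mem_FU:
  assumes P: "form_ideal F P" and ij: "root i j" and hk: "root h k"
    and ne: "\<not> same_root i j h k" "\<not> same_root j i h k"
    and c: "c \<in> part whole j i" and p: "p \<in> part P i j" and d: "d \<in> part whole h k"
  shows "comm (T h k d) (conjg (T j i c) (T i j p)) \<in> FU P"
proof -
  obtain f where f: "odd_fun f" "f i = f j" "f k < f h" using exists_parabolic[OF ij hk ne] by blast
  note ji = root_swap[OF ij]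
  have c': "- c \<in> part whole j i" "inv (T j i c) = T j i (- c)"
    using T_inv_gens[OF form_ideal_whole ji c] by auto
  have v: "conjg (T j i (- c)) (T h k d) \<in> unip f whole"
    using conjg_T_unip[OF form_ideal_whole f(1) ji _ c'(1)] T_mem_unip[of h k f d whole] f hk d by auto
  have "conjg (T j i c) (comm (conjg (T j i (- c)) (T h k d)) (T i j p)) \<in> unip f P"
    using conjg_T_unip[OF P f(1) ji _ c] comm_unip_T[OF P f(1) ij f(2) p v] f by auto
  moreover have "comm (T h k d) (conjg (T j i c) (T i j p)) =
      conjg (T j i c) (comm (conjg (T j i (- c)) (T h k d)) (T i j p))"
    using T_in_carrier_whole[OF ji c] T_in_carrier_whole[OF hk d] T_in_carrier[OF P ij p]
    by (simp add: group_word flip: c'(2))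
  ultimately show ?thesis using unip_subset_FU[of f P] by (metis subsetD)
qed

text \<open>
  The generators of the relative elementary subgroup: root elements conjugated by opposite ones.
\<close>

definition conj_gens :: "'a set \<times> 'a set \<Rightarrow> 'g set" where
  "conj_gens P = {conjg (T j i c) (T i j p) | i j c p. root i j \<and> c \<in> part whole j i \<and> p \<in> part P i j}"

text \<open>
  The part of \<open>conj_gens\<close> where an actual conjugation is only allowed for roots of negative degree;
  the conjugating element then has positive degree.
\<close>

definition neg_gens :: "(int \<Rightarrow> int) \<Rightarrow> 'a set \<times> 'a set \<Rightarrow> 'g set" where
  "neg_gens f P =
    elem P \<union> {conjg (T j i c) (T i j p) | i j c p. root i j \<and> f i < f j \<and> c \<in> part whole j i \<and> p \<in> part P i j}"

lemma conj_gensI: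
  assumes "root i j" "c \<in> part whole j i" "p \<in> part P i j"
  shows "conjg (T j i c) (T i j p) \<in> conj_gens P"
  unfolding conj_gens_def using assms
  by (intro CollectI exI[of _ i] exI[of _ j] exI[of _ c] exI[of _ p]) simp

lemma neg_gensI:
  assumes "root i j" "f i < f j" "c \<in> part whole j i" "p \<in> part P i j"
  shows "conjg (T j i c) (T i j p) \<in> neg_gens f P"
  unfolding neg_gens_def using assms
  by (intro UnI2 CollectI exI[of _ i] exI[of _ j] exI[of _ c] exI[of _ p]) simp

lemma conj_gens_carrier:
  assumes "form_ideal F P" shows "conj_gens P \<subseteq> carrier G"
  using T_in_carrier[OF assms] T_in_carrier_whole root_swap by (auto simp: conj_gens_def)

lemma elem_subset_conj_gens:
  assumes "form_ideal F P" shows "elem P \<subseteq> conj_gens P"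
proof
  fix x assume "x \<in> elem P"
  then obtain i j p where x: "x = T i j p" "root i j" "p \<in> part P i j" by (auto simp: elem_def)
  have "x = conjg (T j i 0) (T i j p)"
    using x assms T_zero[OF root_swap[OF x(2)]] by auto
  moreover have "0 \<in> part whole j i" using x by (simp add: part_zero[OF form_ideal_whole] rootD)
  ultimately show "x \<in> conj_gens P" using x unfolding conj_gens_def by blast
qed

lemma neg_gens_subset:
  assumes "form_ideal F P" shows "neg_gens f P \<subseteq> conj_gens P"
  using elem_subset_conj_gens[OF assms] by (auto simp: neg_gens_def conj_gens_def)

lemma FU_subset_conj: "form_ideal F P \<Longrightarrow> FU P \<subseteq> generate G (conj_gens P)"
  unfolding FU_def by (rule mono_generate[OF elem_subset_conj_gens])

lemma conjg_T_conj:
  assumes P: "form_ideal F P" and ij: "root i j" and hk: "root h k" "same_root j i h k"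
    and c: "c \<in> part whole j i" and p: "p \<in> part P i j" and d: "d \<in> part whole h k"
  obtains e where "e \<in> part whole j i" "conjg (T h k d) (conjg (T j i c) (T i j p)) = conjg (T j i e) (T i j p)"
proof -
  note ji = root_swap[OF ij]
  obtain d' where d': "d' \<in> part whole j i" "T h k d = T j i d'"
    using dual_rep[OF form_ideal_whole ji hk(2) d] by blast
  have "d' + c \<in> part whole j i" using d' c ji by (simp add: part_add[OF form_ideal_whole] rootD)
  moreover have "conjg (T j i d') (conjg (T j i c) (T i j p)) = conjg (T j i (d' + c)) (T i j p)"
    using d' c ij ji p P T_add[of j i d' c] by (auto simp: conjg_conjg root_def)
  ultimately show ?thesis using that d' by metis
qed

text \<open>
  Conjugating by a root element of positive degree changes a generator by an unrelativised element,
  unless the two roots are proportional. If they are opposite, a conjugate for a root of negative degree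
  results, which is again admitted; and a conjugate that was already present has a root of negative
  degree, so its root never coincides with that of the conjugating element.
\<close>

lemma conjg_unip_neg:
  assumes P: "form_ideal F P" and f: "odd_fun f" and v: "v \<in> unip f whole"
    and x: "x \<in> generate G (neg_gens f P)"
  shows "conjg v x \<in> generate G (neg_gens f P)"
proof (rule conjg_unip_induct[OF _ _ v x])
  have nc: "neg_gens f P \<subseteq> carrier G" using neg_gens_subset[OF P] conj_gens_carrier[OF P] by blast
  have sg: "subgroup (generate G (neg_gens f P)) G" by (rule generate_is_subgroup[OF nc])
  then show "generate G (neg_gens f P) \<subseteq> carrier G" by (rule subgroup.subset)
  have FU_sub: "FU P \<subseteq> generate G (neg_gens f P)"
    unfolding FU_def by (rule mono_generate) (auto simp: neg_gens_def)
  fix h k d x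
  assume hk: "root h k" "f k < f h" and d: "d \<in> part whole h k" and x: "x \<in> generate G (neg_gens f P)"
  note t = T_in_carrier_whole[OF hk(1) d]
  note fodd = f[unfolded odd_fun_def, rule_format]
  have le: "f i < f j" if "same_root j i h k" for i j
    using that hk by (auto simp: same_root_def fodd)
  show "conjg (T h k d) x \<in> generate G (neg_gens f P)"
  proof (rule conjg_generate_mem[OF t nc sg _ x])
    fix s assume s: "s \<in> neg_gens f P"
    have by_comm: "conjg (T h k d) s \<in> generate G (neg_gens f P)" if "comm (T h k d) s \<in> FU P"
    proof -
      have "comm (T h k d) s \<otimes> s \<in> generate G (neg_gens f P)"
        using that FU_sub s by (intro generate.eng) (auto intro: generate.incl)
      then show ?thesis using t s nc by (auto simp: conjg_eq_comm_mult)
    qed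
    consider i j p where "s = T i j p" "root i j" "p \<in> part P i j"
      | i j c p where "s = conjg (T j i c) (T i j p)" "root i j" "f i < f j" "c \<in> part whole j i" "p \<in> part P i j"
      using s by (auto simp: neg_gens_def elem_def)
    then show "conjg (T h k d) s \<in> generate G (neg_gens f P)"
    proof cases
      case 1
      show ?thesis
      proof (cases "same_root j i h k")
        case True
        obtain d' where "d' \<in> part whole j i" "T h k d = T j i d'"
          using dual_rep[OF form_ideal_whole root_swap[OF 1(2)] True d] by blast
        then have "conjg (T h k d) s \<in> neg_gens f P" using 1 le[OF True] neg_gensI by simp
        then show ?thesis by (rule generate.incl)
      next
        case False
        have "\<not> same_root k h i j" using False by (auto simp: same_root_def)
        then have "comm (T h k d) s \<in> FU P"
          unfolding 1(1) by (rule comm_mem_FU[OF prod_le_whole_left[OF P] hk(1) 1(2) _ d 1(3)])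
        then show ?thesis by (rule by_comm)
      qed
    next
      case 2
      show ?thesis
      proof (cases "same_root j i h k")
        case True
        then obtain e where "e \<in> part whole j i" "conjg (T h k d) s = conjg (T j i e) (T i j p)"
          using conjg_T_conj[OF P 2(2) hk(1) _ 2(4,5) d] 2(1) by blast
        then have "conjg (T h k d) s \<in> neg_gens f P" using 2 neg_gensI by simp
        then show ?thesis by (rule generate.incl)
      next
        case False
        have "\<not> same_root i j h k" using 2(3) hk by (auto simp: same_root_def fodd)
        then have "comm (T h k d) s \<in> FU P"
          unfolding 2(1) using comm_T_conj_mem_FU[OF P 2(2) hk(1) _ False 2(4,5) d] by blast
        then show ?thesis by (rule by_comm)
      qed
    qed
  qed
qed

text \<open>
  Conjugation of the generator \<open>conjg (T j i c) (T i j p)\<close> by \<open>T h k d\<close> is harmless unless \<open>(h, k)\<close> is the root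
  \<open>(i, j)\<close> itself. In that case the conjugating element is the product \<open>g\<close> of two opposite
  root elements. It stabilises every unipotent radical whose cocharacter vanishes on \<open>(i, j)\<close>, so by
  \<open>T_mem_generate_off_gens\<close> the conjugate of \<open>T i j p\<close> by \<open>g\<close> is a product of elements of \<open>FU P\<close> and of
  conjugates of such elements by elements of unipotent radicals; \<open>conjg_unip_neg\<close> deals with the
  latter.
\<close>

lemma normal_conj_gens:
  assumes P: "form_ideal F P"
  shows "generate G (conj_gens P) \<lhd> G" (is "?L \<lhd> G")
proof (rule normal_conjgI)
  note cc = conj_gens_carrier[OF P]
  show sg: "subgroup ?L G" by (rule generate_is_subgroup[OF cc])
  note FL = FU_subset_conj[OF P]
  have step: "conjg (T h k d) s \<in> ?L"
    if hk: "root h k" and d: "d \<in> part whole h k" and s: "s \<in> conj_gens P" for h k d s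
  proof -
    note t = T_in_carrier_whole[OF hk d]
    obtain i j c p where s': "s = conjg (T j i c) (T i j p)" "root i j" "c \<in> part whole j i" "p \<in> part P i j"
      using s by (auto simp: conj_gens_def)
    consider "same_root j i h k" | "same_root i j h k" | "\<not> same_root j i h k" "\<not> same_root i j h k" by blast
    then show ?thesis
    proof cases
      case 1
      then obtain e where "e \<in> part whole j i" "conjg (T h k d) s = conjg (T j i e) (T i j p)"
        using conjg_T_conj[OF P s'(2) hk _ s'(3,4) d] s'(1) by blast
      then have "conjg (T h k d) s \<in> conj_gens P" using s' conj_gensI by simp
      then show ?thesis by (rule generate.incl)
    next
      case 3
      then have "comm (T h k d) s \<in> FU P"
        unfolding s'(1) using comm_T_conj_mem_FU[OF P s'(2) hk _ _ s'(3,4) d] by blast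
      then have "comm (T h k d) s \<otimes> s \<in> ?L" using FL s by (intro generate.eng) (auto intro: generate.incl)
      then show ?thesis using t s cc by (auto simp: conjg_eq_comm_mult)
    next
      case 2
      note ij = s'(2) and ji = root_swap[OF s'(2)]
      obtain d' where d': "d' \<in> part whole i j" "T h k d = T i j d'"
        using dual_rep[OF form_ideal_whole ij 2 d] by blast
      \<comment> \<open>the remaining conjugate is that of \<open>T i j p\<close> by the following element\<close>
      define g where "g = T i j d' \<otimes> T j i c"
      have tc: "T i j d' \<in> carrier G" "T j i c \<in> carrier G" using d' s' ij ji by auto
      have gc: "g \<in> carrier G" using tc by (simp add: g_def)
      have pc: "T i j p \<in> carrier G" using P s' by auto
      have unip: "conjg g x \<in> unip f Q" if "form_ideal F Q" "odd_fun f" "f i = f j" "x \<in> unip f Q" for f Q x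
      proof -
        have "conjg (T i j d') (conjg (T j i c) x) \<in> unip f Q"
          using that by (intro conjg_T_unip ij ji d'(1) s'(3)) auto
        moreover have "x \<in> carrier G" using unip_carrier[OF that(1)] that(4) by blast
        ultimately show ?thesis using tc by (simp add: g_def conjg_conjg)
      qed
      have T_g: "\<exists>f. odd_fun f \<and> conjg g (T x y q) \<in> unip f Q"
        if "form_ideal F Q" "root x y" "\<not> same_root i j x y" "\<not> same_root j i x y" "q \<in> part Q x y" for Q x y q
        using exists_parabolic[OF ij that(2-4)] unip[OF that(1)] T_mem_unip that by blast
      have "conjg g (T i j p) \<in> ?L"
      proof (rule conjg_generate_mem[OF gc off_gens_carrier[OF P] sg _ T_mem_generate_off_gens[OF P ij s'(4)]])
        fix u assume "u \<in> off_gens P i j"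
        then consider x y q where "u = T x y q" "root x y" "\<not> same_root i j x y" "\<not> same_root j i x y" "q \<in> part P x y"
          | w z e x y q where "u = conjg (T w z e) (T x y q)" "root x y" "\<not> same_root i j x y" "\<not> same_root j i x y"
            "q \<in> part P x y" "root w z" "\<not> same_root i j w z" "\<not> same_root j i w z" "e \<in> part whole w z"
          unfolding off_gens_def by blast
        then show "conjg g u \<in> ?L"
        proof cases
          case 1
          then show ?thesis using T_g[OF P 1(2-5)] FL unip_subset_FU by blast
        next
          case 2
          obtain f where f: "odd_fun f" "conjg g (T w z e) \<in> unip f whole"
            using T_g[OF form_ideal_whole 2(6-9)] by blast
          have "conjg g (T x y q) \<in> FU P" using T_g[OF P 2(2-5)] unip_subset_FU by blast
          moreover have "FU P \<subseteq> generate G (neg_gens f P)"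
            unfolding FU_def by (rule mono_generate) (auto simp: neg_gens_def)
          ultimately have "conjg (conjg g (T w z e)) (conjg g (T x y q)) \<in> generate G (neg_gens f P)"
            using conjg_unip_neg[OF P f] by blast
          also have "\<dots> \<subseteq> ?L" by (rule mono_generate[OF neg_gens_subset[OF P]])
          finally show ?thesis
            unfolding 2(1)
              conjg_by_conjg[OF gc T_in_carrier_whole[OF 2(6,9)] T_in_carrier[OF P 2(2,5)]] .
        qed
      qed
      then show ?thesis using tc pc by (simp add: s'(1) d'(2) g_def conjg_conjg)
    qed
  qed
  fix g x assume g: "g \<in> carrier G" and x: "x \<in> ?L"
  show "conjg g x \<in> ?L"
  proof (rule generate_mem_induct_conjg[OF elem_carrier[OF form_ideal_whole] _ subgroup.subset[OF sg] _ _ x])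
    show "g \<in> generate G (elem whole)" using g FU_whole by (simp add: FU_def)
    fix s assume s: "s \<in> elem whole"
    show "inv s \<in> elem whole" using s T_inv_gens[OF form_ideal_whole] unfolding elem_def by blast
    fix x assume x: "x \<in> ?L"
    obtain h k d where hkd: "s = T h k d" "root h k" "d \<in> part whole h k" using s by (auto simp: elem_def)
    show "conjg s x \<in> ?L"
      unfolding hkd(1) by (rule conjg_generate_mem[OF T_in_carrier_whole[OF hkd(2,3)] cc sg step[OF hkd(2,3)] x])
  qed
qed

text \<open>
  The relative elementary subgroup, as the normal closure in the absolute one.
\<close>

definition EE :: "'a set \<times> 'a set \<Rightarrow> 'g set" where
  "EE P = \<Inter>{N. N \<lhd> G \<and> FU P \<subseteq> N}"

lemma EE_eq_conj:
  assumes P: "form_ideal F P" shows "EE P = generate G (conj_gens P)"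
proof
  show "EE P \<subseteq> generate G (conj_gens P)"
    unfolding EE_def using normal_conj_gens[OF P] FU_subset_conj[OF P] by blast
  have "generate G (conj_gens P) \<subseteq> N" if N: "N \<lhd> G" "FU P \<subseteq> N" for N
  proof (rule generate_subsetI[OF normal_imp_subgroup[OF N(1)]])
    show "conj_gens P \<subseteq> N"
      unfolding conj_gens_def using N T_mem_FU root_swap by (blast intro: normal_conjgD)
  qed
  then show "generate G (conj_gens P) \<subseteq> EE P" unfolding EE_def by blast
qed

lemma normal_EE: "form_ideal F P \<Longrightarrow> EE P \<lhd> G"
  by (simp add: EE_eq_conj normal_conj_gens)

lemma FU_subset_EE: "FU P \<subseteq> EE P"
  unfolding EE_def by blast

lemma EE_subset: "N \<lhd> G \<Longrightarrow> FU P \<subseteq> N \<Longrightarrow> EE P \<subseteq> N"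
  unfolding EE_def by blast

lemma EE_carrier: "form_ideal F P \<Longrightarrow> EE P \<subseteq> carrier G"
  by (rule normal_subset_carrier[OF normal_EE])

text \<open>
  For a root not proportional to \<open>(i, j)\<close>, take a cocharacter that vanishes on \<open>(i, j)\<close>. Commuting an
  element of the unipotent radical with \<open>T i j a\<close> brings it to level \<open>P\<close>, and commuting that with
  \<open>T j i b\<close> brings it into \<open>N\<close>; likewise in the other order. So the three subgroups lemma applies.
  Root elements of \<open>(i, j)\<close> and \<open>(j, i)\<close> are products of other ones.
\<close>

lemma comm_opposite_central:
  assumes PQ: "prod_le P Q W" and N: "N \<lhd> G" "FU W \<subseteq> N"
    and ij: "root i j" and a: "a \<in> part P i j" and b: "b \<in> part Q j i"
  shows "comm (T i j a) (T j i b) \<in> centralizer_mod N (carrier G)" (is "?c \<in> _")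
proof -
  have F: "form_ideal F P" "form_ideal F Q" using PQ by (auto simp: prod_le_def)
  note ji = root_swap[OF ij]
  have tc: "T i j a \<in> carrier G" "T j i b \<in> carrier G" using F ij ji a b by auto
  then have cc: "?c \<in> carrier G" by simp
  have cen: "comm v (T x y p) \<in> N"
    if "prod_le P' Q' W" "odd_fun f" "root x y" "f x = f y" "p \<in> part P' x y" "v \<in> unip f Q'" for P' Q' f x y p v
  proof -
    have F': "form_ideal F P'" "form_ideal F Q'" using that by (auto simp: prod_le_def)
    note fodd = that(2)[unfolded odd_fun_def, rule_format]
    have t: "{T x y p} \<subseteq> carrier G" using F' that by auto
    have "unip f Q' \<subseteq> centralizer_mod N {T x y p}"
      unfolding unip_def
    proof (rule generate_subset_centralizer_mod[OF N(1) t], clarify)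
      fix h k q assume hk: "root h k" "f k < f h" "q \<in> part Q' h k"
      have "\<not> same_root k h x y" using hk that(4) by (auto simp: same_root_def fodd)
      then have "comm (T h k q) (T x y p) \<in> N"
        using comm_mem_FU[OF prod_le_sym[OF that(1)] hk(1) that(3) _ hk(3) that(5)] N by blast
      then show "T h k q \<in> centralizer_mod N {T x y p}"
        using F' hk by (auto simp: centralizer_mod_def)
    qed
    then show ?thesis using that(6) by (auto dest: centralizer_mod_memD)
  qed
  have cs: "{?c} \<subseteq> carrier G" using cc by simp
  note sg = subgroup_centralizer_mod[OF N(1) cs]
  have off: "T h k d \<in> centralizer_mod N {?c}"
    if hk: "root h k" "\<not> same_root i j h k" "\<not> same_root j i h k" "d \<in> part whole h k" for h k d
  proof -
    obtain f where f: "odd_fun f" "f i = f j" "f k < f h" using exists_parabolic[OF ij hk(1-3)] by blast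
    note v = T_in_carrier_whole[OF hk(1,4)]
    have vm: "T h k d \<in> unip f whole" by (rule T_mem_unip[of h k f d whole]) (use hk f in auto)
    note ma = T_inv_gens[OF F(1) ij a] and mb = T_inv_gens[OF F(2) ji b]
    have mc: "T i j (- a) \<in> carrier G" "T j i (- b) \<in> carrier G" using F ij ji ma mb by auto
    have "comm (T h k d) (T j i (- b)) \<in> unip f Q"
      using comm_unip_T[OF F(2) f(1) ji _ mb(2) vm] f by simp
    then have "inv (comm (T h k d) (T j i (- b))) \<in> unip f Q"
      using subgroup.m_inv_closed[OF subgroup_unip[OF F(2)]] by blast
    then have 1: "comm (T j i (- b)) (T h k d) \<in> unip f Q" using v mc by (simp add: inv_comm)
    \<comment> \<open>the hypotheses of the three subgroups lemma, with \<open>T i j (- a)\<close> so that its inverse is \<open>T i j a\<close>\<close>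
    have "comm (comm (T j i (- b)) (T h k d)) (T i j (- a)) \<in> N"
      by (rule cen[OF PQ f(1) ij f(2) ma(2) 1])
    then have h1: "comm (T i j (- a)) (comm (inv (T j i b)) (T h k d)) \<in> N"
      unfolding mb(1) using comm_mem_normal_sym[OF N(1)] v mc by (meson comm_closed)
    have "inv (T h k d) \<in> unip f whole" using subgroup.m_inv_closed[OF subgroup_unip[OF form_ideal_whole] vm] .
    then have 2: "comm (inv (T h k d)) (T i j (- a)) \<in> unip f P"
      using comm_unip_T[OF F(1) f(1) ij f(2) ma(2)] by blast
    have "comm (comm (inv (T h k d)) (T i j (- a))) (T j i b) \<in> N"
      using cen[OF prod_le_sym[OF PQ] f(1) ji _ b 2] f by simp
    then have h2: "comm (T j i b) (comm (inv (T h k d)) (T i j (- a))) \<in> N"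
      using comm_mem_normal_sym[OF N(1)] v mc tc by (meson comm_closed inv_closed)
    have "comm (T h k d) (comm (inv (T i j (- a))) (T j i b)) \<in> N"
      by (rule comm_comm_mem_normal[OF N(1) v mc(1) tc(2) h1 h2])
    then have "comm (T h k d) ?c \<in> N" using tc by (simp flip: ma(1))
    then show ?thesis using v by (simp add: centralizer_mod_def)
  qed
  have off_gens: "off_gens whole i j \<subseteq> centralizer_mod N {?c}"
  proof
    fix u assume "u \<in> off_gens whole i j"
    then consider h k q where "u = T h k q" "root h k" "\<not> same_root i j h k" "\<not> same_root j i h k" "q \<in> part whole h k"
      | w z e h k q where "u = conjg (T w z e) (T h k q)" "root h k" "\<not> same_root i j h k" "\<not> same_root j i h k"
        "q \<in> part whole h k" "root w z" "\<not> same_root i j w z" "\<not> same_root j i w z" "e \<in> part whole w z"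
      unfolding off_gens_def by blast
    then show "u \<in> centralizer_mod N {?c}"
    proof cases
      case 1
      then show ?thesis using off by blast
    next
      case 2
      then show ?thesis using off[OF 2(2-5)] off[OF 2(6-9)] sg
        by (simp add: conjg_def subgroup.m_closed subgroup.m_inv_closed)
    qed
  qed
  have line: "generate G (off_gens whole i j) \<subseteq> centralizer_mod N {?c}"
    by (rule generate_subsetI[OF sg off_gens])
  have "elem whole \<subseteq> centralizer_mod N {?c}"
  proof
    fix s assume "s \<in> elem whole"
    then obtain h k d where s: "s = T h k d" "root h k" "d \<in> part whole h k" by (auto simp: elem_def)
    consider "same_root i j h k" | "same_root j i h k" | "\<not> same_root i j h k" "\<not> same_root j i h k" by blast
    then show "s \<in> centralizer_mod N {?c}"
    proof cases
      case 1
      obtain e where "e \<in> part whole i j" "s = T i j e"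
        using dual_rep[OF form_ideal_whole ij 1 s(3)] s(1) by blast
      then show ?thesis using line T_mem_generate_off_gens[OF form_ideal_whole ij] by blast
    next
      case 2
      obtain e where "e \<in> part whole j i" "s = T j i e"
        using dual_rep[OF form_ideal_whole ji 2 s(3)] s(1) by blast
      then show ?thesis
        using line T_mem_generate_off_gens[OF form_ideal_whole ji] unfolding off_gens_swap[of whole j i] by blast
    next
      case 3
      then show ?thesis using off s by blast
    qed
  qed
  then have "carrier G \<subseteq> centralizer_mod N {?c}"
    using generate_subsetI[OF sg] FU_whole unfolding FU_def by blast
  then have "{?c} \<subseteq> centralizer_mod N (carrier G)"
    using centralizer_mod_swap[OF N(1) order_refl _ cs] by blast
  then show ?thesis by blast
qed

text \<open>
  The commutators of opposite root elements for the root \<open>(i, j)\<close> lie in \<open>N\<close>. The following lemmas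
  transfer this property from root to root.
\<close>

definition opp_comm_mem :: "'g set \<Rightarrow> 'a set \<times> 'a set \<Rightarrow> 'a set \<times> 'a set \<Rightarrow> int \<Rightarrow> int \<Rightarrow> bool" where
  "opp_comm_mem N P Q i j \<longleftrightarrow> (\<forall>a\<in>part P i j. \<forall>b\<in>part Q j i. comm (T i j a) (T j i b) \<in> N)"

lemma opp_comm_mem_dual:
  assumes F: "form_ideal F P" "form_ideal F Q" and ij: "root i j"
    and m: "opp_comm_mem N P Q (- j) (- i)"
  shows "opp_comm_mem N P Q i j"
  unfolding opp_comm_mem_def
proof (intro ballI)
  fix a b assume a: "a \<in> part P i j" and b: "b \<in> part Q j i"
  obtain a' where "a' \<in> part P (- j) (- i)" "T i j a = T (- j) (- i) a'"
    using dual_rep[OF F(1), of "- j" "- i" i j a] a ij by (auto simp: root_dual same_root_def)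
  moreover obtain b' where "b' \<in> part Q (- i) (- j)" "T j i b = T (- i) (- j) b'"
    using dual_rep[OF F(2), of "- i" "- j" j i b] b root_swap[OF ij] by (auto simp: root_dual same_root_def)
  ultimately show "comm (T i j a) (T j i b) \<in> N" using m by (simp add: opp_comm_mem_def)
qed

text \<open>
  Write \<open>T i j a\<close> as \<open>T i k a\<close> times a conjugate of its inverse by \<open>T k j 1\<close>. Moving this conjugation to
  \<open>T j i b\<close> produces a factor \<open>T k i (- b)\<close>, which is opposite to \<open>T i k (- a)\<close>; all other
  commutators that occur involve no opposite roots.
\<close>

lemma opp_comm_mem_shift:
  assumes PQ: "prod_le P Q W" and N: "N \<lhd> G" "FU W \<subseteq> N"
    and ijk: "i \<in> Omega n" "j \<in> Omega n" "k \<in> Omega n" "\<bar>i\<bar> \<noteq> \<bar>j\<bar>" "\<bar>j\<bar> \<noteq> \<bar>k\<bar>" "\<bar>i\<bar> \<noteq> \<bar>k\<bar>"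
    and m: "opp_comm_mem N P Q i k"
  shows "opp_comm_mem N P Q i j"
  unfolding opp_comm_mem_def
proof (intro ballI)
  fix a b assume "a \<in> part P i j" "b \<in> part Q j i"
  moreover have F: "form_ideal F P" "form_ideal F Q" using PQ by (auto simp: prod_le_def)
  ultimately have ab: "a \<in> fst P" "b \<in> fst Q" "- a \<in> fst P" "- b \<in> fst Q"
    using ijk add_subgroupD(3)[OF form_idealD(2)[OF F(1)]] add_subgroupD(3)[OF form_idealD(2)[OF F(2)]]
    by (auto simp: part_short)
  have p: "part R x y = fst R" if "\<bar>x\<bar> \<noteq> \<bar>y\<bar>" for R x y using that by (auto simp: part_short)
  have r: "root x y" if "x \<in> Omega n" "y \<in> Omega n" "\<bar>x\<bar> \<noteq> \<bar>y\<bar>" for x y using that by (auto simp: root_def)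
  have tc: "T x y c \<in> carrier G" if "x \<in> Omega n" "y \<in> Omega n" "\<bar>x\<bar> \<noteq> \<bar>y\<bar>" for x y c
    using r[OF that] that by (simp add: p)
  have ne: "\<bar>j\<bar> \<noteq> \<bar>i\<bar>" "\<bar>k\<bar> \<noteq> \<bar>j\<bar>" "\<bar>k\<bar> \<noteq> \<bar>i\<bar>"
    "j \<noteq> k" "k \<noteq> j" "j \<noteq> - i" "i \<noteq> - j" "i \<noteq> - k" using ijk by auto
  have y: "T j i b \<in> carrier G" "{T j i b} \<subseteq> carrier G" using tc ijk ne by auto
  have x: "T i k (- a) \<in> carrier G" "{T i k (- a)} \<subseteq> carrier G" using tc ijk ne by auto
  have "comm (T i k a) (T j i b) \<in> N"
    using comm_mem_FU[OF PQ, of i k j i a b] N ijk ne ab r by (auto simp: p same_root_def)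
  then have 1: "T i k a \<in> centralizer_mod N {T j i b}" using tc ijk by (simp add: centralizer_mod_def)
  have "comm (T j i b) (T i k (- a)) \<in> N"
    using comm_mem_FU[OF prod_le_sym[OF PQ], of j i i k b "- a"] N ijk ne ab r by (auto simp: p same_root_def)
  then have 2: "T j i b \<in> centralizer_mod N {T i k (- a)}" using y by (simp add: centralizer_mod_def)
  have "comm (T i k (- a)) (T k i (- b)) \<in> N" using m ab ijk ne by (simp add: opp_comm_mem_def p)
  then have 3: "T k i (- b) \<in> centralizer_mod N {T i k (- a)}"
    using comm_mem_normal_sym[OF N(1) x(1) tc[OF ijk(3,1) ne(3)]] tc[OF ijk(3,1) ne(3)]
    by (simp add: centralizer_mod_def)
  have "conjg (T k j (- 1)) (T j i b) = T k i (- b) \<otimes> T j i b"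
    using T_comm_short[of k j i "- 1" b] ijk ne tc by (simp add: conjg_eq_comm_mult)
  then have "conjg (T k j (- 1)) (T j i b) \<in> centralizer_mod N {T i k (- a)}"
    using 2 3 subgroup_centralizer_mod[OF N(1) x(2)] by (simp add: subgroup.m_closed)
  moreover have "T k j (- 1) = inv (T k j 1)" using T_minus[of k j 1] r ijk ne by (simp add: p)
  ultimately have "conjg (T k j 1) (T i k (- a)) \<in> centralizer_mod N {T j i b}"
    using conjg_mem_centralizer_mod_iff[OF N(1) x(1) y(1), of "T k j 1"] tc ijk ne by simp
  then have "T i j a \<in> centralizer_mod N {T j i b}"
    using 1 T_short_split[of i j k a] ijk subgroup_centralizer_mod[OF N(1) y(2)]
    by (simp add: subgroup.m_closed)
  then show "comm (T i j a) (T j i b) \<in> N" by (simp add: centralizer_mod_def)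
qed

text \<open>
  The same idea, with the decomposition of a long root element in place of the short one.
\<close>

lemma opp_comm_mem_shift_long:
  assumes PQ: "prod_le P Q W" and N: "N \<lhd> G" "FU W \<subseteq> N"
    and ik: "i \<in> Omega n" "k \<in> Omega n" "sgn k = sgn i" "\<bar>k\<bar> \<noteq> \<bar>i\<bar>"
    and m: "opp_comm_mem N P Q k (- k)"
  shows "opp_comm_mem N P Q i (- i)"
  unfolding opp_comm_mem_def
proof (intro ballI)
  fix a b assume a: "a \<in> part P i (- i)" and b: "b \<in> part Q (- i) i"
  have F: "form_ideal F P" "form_ideal F Q" using PQ by (auto simp: prod_le_def)
  have nz: "i \<noteq> 0" "k \<noteq> 0" using ik by (metis Omega_simps(2))+
  have ak: "a \<in> part P k (- k)" using a part_same_sign[of i k P] nz ik by simp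
  have bk: "b \<in> part Q (- k) k" using b part_same_sign[of "- i" "- k" Q] nz ik by (simp add: sgn_minus)
  have mak: "- a \<in> part P k (- k)" using part_minus[OF F(1) nz(2) ak] .
  have mbk: "- b \<in> part Q (- k) k" using part_minus[OF F(2) _ bk] nz by simp
  have aI: "a \<in> fst P" using part_subset_fst[OF F(1) nz(1) a] .
  have bJ: "b \<in> fst Q" using part_subset_fst[OF F(2) _ b] nz by simp
  have p: "part R x y = fst R" if "\<bar>x\<bar> \<noteq> \<bar>y\<bar>" for R x y using that by (auto simp: part_short)
  have r: "root x y" if "x \<in> Omega n" "y \<in> Omega n" "\<bar>x\<bar> \<noteq> \<bar>y\<bar>" for x y using that by (auto simp: root_def)
  have rl: "root i (- i)" "root (- i) i" "root k (- k)" "root (- k) k" using ik by auto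
  have ne: "\<bar>i\<bar> \<noteq> \<bar>k\<bar>" using ik by auto
  have y: "T (- i) i b \<in> carrier G" "{T (- i) i b} \<subseteq> carrier G" using T_in_carrier[OF F(2) rl(2) b] by auto
  have x: "T k (- k) a \<in> carrier G" "{T k (- k) a} \<subseteq> carrier G" using T_in_carrier[OF F(1) rl(3) ak] by auto
  note sgx = subgroup_centralizer_mod[OF N(1) x(2)] and sgy = subgroup_centralizer_mod[OF N(1) y(2)]
  have tc: "T s t c \<in> carrier G" if "s \<in> Omega n" "t \<in> Omega n" "\<bar>s\<bar> \<noteq> \<bar>t\<bar>" for s t c
    using r[OF that] that by (simp add: p)
  have "comm (T k (- i) a) (T (- i) i b) \<in> N"
    using comm_mem_FU[OF PQ r rl(2) _ _ b, of k "- i" a] N ik ne nz aI by (auto simp: p same_root_def)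
  then have 1: "T k (- i) a \<in> centralizer_mod N {T (- i) i b}" using tc ik by (simp add: centralizer_mod_def)
  have "comm (T k (- k) (- a)) (T (- i) i b) \<in> N"
    using comm_mem_FU[OF PQ rl(3,2) _ mak b] N ne by (auto simp: same_root_def)
  then have 2: "T k (- k) (- a) \<in> centralizer_mod N {T (- i) i b}"
    using T_in_carrier[OF F(1) rl(3) mak] by (simp add: centralizer_mod_def)
  have "comm (T (- i) i b) (T k (- k) a) \<in> N"
    using comm_mem_FU[OF prod_le_sym[OF PQ] rl(2,3) _ b ak] N ne by (auto simp: same_root_def)
  then have 3: "T (- i) i b \<in> centralizer_mod N {T k (- k) a}" using y by (simp add: centralizer_mod_def)
  have "comm (T (- i) k b) (T k (- k) a) \<in> N"
    using comm_mem_FU[OF prod_le_sym[OF PQ] r rl(3) _ _ ak, of "- i" k b] N ik ne nz bJ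
    by (auto simp: p same_root_def)
  then have 4: "T (- i) k b \<in> centralizer_mod N {T k (- k) a}" using tc ik ne by (simp add: centralizer_mod_def)
  have "comm (T k (- k) a) (T (- k) k (- b)) \<in> N" using m ak mbk by (simp add: opp_comm_mem_def)
  then have 5: "T (- k) k (- b) \<in> centralizer_mod N {T k (- k) a}"
    using comm_mem_normal_sym[OF N(1) x(1) T_in_carrier[OF F(2) rl(4) mbk]] T_in_carrier[OF F(2) rl(4) mbk]
    by (simp add: centralizer_mod_def)
  have d: "dual_entry i k 1 = 1" using nz ik by (simp add: dual_entry_cases)
  have t: "T i k 1 \<in> carrier G" "T (- k) (- i) 1 \<in> carrier G" using tc ik ne by auto
  have "comm (T (- i) i b) (T i k 1) = T (- i) k b \<otimes> T (- k) k (- b)"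
    using T_comm_long_short[of "- i" k b 1] ik ne d part_subset_whole[OF F(2) _ b] nz by simp
  then have "comm (T (- i) i b) (T i k 1) \<in> centralizer_mod N {T k (- k) a}"
    using 4 5 sgx by (simp add: subgroup.m_closed)
  then have "inv (comm (T (- i) i b) (T i k 1)) \<in> centralizer_mod N {T k (- k) a}"
    using sgx by (simp add: subgroup.m_inv_closed)
  then have "comm (T i k 1) (T (- i) i b) \<otimes> T (- i) i b \<in> centralizer_mod N {T k (- k) a}"
    using 3 sgx t y by (simp add: inv_comm subgroup.m_closed)
  then have "conjg (T i k 1) (T (- i) i b) \<in> centralizer_mod N {T k (- k) a}"
    using t y by (simp add: conjg_eq_comm_mult)
  moreover have "T i k 1 = inv (T (- k) (- i) 1)"
    using T_dual[of i k 1] T_minus[of "- k" "- i" 1] r ik ne d by (auto simp: p)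
  ultimately have "conjg (T (- k) (- i) 1) (T k (- k) a) \<in> centralizer_mod N {T (- i) i b}"
    using conjg_mem_centralizer_mod_iff[OF N(1) x(1) y(1), of "T (- k) (- i) 1"] t by simp
  then have "T i (- i) a \<in> centralizer_mod N {T (- i) i b}"
    using 1 2 T_long_split[of i k a] ik sgy part_subset_whole[OF F(1) nz(1) a]
    by (simp add: subgroup.m_closed)
  then show "comm (T i (- i) a) (T (- i) i b) \<in> N" by (simp add: centralizer_mod_def)
qed

text \<open>
  A short root reaches the block of \<open>p\<close> and \<open>q\<close> by exchanging its indices one at a time; a long root
  does so in one step.
\<close>

lemma opp_comm_mem_all:
  assumes PQ: "prod_le P Q W" and N: "N \<lhd> G" "FU W \<subseteq> N"
    and pq: "p \<in> Omega n" "q \<in> Omega n" "0 < p" "0 < q" "p \<noteq> q"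
    and block: "\<And>i j. root i j \<Longrightarrow> \<bar>i\<bar> \<in> {p, q} \<Longrightarrow> \<bar>j\<bar> \<in> {p, q} \<Longrightarrow> opp_comm_mem N P Q i j"
    and ij: "root i j"
  shows "opp_comm_mem N P Q i j"
proof -
  have F: "form_ideal F P" "form_ideal F Q" using PQ by (auto simp: prod_le_def)
  note shift = opp_comm_mem_shift[OF PQ N]
  have other: "\<exists>z\<in>Omega n. 0 < z \<and> z \<in> {p, q} \<and> z \<noteq> \<bar>x\<bar>" for x using pq by auto
  have half: "opp_comm_mem N P Q i j"
    if o: "i \<in> Omega n" "j \<in> Omega n" "\<bar>i\<bar> \<noteq> \<bar>j\<bar>" and m: "\<bar>i\<bar> \<in> {p, q}" for i j
  proof (cases "\<bar>j\<bar> \<in> {p, q}")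
    case True
    then show ?thesis using block that by (auto simp: root_def)
  next
    case False
    obtain z where z: "z \<in> Omega n" "0 < z" "z \<in> {p, q}" "z \<noteq> \<bar>i\<bar>" using other by blast
    have "opp_comm_mem N P Q i z" using block[of i z] z o m by (auto simp: root_def)
    then show ?thesis by (rule shift[rotated -1]) (use z o False in auto)
  qed
  have half': "opp_comm_mem N P Q i j"
    if o: "i \<in> Omega n" "j \<in> Omega n" "\<bar>i\<bar> \<noteq> \<bar>j\<bar>" and m: "\<bar>j\<bar> \<in> {p, q}" for i j
    using half[of "- j" "- i"] opp_comm_mem_dual[OF F, of i j] that by (auto simp: root_def)
  show ?thesis
  proof (cases "j = - i")
    case True
    show ?thesis
    proof (cases "\<bar>i\<bar> \<in> {p, q}")
      case False
      define k where "k = sgn i * p"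
      have k: "k \<in> Omega n" "sgn k = sgn i" "\<bar>k\<bar> = p"
        using pq rootD(4)[OF ij] by (auto simp: k_def sgn_if)
      have "opp_comm_mem N P Q k (- k)" using block[of k "- k"] k by auto
      then show ?thesis
        unfolding True by (rule opp_comm_mem_shift_long[OF PQ N, rotated -1]) (use k False rootD[OF ij] in auto)
    qed (use block[OF ij] True in auto)
  next
    case False
    then have o: "i \<in> Omega n" "j \<in> Omega n" "\<bar>i\<bar> \<noteq> \<bar>j\<bar>" using ij by (auto simp: root_def)
    show ?thesis
    proof (cases "\<bar>i\<bar> \<in> {p, q} \<or> \<bar>j\<bar> \<in> {p, q}")
      case True
      then show ?thesis using half half' o by blast
    next
      case ne: False
      have "opp_comm_mem N P Q i p" using half'[of i p] pq o ne by auto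
      then show ?thesis by (rule shift[rotated -1]) (use o ne pq in auto)
    qed
  qed
qed

lemma T_comm_mem_of_opp:
  assumes PQ: "prod_le P Q W" and N: "FU W \<subseteq> N"
    and opp: "\<And>i j. root i j \<Longrightarrow> opp_comm_mem N P Q i j"
    and ij: "root i j" and hk: "root h k" and a: "a \<in> part P i j" and b: "b \<in> part Q h k"
  shows "comm (T i j a) (T h k b) \<in> N"
proof (cases "same_root j i h k")
  case True
  have "form_ideal F Q" using PQ by (simp add: prod_le_def)
  then obtain b' where "b' \<in> part Q j i" "T h k b = T j i b'"
    using dual_rep[OF _ root_swap[OF ij] True b] by blast
  then show ?thesis using opp[OF ij] a by (simp add: opp_comm_mem_def)
next
  case False
  then show ?thesis using comm_mem_FU[OF PQ ij hk False a b] N by blast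
qed

text \<open>
  It suffices that \<open>T h k a\<close> of level \<open>P\<close> commutes modulo \<open>N\<close> with each generator
  \<open>z = conjg (T j i c) (T i j q)\<close> of \<open>EE Q\<close>, since then the normal closure does so as well. If \<open>(h, k)\<close> is not
  the root \<open>(i, j)\<close>, the conjugation can be moved to \<open>T h k a\<close>, which stays in \<open>FU P\<close>. Otherwise
  \<open>T h k a\<close> is replaced by the elements of \<open>off_gens\<close>, and the conjugations that occur there are moved to
  \<open>z\<close>, which they change only by a factor from \<open>FU Q\<close>.
\<close>

lemma EE_commute_mod:
  assumes PQ: "prod_le P Q W" and N: "N \<lhd> G" "FU W \<subseteq> N"
    and opp: "\<And>i j. root i j \<Longrightarrow> opp_comm_mem N P Q i j"
  shows "commutator_subgroup G (EE P) (EE Q) \<subseteq> N"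
proof -
  have F: "form_ideal F P" "form_ideal F Q" using PQ by (auto simp: prod_le_def)
  have base: "comm (T i j a) (T h k b) \<in> N"
    if "root i j" "root h k" "a \<in> part P i j" "b \<in> part Q h k" for i j h k a b
    using T_comm_mem_of_opp[OF PQ N(2) opp] that by blast
  have FUP: "FU P \<subseteq> centralizer_mod N {T i j q}" if "root i j" "q \<in> part Q i j" for i j q
    unfolding FU_def
    by (rule generate_subset_centralizer_mod[OF N(1)])
      (use that F base in \<open>auto simp: elem_def centralizer_mod_def\<close>)
  have FUQ: "FU Q \<subseteq> centralizer_mod N {T i j p}" if ij: "root i j" "p \<in> part P i j" for i j p
    unfolding FU_def
  proof (rule generate_subset_centralizer_mod[OF N(1)])
    have t: "T i j p \<in> carrier G" using ij F by auto
    then show "{T i j p} \<subseteq> carrier G" by simp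
    show "elem Q \<subseteq> centralizer_mod N {T i j p}"
      unfolding elem_def
    proof clarify
      fix h k q assume hk: "root h k" "q \<in> part Q h k"
      have "T h k q \<in> carrier G" using hk F by auto
      then show "T h k q \<in> centralizer_mod N {T i j p}"
        using comm_mem_normal_sym[OF N(1) t _ base[OF ij(1) hk(1) ij(2) hk(2)]]
        by (simp add: centralizer_mod_def)
    qed
  qed
  have "elem P \<subseteq> centralizer_mod N (conj_gens Q)"
  proof
    fix t assume "t \<in> elem P"
    then obtain h k a where t: "t = T h k a" "root h k" "a \<in> part P h k" by (auto simp: elem_def)
    have tc: "t \<in> carrier G" using t F by auto
    have "comm t z \<in> N" if z0: "z \<in> conj_gens Q" for z
    proof -
      obtain i j c q where z: "z = conjg (T j i c) (T i j q)" "root i j" "c \<in> part whole j i" "q \<in> part Q i j"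
        using z0 by (auto simp: conj_gens_def)
      note ij = z(2) and ji = root_swap[OF z(2)]
      have qc: "T i j q \<in> carrier G" and cc: "T j i c \<in> carrier G" using z ji F by auto
      have zc: "z \<in> carrier G" "{z} \<subseteq> carrier G" using qc cc z by auto
      have c': "- c \<in> part whole j i" "inv (T j i c) = T j i (- c)"
        using T_inv_gens[OF form_ideal_whole ji z(3)] by auto
      have off: "z \<in> centralizer_mod N {T x y p}"
        if xy: "root x y" "\<not> same_root i j x y" "p \<in> part P x y" for x y p
      proof -
        have xc: "T x y p \<in> carrier G" using xy F by auto
        have "comm (T j i (- c)) (T x y p) \<in> FU P"
          by (rule comm_mem_FU[OF prod_le_whole_left[OF F(1)] ji xy(1,2) c'(1) xy(3)])
        then have "conjg (T j i (- c)) (T x y p) \<in> FU P"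
          using T_mem_FU[OF xy(1,3)] subgroup_FU[OF F(1)] xc T_in_carrier_whole[OF ji c'(1)]
          by (simp add: conjg_eq_comm_mult subgroup.m_closed)
        then show ?thesis
          using FUP[OF z(2,4)] conjg_mem_centralizer_mod_iff[OF N(1) qc xc cc] z(1) c'(2) by auto
      qed
      have sgz: "subgroup (centralizer_mod N {z}) G" by (rule subgroup_centralizer_mod[OF N(1) zc(2)])
      have swap: "x \<in> centralizer_mod N {z}" if "z \<in> centralizer_mod N {x}" "x \<in> carrier G" for x
        using that comm_mem_normal_sym[OF N(1) zc(1) that(2)] by (simp add: centralizer_mod_def)
      show ?thesis
      proof (cases "same_root i j h k")
        case False
        then show ?thesis
          using off[OF t(2) False t(3)] swap t tc by (simp add: centralizer_mod_def)
      next
        case True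
        obtain a' where a': "a' \<in> part P i j" "T h k a = T i j a'" using dual_rep[OF F(1) ij True t(3)] by blast
        have "off_gens P i j \<subseteq> centralizer_mod N {z}"
        proof
          fix u assume "u \<in> off_gens P i j"
          then consider x y p where "u = T x y p" "root x y" "\<not> same_root i j x y" "p \<in> part P x y"
            | v w e x y p where "u = conjg (T v w e) (T x y p)" "root x y" "\<not> same_root i j x y"
              "p \<in> part P x y" "root v w" "\<not> same_root i j v w" "\<not> same_root j i v w" "e \<in> part whole v w"
            unfolding off_gens_def by blast
          then show "u \<in> centralizer_mod N {z}"
          proof cases
            case 1
            then show ?thesis using off[OF 1(2-4)] swap F by auto
          next
            case 2
            have xc: "T x y p \<in> carrier G" and vc: "T v w e \<in> carrier G" using 2 F by auto
            have e': "- e \<in> part whole v w" "inv (T v w e) = T v w (- e)"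
              using T_inv_gens[OF form_ideal_whole 2(5,8)] by auto
            have "comm (T v w (- e)) z \<in> FU Q"
              unfolding z(1) by (rule comm_T_conj_mem_FU[OF F(2) ij 2(5-7) z(3,4) e'(1)])
            then have "comm (T v w (- e)) z \<in> centralizer_mod N {T x y p}" using FUQ[OF 2(2,4)] by blast
            then have "conjg (T v w (- e)) z \<in> centralizer_mod N {T x y p}"
              using off[OF 2(2-4)] subgroup_centralizer_mod[OF N(1), of "{T x y p}"] xc zc
                T_in_carrier_whole[OF 2(5) e'(1)]
              by (simp add: conjg_eq_comm_mult subgroup.m_closed)
            then show ?thesis
              using conjg_mem_centralizer_mod_iff[OF N(1) xc zc(1) vc] 2(1) e'(2) by simp
          qed
        qed
        then have "T i j a' \<in> centralizer_mod N {z}"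
          using T_mem_generate_off_gens[OF F(1) ij a'(1)] generate_subsetI[OF sgz] by blast
        then show ?thesis using t a' by (simp add: centralizer_mod_def)
      qed
    qed
    then show "t \<in> centralizer_mod N (conj_gens Q)" using tc by (simp add: centralizer_mod_def)
  qed
  then have "elem P \<subseteq> centralizer_mod N (EE Q)"
    unfolding EE_eq_conj[OF F(2)] centralizer_mod_generate[OF N(1) conj_gens_carrier[OF F(2)]] .
  then have "FU P \<subseteq> centralizer_mod N (EE Q)"
    unfolding FU_def by (rule generate_subset_centralizer_mod[OF N(1) EE_carrier[OF F(2)]])
  then have "EE P \<subseteq> centralizer_mod N (EE Q)"
    by (rule EE_subset[OF normal_centralizer_mod[OF N(1) normal_EE[OF F(2)]]])
  then show ?thesis
    using commutator_subgroup_subset_iff[OF N(1) EE_carrier[OF F(1)] EE_carrier[OF F(2)]] by simp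
qed

definition block_comms :: "int \<Rightarrow> int \<Rightarrow> 'a set \<times> 'a set \<Rightarrow> 'a set \<times> 'a set \<Rightarrow> 'g set" where
  "block_comms p q P Q = {comm (T i j a) (T j i b) | i j a b.
     root i j \<and> \<bar>i\<bar> \<in> {p, q} \<and> \<bar>j\<bar> \<in> {p, q} \<and> a \<in> part P i j \<and> b \<in> part Q j i}"

lemma block_comms_carrier:
  assumes "form_ideal F P" "form_ideal F Q" shows "block_comms p q P Q \<subseteq> carrier G"
  using assms by (auto simp: block_comms_def intro!: comm_closed dest: root_swap)

lemma block_comms_subset:
  "block_comms p q P Q \<subseteq> commutator_subgroup G (EE P) (EE Q)"
  unfolding block_comms_def using FU_subset_EE T_mem_FU root_swap
  by (blast intro: comm_mem_commutator_subgroup)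

text \<open>
  The right-hand side is normal, as the commutators in the block are central modulo \<open>EE W\<close>, and it
  contains all commutators of opposite root elements once it contains those of the block.
\<close>

lemma commutator_EE_subset:
  assumes PQ: "prod_le P Q W" and pq: "p \<in> Omega n" "q \<in> Omega n" "0 < p" "0 < q" "p \<noteq> q"
  shows "commutator_subgroup G (EE P) (EE Q) \<subseteq> generate G (EE W \<union> block_comms p q P Q)" (is "_ \<subseteq> ?M")
proof -
  have F: "form_ideal F P" "form_ideal F Q" "form_ideal F W" using PQ by (auto simp: prod_le_def)
  have "block_comms p q P Q \<subseteq> centralizer_mod (EE W) (carrier G)"
    unfolding block_comms_def using comm_opposite_central[OF PQ normal_EE[OF F(3)] FU_subset_EE] by blast
  then have M: "?M \<lhd> G"
    by (rule normal_generate_Un_central[OF normal_EE[OF F(3)] block_comms_carrier[OF F(1,2)]])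
  have sub: "EE W \<union> block_comms p q P Q \<subseteq> ?M" by (blast intro: generate.incl)
  then have FU: "FU W \<subseteq> ?M" using FU_subset_EE by blast
  have "opp_comm_mem ?M P Q i j" if "root i j" "\<bar>i\<bar> \<in> {p, q}" "\<bar>j\<bar> \<in> {p, q}" for i j
    unfolding opp_comm_mem_def
  proof (intro ballI)
    fix a b assume "a \<in> part P i j" "b \<in> part Q j i"
    then have "comm (T i j a) (T j i b) \<in> block_comms p q P Q"
      unfolding block_comms_def using that
      by (intro CollectI exI[of _ i] exI[of _ j] exI[of _ a] exI[of _ b]) simp
    then show "comm (T i j a) (T j i b) \<in> ?M" using sub by blast
  qed
  then have "opp_comm_mem ?M P Q i j" if "root i j" for i j
    using opp_comm_mem_all[OF PQ M FU pq _ that] by blast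
  then show ?thesis by (rule EE_commute_mod[OF PQ M FU])
qed

text \<open>
  The right-hand side is normal, so it is enough to find the root elements of level \<open>P \<circ> Q\<close> in it.
  For each root the admissible coefficients form an additive subgroup, hence only the spanning
  elements of \<open>P \<circ> Q\<close> matter. Products and their traces arise as commutators of short root elements, twisted elements as the
  long factor of a commutator of a long with a short root element.
\<close>

section \<open>Multiple commutators of relative elementary subgroups\<close>

lemma EE_form_prod_subset:
  assumes P: "form_ideal F P" and Q: "form_ideal F Q"
  shows "EE (form_prod F P Q) \<subseteq> commutator_subgroup G (EE P) (EE Q)" (is "EE ?W \<subseteq> ?X")
proof -
  note W = form_ideal_form_prod[OF P Q]
  have X: "?X \<lhd> G" by (rule normal_commutator_subgroup[OF normal_EE[OF P] normal_EE[OF Q]])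
  note sg = normal_imp_subgroup[OF X]
  have p: "part R x y = fst R" if "\<bar>x\<bar> \<noteq> \<bar>y\<bar>" for R x y using that by (auto simp: part_short)
  have r: "root x y" if "x \<in> Omega n" "y \<in> Omega n" "\<bar>x\<bar> \<noteq> \<bar>y\<bar>" for x y using that by (auto simp: root_def)
  have mem: "comm (T x y a) (T h k b) \<in> ?X \<and> comm (T h k b) (T x y a) \<in> ?X"
    if "root x y" "root h k" "a \<in> part P x y" "b \<in> part Q h k" for x y h k a b
  proof -
    have "T x y a \<in> EE P" "T h k b \<in> EE Q" using that T_mem_FU FU_subset_EE by blast+
    then show ?thesis
      using comm_mem_commutator_subgroup commutator_subgroup_commute[OF normal_EE[OF P] normal_EE[OF Q]] by blast
  qed
  have line: "add_subgroup {a \<in> part whole i j. T i j a \<in> ?X}" if ij: "root i j" for i j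
    unfolding add_subgroup_def
    using T_zero[OF ij] T_add rootD[OF ij] T_minus[OF ij] part_add[OF form_ideal_whole]
      part_minus[OF form_ideal_whole] part_zero[OF form_ideal_whole] sg
    by (auto simp: subgroup.one_closed subgroup.m_closed subgroup.m_inv_closed)
  have short: "T i j x \<in> ?X" if o: "i \<in> Omega n" "j \<in> Omega n" "\<bar>i\<bar> \<noteq> \<bar>j\<bar>" and x: "x \<in> fst ?W" for i j x
  proof -
    obtain k where k: "k \<in> Omega n" "\<bar>k\<bar> \<noteq> \<bar>i\<bar>" "\<bar>k\<bar> \<noteq> \<bar>j\<bar>" using exists_index_off[OF o(1,2)] by blast
    have "T i j (a * b) \<in> ?X \<and> T i j (b * a) \<in> ?X" if "a \<in> fst P" "b \<in> fst Q" for a b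
      using mem[of i k k j a b] mem[of k j i k a b] T_comm_short[of i k j a b] T_comm_short[of i k j b a]
        o k that by (simp add: p r)
    then have "fst ?W \<subseteq> {a \<in> part whole i j. T i j a \<in> ?X}"
      unfolding fst_form_prod_subset_iff[OF line[OF r[OF o]]] using o by (simp add: p)
    then show ?thesis using x by blast
  qed
  have trace: "T i (- i) (x - dual_entry i (- i) x) \<in> ?X" if i: "i \<in> Omega n" and x: "x \<in> fst ?W" for i x
  proof -
    have nz: "i \<noteq> 0" using i by (metis Omega_simps(2))
    have tm: "y - dual_entry i (- i) y \<in> part whole i (- i)" for y
      using trace_mem_part[OF form_ideal_whole _ nz] by simp
    obtain k where k: "k \<in> Omega n" "\<bar>k\<bar> \<noteq> \<bar>i\<bar>" using exists_index_off[OF i i] by blast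
    let ?Y = "{y. T i (- i) (y - dual_entry i (- i) y) \<in> ?X}"
    have eq: "y + z - dual_entry i (- i) (y + z) = (y - dual_entry i (- i) y) + (z - dual_entry i (- i) z)"
      "- y - dual_entry i (- i) (- y) = - (y - dual_entry i (- i) y)" for y z
      by (simp_all add: dual_entry_add)
    have Y: "add_subgroup ?Y"
      unfolding add_subgroup_def
    proof (intro conjI ballI)
      have ii: "root i (- i)" using i by simp
      show "0 \<in> ?Y" using T_zero[OF ii] sg by (simp add: subgroup.one_closed)
      fix y assume y: "y \<in> ?Y"
      show "- y \<in> ?Y"
        unfolding mem_Collect_eq eq(2) T_minus[OF ii tm[of y]]
        using y by (simp add: subgroup.m_inv_closed[OF sg])
      fix z assume z: "z \<in> ?Y"
      show "y + z \<in> ?Y"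
        using y z T_add[OF i _ _ tm[of y] tm[of z]] i nz sg
        by (simp only: mem_Collect_eq eq(1)) (simp add: subgroup.m_closed)
    qed
    have "a * b \<in> ?Y \<and> b * a \<in> ?Y" if "a \<in> fst P" "b \<in> fst Q" for a b
      using mem[of i k k "- i" a b] mem[of k "- i" i k a b] T_comm_long[of i k a b] T_comm_long[of i k b a]
        i k that by (simp add: p r)
    then have "fst ?W \<subseteq> ?Y" unfolding fst_form_prod_subset_iff[OF Y] by blast
    then show ?thesis using x by blast
  qed
  have long: "T i (- i) c \<in> ?X" if i: "i \<in> Omega n" and c: "c \<in> part ?W i (- i)" for i c
  proof -
    have nz: "i \<noteq> 0" using i by (metis Omega_simps(2))
    have ii: "root i (- i)" using i by simp
    \<comment> \<open>the passage from \<open>\<Gamma>\<close> to coefficients of long root elements; \<open>k\<close> has the sign of \<open>i\<close>, so it is the same for both\<close>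
    define tw where "tw g = (if i > 0 then br lm * g else g)" for g
    obtain k where k: "k \<in> Omega n" "sgn k = sgn i" "\<bar>k\<bar> \<noteq> \<bar>i\<bar>" using exists_index_off[OF i i] by blast
    have k_nz: "k \<noteq> 0" using k by (metis Omega_simps(2))
    have k_pos: "k > 0 \<longleftrightarrow> i > 0" using k(2) by (metis sgn_greater)
    have tw_mem: "tw g \<in> part R k (- k) \<longleftrightarrow> g \<in> snd R" "tw g \<in> part R i (- i) \<longleftrightarrow> g \<in> snd R" for R g
      using nz k_nz k_pos by (auto simp: mem_part_long_iff tw_def lam_simps)
    have tw_add: "tw (g + h) = tw g + tw h" "tw (- g) = - tw g" "tw 0 = 0" for g h
      by (auto simp: tw_def distrib_left)
    let ?Y = "{g \<in> Lam F. T i (- i) (tw g) \<in> ?X}"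
    have Y: "add_subgroup ?Y"
    proof -
      have "{g \<in> Lam F. T i (- i) (tw g) \<in> ?X} = {g. tw g \<in> {a \<in> part whole i (- i). T i (- i) a \<in> ?X}}"
        using tw_mem(2)[of _ whole] by auto
      then show ?thesis using line[OF ii] unfolding add_subgroup_def by (simp add: tw_add)
    qed
    \<comment> \<open>a long root element is what remains of a commutator of a long with a short one\<close>
    have step: "x * g * br x \<in> ?Y"
      if g: "g \<in> Lam F" and 1: "comm (T k (- k) (tw g)) (T (- k) (- i) (br x)) \<in> ?X"
        and 2: "tw g * br x \<in> fst ?W" for x g
    proof -
      have d: "dual_entry (- k) (- i) (br x) = x"
        using k nz k_nz by (simp add: dual_entry_cases sgn_minus bar_bar)
      have m: "x * g * br x \<in> Lam F" using g by (rule Lam_closed)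
      have e: "- (x * tw g * br x) = tw (- (x * g * br x))" by (simp add: tw_def mult.assoc lam_simps)
      have tm: "tw (x * g * br x) \<in> part whole i (- i)" using tw_mem(2)[of _ whole] m by simp
      have tgm: "tw g \<in> part whole k (- k)" using tw_mem(1)[of _ whole] g by simp
      have A: "T k (- i) (tw g * br x) \<in> ?X" by (rule short) (use k i 2 in auto)
      have "comm (T k (- k) (tw g)) (T (- k) (- i) (br x))
          = T k (- i) (tw g * br x) \<otimes> T i (- i) (- (x * tw g * br x))"
        using T_comm_long_short[of k "- i" "tw g" "br x"] k i tgm d by simp
      then have "T k (- i) (tw g * br x) \<otimes> inv (T i (- i) (tw (x * g * br x))) \<in> ?X"
        using 1 T_minus[OF ii tm] unfolding e tw_add by simp
      then have "inv (T k (- i) (tw g * br x)) \<otimes> (T k (- i) (tw g * br x) \<otimes> inv (T i (- i) (tw (x * g * br x)))) \<in> ?X"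
        using A sg by (simp add: subgroup.m_closed subgroup.m_inv_closed)
      then have "inv (T i (- i) (tw (x * g * br x))) \<in> ?X"
        using T_in_carrier_whole[OF ii tm] A normal_subset_carrier[OF X] by (auto simp: inv_mult_cancel)
      then have "T i (- i) (tw (x * g * br x)) \<in> ?X"
        using T_in_carrier_whole[OF ii tm] sg subgroup.m_inv_closed by fastforce
      then show ?thesis using m by simp
    qed
    have Gmin: "Gamma_min F (fst ?W) \<subseteq> ?Y"
      unfolding Gamma_min_subset_iff[OF form_idealD(2)[OF W] Y]
    proof (intro conjI ballI)
      fix x assume x: "x \<in> fst ?W"
      have m: "x - lm * br x \<in> Lam F" using form_idealD(10)[OF form_ideal_whole] by simp
      show "x - lm * br x \<in> ?Y"
      proof (cases "i > 0")
        case True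
        have "T i (- i) (br x - dual_entry i (- i) (br x)) \<in> ?X"
          by (rule trace[OF i]) (use x W in \<open>simp add: form_idealD\<close>)
        moreover have "br x - dual_entry i (- i) (br x) = tw (- (x - lm * br x))"
          using True by (simp add: tw_def dual_entry_cases bar_bar right_diff_distrib lam_simps)
        ultimately have "T i (- i) (tw (- (x - lm * br x))) \<in> ?X" by simp
        then have "- (x - lm * br x) \<in> ?Y"
          unfolding mem_Collect_eq using add_subgroupD(3)[OF add_subgroup_Lam m] by blast
        from add_subgroupD(3)[OF Y this] show ?thesis unfolding minus_minus .
      next
        case False
        then have "tw (x - lm * br x) = x - dual_entry i (- i) x"
          using nz by (simp add: tw_def dual_entry_cases)
        then show ?thesis using trace[OF i x] m by simp
      qed
      fix g assume g: "g \<in> Lam F"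
      have bx: "br x \<in> fst ?W" using x W by (simp add: form_idealD)
      have "T (- k) (- i) (br x) \<in> ?X" by (rule short) (use k i bx in auto)
      moreover have "T k (- k) (tw g) \<in> carrier G" using tw_mem(1)[of g whole] g k by auto
      ultimately have "comm (T k (- k) (tw g)) (T (- k) (- i) (br x)) \<in> ?X"
        using comm_mem_normal_sym[OF X] comm_mem_normal_left[OF X] normal_subset_carrier[OF X] by blast
      then show "x * g * br x \<in> ?Y" using step g bx form_idealD(6)[OF W] by blast
    qed
    have twist: "b * g * br b \<in> ?Y" if b: "b \<in> fst Q" and g: "g \<in> snd P" for b g
    proof (rule step)
      have bb: "br b \<in> fst Q" using b Q by (simp add: form_idealD)
      have tg: "tw g \<in> part P k (- k)" using tw_mem(1) g by simp
      show "g \<in> Lam F" using g P by (simp add: form_idealD)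
      show "comm (T k (- k) (tw g)) (T (- k) (- i) (br b)) \<in> ?X"
        using mem[OF _ r tg, of "- k" "- i" "br b"] bb k i by (simp add: p)
      show "tw g * br b \<in> fst ?W"
        using prod_le_mult_mem[OF prod_le_form_prod[OF P Q] part_subset_fst[OF P k_nz tg] bb] .
    qed
    have twist': "a * d * br a \<in> ?Y" if a: "a \<in> fst P" and d: "d \<in> snd Q" for a d
    proof (rule step)
      have ba: "br a \<in> fst P" using a P by (simp add: form_idealD)
      have td: "tw d \<in> part Q k (- k)" using tw_mem(1) d by simp
      show "d \<in> Lam F" using d Q by (simp add: form_idealD)
      show "comm (T k (- k) (tw d)) (T (- k) (- i) (br a)) \<in> ?X"
        using mem[OF r _ _ td, of "- k" "- i" "br a"] ba k i by (simp add: p)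
      show "tw d * br a \<in> fst ?W"
        using prod_le_mult_mem[OF prod_le_sym[OF prod_le_form_prod[OF P Q]] part_subset_fst[OF Q k_nz td] ba] .
    qed
    have "snd ?W \<subseteq> ?Y"
      unfolding snd_form_prod_subset_iff[OF P Q Y] using Gmin twist twist' by blast
    moreover define g where "g = (if i > 0 then lm * c else c)"
    then have "g \<in> snd ?W" using c nz by (simp add: mem_part_long_iff)
    ultimately have "T i (- i) (tw g) \<in> ?X" by blast
    moreover have "tw g = c" by (simp add: tw_def g_def lam_simps)
    ultimately show ?thesis by simp
  qed
  have "elem ?W \<subseteq> ?X"
  proof
    fix x assume "x \<in> elem ?W"
    then obtain i j c where x: "x = T i j c" "root i j" "c \<in> part ?W i j" by (auto simp: elem_def)
    show "x \<in> ?X"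
    proof (cases "j = - i")
      case True
      then show ?thesis using long x rootD by blast
    next
      case False
      then have "\<bar>i\<bar> \<noteq> \<bar>j\<bar>" using x by (auto simp: root_def)
      then show ?thesis using short x rootD by (simp add: p)
    qed
  qed
  then have "FU ?W \<subseteq> ?X" unfolding FU_def by (rule generate_subsetI[OF sg])
  then show ?thesis by (rule EE_subset[OF X])
qed

lemma T_centralizes_block:
  assumes P: "form_ideal F P" and N: "N \<lhd> G"
    and hk: "root h k" "\<bar>h\<bar> \<notin> {p, q}" "\<bar>k\<bar> \<notin> {p, q}" and c: "c \<in> part P h k"
    and ij: "root i j" "\<bar>i\<bar> \<in> {p, q}" "\<bar>j\<bar> \<in> {p, q}" and a: "a \<in> part whole i j"
  shows "T h k c \<in> centralizer_mod N {T i j a}"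
proof -
  have "comm (T h k c) (T i j a) = \<one>"
    by (rule comm_eq_oneI) (use assms root_mem_whole in auto)
  then show ?thesis
    using T_in_carrier[OF P hk(1) c] subgroup.one_closed[OF normal_imp_subgroup[OF N]]
    by (simp add: centralizer_mod_def)
qed

lemma block_comms_centralized:
  assumes F: "form_ideal F P" "form_ideal F Q" and N: "N \<lhd> G" and x: "x \<in> carrier G"
    and T: "\<And>i j a. root i j \<Longrightarrow> \<bar>i\<bar> \<in> {p, q} \<Longrightarrow> \<bar>j\<bar> \<in> {p, q} \<Longrightarrow> a \<in> part whole i j \<Longrightarrow>
      x \<in> centralizer_mod N {T i j a}"
  shows "block_comms p q P Q \<subseteq> centralizer_mod N {x}"
proof
  fix c assume "c \<in> block_comms p q P Q"
  then obtain i j a b where c: "c = comm (T i j a) (T j i b)" "root i j" "\<bar>i\<bar> \<in> {p, q}" "\<bar>j\<bar> \<in> {p, q}"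
    "a \<in> part whole i j" "b \<in> part whole j i"
    unfolding block_comms_def using root_mem_whole[OF F(1)] root_mem_whole[OF F(2)] root_swap by blast
  have "T i j a \<in> centralizer_mod N {x}" if "root i j" "\<bar>i\<bar> \<in> {p, q}" "\<bar>j\<bar> \<in> {p, q}" "a \<in> part whole i j" for i j a
    using T[OF that] comm_mem_normal_sym[OF N x T_in_carrier_whole[OF that(1,4)]] T_in_carrier_whole[OF that(1,4)]
    by (simp add: centralizer_mod_def)
  then show "c \<in> centralizer_mod N {x}"
    unfolding c(1) comm_def using c root_swap subgroup_centralizer_mod[OF N, of "{x}"] x
    by (simp add: subgroup.m_closed subgroup.m_inv_closed)
qed

text \<open>
  The block of \<open>[E(P), E(Q)]\<close> can be chosen anew for every root element of \<open>E(K)\<close>, disjoint from its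
  indices.
\<close>

lemma commutator_EE_triple:
  assumes P: "form_ideal F P" and Q: "form_ideal F Q" and K: "form_ideal F K"
  shows "commutator_subgroup G (commutator_subgroup G (EE P) (EE Q)) (EE K)
    = commutator_subgroup G (EE (form_prod F P Q)) (EE K)" (is "commutator_subgroup G ?X _ = ?N")
proof
  let ?R = "EE (form_prod F P Q)"
  have W: "form_ideal F (form_prod F P Q)" by (rule form_ideal_form_prod[OF P Q])
  have X: "?X \<lhd> G" by (rule normal_commutator_subgroup[OF normal_EE[OF P] normal_EE[OF Q]])
  have N: "?N \<lhd> G" by (rule normal_commutator_subgroup[OF normal_EE[OF W] normal_EE[OF K]])
  note Xc = normal_subset_carrier[OF X]
  show "?N \<subseteq> commutator_subgroup G ?X (EE K)"
    by (rule commutator_subgroup_mono[OF EE_form_prod_subset[OF P Q] order_refl])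
  have "elem K \<subseteq> centralizer_mod ?N ?X"
  proof
    fix t assume t: "t \<in> elem K"
    then obtain h k c where hk: "t = T h k c" "root h k" "c \<in> part K h k" by (auto simp: elem_def)
    have tc: "t \<in> carrier G" "{t} \<subseteq> carrier G" using hk K by auto
    \<comment> \<open>a block disjoint from the indices of \<open>t\<close>\<close>
    have "card {\<bar>h\<bar>, \<bar>k\<bar>} < n" using four_le by (simp add: card_insert_if)
    then obtain p where p: "p \<in> Omega n" "p > 0" "p \<notin> {\<bar>h\<bar>, \<bar>k\<bar>}"
      using exists_new_index[OF finite.insertI[OF finite.insertI[OF finite.emptyI]]] by blast
    have "card {p, \<bar>h\<bar>, \<bar>k\<bar>} < n" using four_le by (simp add: card_insert_if)
    then obtain q where q: "q \<in> Omega n" "q > 0" "q \<notin> {p, \<bar>h\<bar>, \<bar>k\<bar>}"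
      using exists_new_index[OF finite.insertI[OF finite.insertI[OF finite.insertI[OF finite.emptyI]]]] by blast
    have tK: "t \<in> EE K" unfolding hk(1) using T_mem_FU[OF hk(2,3)] FU_subset_EE by blast
    have "?R \<subseteq> centralizer_mod ?N {t}"
      using tK EE_carrier[OF W] comm_mem_commutator_subgroup by (auto simp: centralizer_mod_def)
    moreover have "block_comms p q P Q \<subseteq> centralizer_mod ?N {t}"
    proof (rule block_comms_centralized[OF P Q N tc(1)])
      fix i j a assume ij: "root i j" "\<bar>i\<bar> \<in> {p, q}" "\<bar>j\<bar> \<in> {p, q}" "a \<in> part whole i j"
      have "\<bar>h\<bar> \<notin> {p, q}" "\<bar>k\<bar> \<notin> {p, q}" using p q by auto
      then show "t \<in> centralizer_mod ?N {T i j a}"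
        unfolding hk(1) by (rule T_centralizes_block[OF K N hk(2) _ _ hk(3) ij])
    qed
    ultimately have "generate G (?R \<union> block_comms p q P Q) \<subseteq> centralizer_mod ?N {t}"
      by (intro generate_subset_centralizer_mod[OF N tc(2)]) blast
    then have "?X \<subseteq> centralizer_mod ?N {t}"
      using commutator_EE_subset[OF prod_le_form_prod[OF P Q] p(1) q(1) p(2) q(2)] q by blast
    then show "t \<in> centralizer_mod ?N ?X" using centralizer_mod_swap[OF N Xc _ tc(2)] by blast
  qed
  then have "FU K \<subseteq> centralizer_mod ?N ?X"
    unfolding FU_def by (rule generate_subset_centralizer_mod[OF N Xc])
  then have "EE K \<subseteq> centralizer_mod ?N ?X"
    by (rule EE_subset[OF normal_centralizer_mod[OF N X]])
  then have "?X \<subseteq> centralizer_mod ?N (EE K)"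
    by (rule centralizer_mod_swap[OF N EE_carrier[OF K] _ Xc])
  then show "commutator_subgroup G ?X (EE K) \<subseteq> ?N"
    using commutator_subgroup_subset_iff[OF N Xc EE_carrier[OF K]] by blast
qed

text \<open>
  The triple commutator formula takes care of \<open>[E(P \<circ> P'), [E(Q), E(Q')]]\<close> and of
  \<open>[[E(P), E(P')], E(Q \<circ> Q')]\<close>, so that only commutators between two disjoint blocks remain. The blocks
  consist of elements of \<open>[E(P), E(P')]\<close> and \<open>[E(Q), E(Q')]\<close>, which makes the triple formula applicable
  to them.
\<close>

lemma commutator_EE_quadruple:
  assumes P: "form_ideal F P" "form_ideal F P'" and Q: "form_ideal F Q" "form_ideal F Q'"
  shows "commutator_subgroup G (commutator_subgroup G (EE P) (EE P')) (commutator_subgroup G (EE Q) (EE Q'))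
    = commutator_subgroup G (EE (form_prod F P P')) (EE (form_prod F Q Q'))"
    (is "commutator_subgroup G ?X ?Y = ?N")
proof
  let ?R = "EE (form_prod F P P')" and ?S = "EE (form_prod F Q Q')"
  have W: "form_ideal F (form_prod F P P')" "form_ideal F (form_prod F Q Q')"
    using P Q form_ideal_form_prod by blast+
  note nR = normal_EE[OF W(1)] and nS = normal_EE[OF W(2)]
  have X: "?X \<lhd> G" by (rule normal_commutator_subgroup[OF normal_EE[OF P(1)] normal_EE[OF P(2)]])
  have Y: "?Y \<lhd> G" by (rule normal_commutator_subgroup[OF normal_EE[OF Q(1)] normal_EE[OF Q(2)]])
  have N: "?N \<lhd> G" by (rule normal_commutator_subgroup[OF nR nS])
  note Xc = normal_subset_carrier[OF X] and Yc = normal_subset_carrier[OF Y]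
  note Rc = EE_carrier[OF W(1)] and Sc = EE_carrier[OF W(2)]
  show "?N \<subseteq> commutator_subgroup G ?X ?Y"
    by (rule commutator_subgroup_mono[OF EE_form_prod_subset[OF P] EE_form_prod_subset[OF Q]])
  have "commutator_subgroup G ?R ?Y = ?N"
    using commutator_EE_triple[OF Q W(1)] commutator_subgroup_commute[OF Y nR] commutator_subgroup_commute[OF nS nR]
    by simp
  then have RY: "?R \<subseteq> centralizer_mod ?N ?Y" using commutator_subgroup_subset_iff[OF N Rc Yc] by blast
  have "commutator_subgroup G ?X ?S = ?N" by (rule commutator_EE_triple[OF P W(2)])
  then have XS: "?X \<subseteq> centralizer_mod ?N ?S" using commutator_subgroup_subset_iff[OF N Xc Sc] by blast
  have idx: "(1 :: int) \<in> Omega n" "(2 :: int) \<in> Omega n" "(3 :: int) \<in> Omega n" "(4 :: int) \<in> Omega n"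
    using four_le by (auto simp: Omega_def)
  have "block_comms 1 2 P P' \<subseteq> centralizer_mod ?N ?Y"
  proof
    fix c assume c: "c \<in> block_comms 1 2 P P'"
    then have cX: "c \<in> ?X" using block_comms_subset by blast
    then have cc: "c \<in> carrier G" "{c} \<subseteq> carrier G" using Xc by auto
    have "{c} \<subseteq> centralizer_mod ?N ?S" using XS cX by blast
    then have "?S \<subseteq> centralizer_mod ?N {c}" by (rule centralizer_mod_swap[OF N cc(2) _ Sc])
    moreover have "block_comms 3 4 Q Q' \<subseteq> centralizer_mod ?N {c}"
    proof (rule block_comms_centralized[OF Q N cc(1)])
      fix i j a assume ij: "root i j" "\<bar>i\<bar> \<in> {3, 4}" "\<bar>j\<bar> \<in> {3, 4}" "a \<in> part whole i j"
      have "block_comms 1 2 P P' \<subseteq> centralizer_mod ?N {T i j a}"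
      proof (rule block_comms_centralized[OF P N T_in_carrier_whole[OF ij(1,4)]])
        fix x y c assume xy: "root x y" "\<bar>x\<bar> \<in> {1, 2}" "\<bar>y\<bar> \<in> {1, 2}" "c \<in> part whole x y"
        have "\<bar>i\<bar> \<notin> {1, 2}" "\<bar>j\<bar> \<notin> {1, 2}" using ij by auto
        then show "T i j a \<in> centralizer_mod ?N {T x y c}"
          by (rule T_centralizes_block[OF form_ideal_whole N ij(1) _ _ ij(4) xy])
      qed
      then show "c \<in> centralizer_mod ?N {T i j a}" using c by blast
    qed
    ultimately have "generate G (?S \<union> block_comms 3 4 Q Q') \<subseteq> centralizer_mod ?N {c}"
      by (intro generate_subset_centralizer_mod[OF N cc(2)]) blast
    then have "?Y \<subseteq> centralizer_mod ?N {c}"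
      using commutator_EE_subset[OF prod_le_form_prod[OF Q] idx(3,4)] by auto
    then show "c \<in> centralizer_mod ?N ?Y" using centralizer_mod_swap[OF N Yc _ cc(2)] by blast
  qed
  then have "generate G (?R \<union> block_comms 1 2 P P') \<subseteq> centralizer_mod ?N ?Y"
    using RY by (intro generate_subset_centralizer_mod[OF N Yc]) blast
  then have "?X \<subseteq> centralizer_mod ?N ?Y"
    using commutator_EE_subset[OF prod_le_form_prod[OF P] idx(1,2)] by auto
  then show "commutator_subgroup G ?X ?Y \<subseteq> ?N"
    using commutator_subgroup_subset_iff[OF N Xc Yc] by blast
qed

lemma form_ideal_bracketed:
  assumes "length xs = leaves b" "\<forall>P\<in>set xs. form_ideal F P"
  shows "form_ideal F (bracketed (form_prod F) b xs)"
  using assms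
proof (induction b arbitrary: xs)
  case Single
  then show ?case by (cases xs) auto
next
  case (Br b c)
  have "form_ideal F (bracketed (form_prod F) b (take (leaves b) xs))"
    by (rule Br.IH(1)) (use Br.prems in \<open>auto dest: in_set_takeD\<close>)
  moreover have "form_ideal F (bracketed (form_prod F) c (drop (leaves b) xs))"
    by (rule Br.IH(2)) (use Br.prems in \<open>auto dest: in_set_dropD\<close>)
  ultimately show ?case by (simp add: form_ideal_form_prod)
qed

text \<open>
  The value of a bracketing is either a single relative elementary subgroup or, by induction, a
  commutator of two of them. Which of the two occurs on either side decides whether nothing, the triple
  or the quadruple formula is to be applied at the outermost bracket.
\<close>

lemma bracketed_commutator_EE:
  assumes "length xs = leaves (Br b c)" "\<forall>P\<in>set xs. form_ideal F P"
  shows "bracketed (commutator_subgroup G) (Br b c) (map EE xs) =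
    commutator_subgroup G
      (EE (bracketed (form_prod F) b (take (leaves b) xs)))
      (EE (bracketed (form_prod F) c (drop (leaves b) xs)))"
proof -
  define cs where "cs V P \<longleftrightarrow> V = EE P \<or> (\<exists>Q R. form_ideal F Q \<and> form_ideal F R \<and>
    V = commutator_subgroup G (EE Q) (EE R) \<and> P = form_prod F Q R)" for V P
  have absorb: "commutator_subgroup G V V' = commutator_subgroup G (EE P) (EE P')"
    if P: "form_ideal F P" "form_ideal F P'" and "cs V P" "cs V' P'" for V V' P P'
  proof -
    note com = commutator_subgroup_commute
    have triple': "commutator_subgroup G (EE K) (commutator_subgroup G (EE Q) (EE R))
        = commutator_subgroup G (EE K) (EE (form_prod F Q R))"
      if "form_ideal F Q" "form_ideal F R" "form_ideal F K" for Q R K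
      using commutator_EE_triple[OF that] com[OF normal_EE[OF that(3)]] normal_EE that
        form_ideal_form_prod normal_commutator_subgroup by metis
    show ?thesis
      using that unfolding cs_def
      by (elim disjE exE conjE) (simp_all add: commutator_EE_triple triple' commutator_EE_quadruple)
  qed
  have "cs (bracketed (commutator_subgroup G) b (map EE xs)) (bracketed (form_prod F) b xs)"
    if "length xs = leaves b" "\<forall>P\<in>set xs. form_ideal F P" for b xs
    using that
  proof (induction b arbitrary: xs)
    case Single
    then show ?case by (cases xs) (auto simp: cs_def)
  next
    case (Br b c)
    have len: "length (take (leaves b) xs) = leaves b" "length (drop (leaves b) xs) = leaves c"
      "\<forall>P\<in>set (take (leaves b) xs). form_ideal F P" "\<forall>P\<in>set (drop (leaves b) xs). form_ideal F P"
      using Br.prems by (auto dest: in_set_takeD in_set_dropD)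
    note fi = form_ideal_bracketed[OF len(1,3)] form_ideal_bracketed[OF len(2,4)]
    have "bracketed (commutator_subgroup G) (Br b c) (map EE xs) = commutator_subgroup G
        (EE (bracketed (form_prod F) b (take (leaves b) xs)))
        (EE (bracketed (form_prod F) c (drop (leaves b) xs)))"
      using absorb[OF fi Br.IH(1)[OF len(1,3)] Br.IH(2)[OF len(2,4)]] by (simp add: take_map drop_map)
    moreover have "bracketed (form_prod F) (Br b c) xs = form_prod F
        (bracketed (form_prod F) b (take (leaves b) xs)) (bracketed (form_prod F) c (drop (leaves b) xs))"
      by simp
    ultimately show ?case unfolding cs_def using fi by blast
  qed
  note cs = this
  have len: "length (take (leaves b) xs) = leaves b" "length (drop (leaves b) xs) = leaves c"
    "\<forall>P\<in>set (take (leaves b) xs). form_ideal F P" "\<forall>P\<in>set (drop (leaves b) xs). form_ideal F P"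
    using assms by (auto dest: in_set_takeD in_set_dropD)
  show ?thesis
    using absorb[OF form_ideal_bracketed[OF len(1,3)] form_ideal_bracketed[OF len(2,4)]
        cs[OF len(1,3)] cs[OF len(2,4)]]
    by (simp add: take_map drop_map)
qed

end

section \<open>Matrices and the Steinberg relations\<close>

lemma (in group) comm_eqI:
  assumes "x \<in> carrier G" "y \<in> carrier G" "z \<in> carrier G" "x \<otimes> y = z \<otimes> (y \<otimes> x)"
  shows "comm x y = z"
proof -
  have "comm x y = x \<otimes> y \<otimes> (inv x \<otimes> inv y)" using assms(1-3) by (simp add: comm_def m_assoc)
  also have "\<dots> = z" unfolding assms(4) using assms(1-3) by (simp add: group_word)
  finally show ?thesis .
qed

text \<open>
  Multiplication as a plain function, bilinear for the pointwise addition of matrices. In this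
  form products of matrices \<open>1 + X\<close> are expanded by rewriting with matrix units.
\<close>

definition mmul :: "nat \<Rightarrow> ('a::{ring, monoid_mult}) matrix \<Rightarrow> 'a matrix \<Rightarrow> 'a matrix" where
  "mmul n M N = (\<lambda>p q. \<Sum>k\<in>Omega n. M p k * N k q)"

lemma mult_GL: "M \<otimes>\<^bsub>GL n\<^esub> N = mmul n M N"
  by (simp add: GL_def units_of_def mat_monoid_def mmul_def)

lemma mmul_distrib:
  "mmul n (M + M') N = mmul n M N + mmul n M' N"
  "mmul n M (N + N') = mmul n M N + mmul n M N'"
  "mmul n (M - M') N = mmul n M N - mmul n M' N"
  "mmul n M (N - N') = mmul n M N - mmul n M N'"
  by (auto simp: mmul_def fun_eq_iff sum.distrib sum_subtractf algebra_simps)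

lemma mmul_zero: "mmul n 0 N = 0" "mmul n M 0 = 0"
  by (auto simp: mmul_def fun_eq_iff)

lemma mmul_unit:
  assumes "j \<in> Omega n"
  shows "mmul n (mat_unit a i j) (mat_unit b h k) = (if j = h then mat_unit (a * b) i k else 0)"
proof (intro ext)
  fix p q
  have "(\<Sum>x\<in>Omega n. mat_unit a i j p x * mat_unit b h k x q)
      = (\<Sum>x\<in>Omega n. if j = x then mat_unit a i j p j * mat_unit b h k j q else 0)"
    by (rule sum.cong) (auto simp: mat_unit_def)
  then show "mmul n (mat_unit a i j) (mat_unit b h k) p q = (if j = h then mat_unit (a * b) i k else 0) p q"
    using assms by (auto simp: mmul_def mat_unit_def)
qed

lemma mmul_one_unit:
  assumes "i \<in> Omega n" shows "mmul n (mat_one n) (mat_unit a i j) = mat_unit a i j"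
proof (intro ext)
  fix p q
  have "(\<Sum>x\<in>Omega n. mat_one n p x * mat_unit a i j x q)
      = (\<Sum>x\<in>Omega n. if i = x then mat_one n p i * mat_unit a i j i q else 0)"
    by (rule sum.cong) (auto simp: mat_unit_def)
  then show "mmul n (mat_one n) (mat_unit a i j) p q = mat_unit a i j p q"
    using assms by (auto simp: mmul_def mat_unit_def mat_one_def)
qed

lemma mmul_unit_one:
  assumes "j \<in> Omega n" shows "mmul n (mat_unit a i j) (mat_one n) = mat_unit a i j"
proof (intro ext)
  fix p q
  have "(\<Sum>x\<in>Omega n. mat_unit a i j p x * mat_one n x q)
      = (\<Sum>x\<in>Omega n. if j = x then mat_unit a i j p j * mat_one n j q else 0)"
    by (rule sum.cong) (auto simp: mat_unit_def)
  then show "mmul n (mat_unit a i j) (mat_one n) p q = mat_unit a i j p q"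
    using assms by (auto simp: mmul_def mat_unit_def mat_one_def)
qed

lemma mmul_one_one: "mmul n (mat_one n) (mat_one n :: ('a::{ring, monoid_mult}) matrix) = mat_one n"
proof -
  interpret monoid "mat_monoid n :: 'a matrix monoid" by (rule monoid_mat_monoid)
  have "\<one>\<^bsub>mat_monoid n\<^esub> \<otimes>\<^bsub>mat_monoid n\<^esub> \<one>\<^bsub>mat_monoid n\<^esub> = (\<one>\<^bsub>mat_monoid n\<^esub> :: 'a matrix)" by simp
  then show ?thesis by (simp add: mat_monoid_def mmul_def)
qed

lemma mat_unit_arith:
  "mat_unit (a + b) i j = mat_unit a i j + mat_unit b i j"
  "mat_unit (a - b) i j = mat_unit a i j - mat_unit b i j"
  "mat_unit (- a) i j = - mat_unit a i j"
  "mat_unit 0 i j = 0"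
  by (auto simp: mat_unit_def fun_eq_iff)

lemmas matrix_simps = mmul_distrib mmul_zero mmul_unit mmul_one_unit mmul_unit_one mmul_one_one mat_unit_arith

context form_ring
begin

lemma trv_short:
  "j \<noteq> - i \<Longrightarrow> trv F n i j c = mat_one n + mat_unit c i j - mat_unit (dual_entry i j c) (- j) (- i)"
  by (simp add: trv_def dual_entry_def fun_eq_iff)

lemma trv_long: "trv F n i (- i) c = mat_one n + mat_unit c i (- i)"
  by (simp add: trv_def fun_eq_iff)

lemma Omega_minus: "- i \<in> Omega n \<longleftrightarrow> i \<in> Omega n"
  by (auto simp: Omega_def)

lemma Omega_nonzero: "i \<in> Omega n \<Longrightarrow> i \<noteq> 0"
  by (auto simp: Omega_def)

text \<open>
  The exponents of \<open>\<lambda>\<close> are differences of signs and add up along \<open>i\<close>, \<open>j\<close>, \<open>k\<close>.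
\<close>

lemma dual_entry_mult:
  assumes "i \<noteq> 0" "j \<noteq> 0" "k \<noteq> 0"
  shows "dual_entry i k (a * b) = dual_entry j k b * dual_entry i j a"
  using assms by (auto simp: dual_entry_cases sgn_if bar_mult mult.assoc lam_simps)

text \<open>
  This is the condition that coefficients of long root elements lie in \<open>\<Lambda>\<^sub>m\<^sub>a\<^sub>x\<close>, transported by
  the power of \<open>\<lambda>\<close> that belongs to \<open>i\<close>.
\<close>

lemma dual_entry_long:
  assumes "i \<noteq> 0" "a \<in> part whole i (- i)" shows "dual_entry i (- i) a = - a"
proof (cases "i > 0")
  case True
  then have "lm * a \<in> Lam F" using assms by (simp add: mem_part_long_iff)
  then have "lm * a = - (lm * br (lm * a))" by (rule Lam_eq)
  then have "br lm * (lm * a) = br lm * (- (lm * br (lm * a)))" by simp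
  then have "a = - br (lm * a)" by (simp add: lam_simps)
  then show ?thesis using True by (simp add: dual_entry_cases bar_mult bar_lam_central) (metis minus_minus)
next
  case False
  then have "a = - (lm * br a)" using assms Lam_eq by (simp add: mem_part_long_iff)
  then show ?thesis using False assms(1) by (simp add: dual_entry_cases) (metis minus_minus)
qed

context
  fixes n :: nat and i j :: int
  assumes i: "i \<in> Omega n" and j: "j \<in> Omega n"
begin

lemma trv_add:
  assumes "i \<noteq> j"
  shows "mmul n (trv F n i j a) (trv F n i j b) = trv F n i j (a + b)"
proof (cases "j = - i")
  case True
  moreover have "- i \<noteq> i" using Omega_nonzero[OF i] by simp
  ultimately show ?thesis using i
    by (simp add: trv_long matrix_simps Omega_minus algebra_simps)
next
  case False
  then show ?thesis using i j assms Omega_nonzero[OF i] Omega_nonzero[OF j]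
    by (auto simp add: trv_short matrix_simps Omega_minus dual_entry_add algebra_simps)
qed

lemma trv_zero: "trv F n i j 0 = mat_one n"
  by (cases "j = - i") (auto simp: trv_long trv_short matrix_simps)

lemma trv_dual:
  assumes "j \<noteq> - i" shows "trv F n (- j) (- i) (- dual_entry i j a) = trv F n i j a"
  using assms Omega_nonzero[OF i] Omega_nonzero[OF j] by (auto simp: trv_short matrix_simps)

lemma trv_closed:
  assumes "i \<noteq> j" shows "trv F n i j a \<in> carrier (GL n)"
proof -
  have car: "trv F n i j b \<in> carrier (mat_monoid n)" for b
    using i j by (auto simp: trv_def mat_monoid_def mat_one_def mat_unit_def Omega_minus)
  have inv: "trv F n i j b \<otimes>\<^bsub>mat_monoid n\<^esub> trv F n i j c = \<one>\<^bsub>mat_monoid n\<^esub>" if "b + c = 0" for b c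
    using trv_add[OF assms, of b c] that trv_zero by (simp add: mat_monoid_def mmul_def)
  show ?thesis
    using car inv[of "- a" a] inv[of a "- a"] by (auto simp: GL_def units_of_def Units_def)
qed

end

lemma trv_commute:
  assumes "i \<in> Omega n" "j \<in> Omega n" "i \<noteq> j" "h \<in> Omega n" "k \<in> Omega n" "h \<noteq> k"
    "h \<noteq> j" "h \<noteq> - i" "k \<noteq> i" "k \<noteq> - j"
  shows "mmul n (trv F n i j a) (trv F n h k b) = mmul n (trv F n h k b) (trv F n i j a)"
  using assms
  by (cases "j = - i"; cases "k = - h")
    (auto simp add: trv_short trv_long matrix_simps Omega_minus algebra_simps)

text \<open>
  A commutator relation \<open>[X, Y] = Z\<close> is verified in the form \<open>X Y = Z Y X\<close>, which needs no inverses.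
\<close>

lemma trv_comm_short:
  assumes ijk: "i \<in> Omega n" "j \<in> Omega n" "k \<in> Omega n" "\<bar>i\<bar> \<noteq> \<bar>j\<bar>" "\<bar>j\<bar> \<noteq> \<bar>k\<bar>" "\<bar>i\<bar> \<noteq> \<bar>k\<bar>"
  shows "mmul n (trv F n i j a) (trv F n j k b)
    = mmul n (trv F n i k (a * b)) (mmul n (trv F n j k b) (trv F n i j a))"
proof -
  note nz = ijk(1-3)[THEN Omega_nonzero]
  have ne: "j \<noteq> - i" "k \<noteq> - j" "k \<noteq> - i" "i \<noteq> j" "j \<noteq> i" "j \<noteq> k" "k \<noteq> j" "i \<noteq> k" "k \<noteq> i" "i \<noteq> - j" "j \<noteq> - k" "i \<noteq> - k"
    "i \<noteq> - i" "j \<noteq> - j" "k \<noteq> - k" "- i \<noteq> i" "- j \<noteq> j" "- k \<noteq> k" "- i \<noteq> j" "- j \<noteq> i" "- j \<noteq> k" "- k \<noteq> j" "- i \<noteq> k" "- k \<noteq> i"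
    using assms nz by auto
  show ?thesis
    using ijk(1-3) ne dual_entry_mult[OF nz, of a b]
    by (simp add: trv_short matrix_simps Omega_minus algebra_simps)
qed

lemma trv_comm_long:
  assumes ij: "i \<in> Omega n" "j \<in> Omega n" "\<bar>i\<bar> \<noteq> \<bar>j\<bar>"
  shows "mmul n (trv F n i j a) (trv F n j (- i) b)
    = mmul n (trv F n i (- i) (a * b - dual_entry i (- i) (a * b))) (mmul n (trv F n j (- i) b) (trv F n i j a))"
proof -
  note nz = ij(1,2)[THEN Omega_nonzero]
  have ne: "j \<noteq> - i" "i \<noteq> j" "j \<noteq> i" "i \<noteq> - j" "i \<noteq> - i" "j \<noteq> - j" "- i \<noteq> i" "- j \<noteq> j" "- i \<noteq> j" "- j \<noteq> i"
    using assms nz by auto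
  have "dual_entry i (- i) (a * b) = dual_entry j (- i) b * dual_entry i j a"
    by (rule dual_entry_mult) (use nz in auto)
  then show ?thesis
    using ij ne by (simp add: trv_short trv_long matrix_simps Omega_minus algebra_simps)
qed

lemma trv_comm_long_short:
  assumes ij: "i \<in> Omega n" "j \<in> Omega n" "\<bar>i\<bar> \<noteq> \<bar>j\<bar>" and a: "a \<in> part whole i (- i)"
  shows "mmul n (trv F n i (- i) a) (trv F n (- i) j b)
    = mmul n (mmul n (trv F n i j (a * b)) (trv F n (- j) j (- (dual_entry (- i) j b * a * b))))
        (mmul n (trv F n (- i) j b) (trv F n i (- i) a))"
proof -
  note nz = ij(1,2)[THEN Omega_nonzero]
  have ne: "j \<noteq> - i" "i \<noteq> j" "j \<noteq> i" "i \<noteq> - j" "i \<noteq> - i" "j \<noteq> - j" "- i \<noteq> i" "- j \<noteq> j" "- i \<noteq> j" "- j \<noteq> i"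
    using assms nz by auto
  have "dual_entry i j (a * b) = dual_entry (- i) j b * dual_entry i (- i) a"
    by (rule dual_entry_mult) (use nz in auto)
  then have d: "dual_entry i j (a * b) = - (dual_entry (- i) j b * a)"
    using dual_entry_long[OF nz(1) a] by simp
  have lj: "trv F n (- j) j c = mat_one n + mat_unit c (- j) j" for c
    using trv_long[of n "- j" c] by simp
  show ?thesis
    using ij ne d by (simp add: trv_short trv_long lj matrix_simps Omega_minus mult.assoc algebra_simps)
qed

end

section \<open>The elementary group and the theorem\<close>

definition EU_group :: "('a::{ring, monoid_mult}) form_data \<Rightarrow> nat \<Rightarrow> 'a matrix monoid" where
  "EU_group F n = (GL n)\<lparr>carrier := EU_abs F n\<rparr>"

context form_ring
begin

lemma elem_gens_GL: "elem_gens F n P \<subseteq> carrier (GL n)"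
  unfolding elem_gens_def using trv_closed by blast

lemma subgroup_EU_abs: "subgroup (EU_abs F n) (GL n)"
  unfolding EU_abs_def by (rule group.generate_is_subgroup[OF group_GL elem_gens_GL])

lemma group_EU_group: "group (EU_group F n)"
  unfolding EU_group_def by (rule subgroup.subgroup_is_group[OF subgroup_EU_abs group_GL])

lemma mult_EU_group: "M \<otimes>\<^bsub>EU_group F n\<^esub> N = mmul n M N"
  by (simp add: EU_group_def mult_GL)

lemma trv_EU_abs:
  assumes "i \<in> Omega n" "j \<in> Omega n" "i \<noteq> j" "a \<in> part whole i j"
  shows "trv F n i j a \<in> EU_abs F n"
  unfolding EU_abs_def by (rule generate.incl) (use assms in \<open>auto simp: elem_gens_def\<close>)

lemma steinberg_EU_group:
  assumes n: "4 \<le> n"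
  shows "unitary_steinberg F (EU_group F n) n (trv F n)"
proof -
  interpret G: group "EU_group F n" by (rule group_EU_group)
  have closed: "trv F n i j a \<in> carrier (EU_group F n)"
    if "i \<in> Omega n" "j \<in> Omega n" "i \<noteq> j" "a \<in> part whole i j" for i j a
    using trv_EU_abs[OF that] by (simp add: EU_group_def)
  have short: "trv F n i j a \<in> carrier (EU_group F n)"
    if "i \<in> Omega n" "j \<in> Omega n" "\<bar>i\<bar> \<noteq> \<bar>j\<bar>" for i j a
    by (rule closed) (use that in \<open>auto simp: part_short\<close>)
  show ?thesis
  proof (unfold_locales, goal_cases)
    case 1
    show ?case by (rule n)
  next
    case (2 i j a)
    then show ?case by (rule closed)
  next
    case 3
    have "elem_gens F n whole \<subseteq> EU_abs F n"
      unfolding EU_abs_def by (blast intro: generate.incl)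
    then have "generate (EU_group F n) (elem_gens F n whole) = EU_abs F n"
      unfolding EU_group_def using group.generate_consistent[OF group_GL _ subgroup_EU_abs]
      by (simp add: EU_abs_def)
    then show ?case by (simp add: EU_group_def elem_gens_def)
  next
    case (4 i j a b)
    then show ?case by (simp add: mult_EU_group trv_add)
  next
    case (5 i j a)
    then show ?case using trv_dual[of i n j a] by auto
  next
    case (6 i j h k a b)
    then show ?case using trv_commute[of i n j h k a b] by (simp add: mult_EU_group)
  next
    case (7 i j k a b)
    show ?case
      by (rule G.comm_eqI)
        (use 7 short trv_comm_short[OF 7, of a b] in \<open>auto simp: mult_EU_group\<close>)
  next
    case (8 i j a b)
    have nz: "i \<noteq> 0" "i \<noteq> - i" using 8(1) by (auto simp: Omega_def)
    have "trv F n i (- i) (a * b - dual_entry i (- i) (a * b)) \<in> carrier (EU_group F n)"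
      by (rule closed) (use 8 nz trace_mem_part[OF form_ideal_whole _ nz(1)] in \<open>auto simp: Omega_minus\<close>)
    then show ?case
      by (intro G.comm_eqI)
        (use 8 short trv_comm_long[OF 8, of a b] in \<open>auto simp: mult_EU_group Omega_minus\<close>)
  next
    case (9 i j a b)
    have nz: "i \<noteq> 0" "i \<noteq> - i" "j \<noteq> 0" "j \<noteq> - j" using 9(1,2) by (auto simp: Omega_def)
    have "trv F n (- j) j (- (dual_entry (- i) j b * a * b)) \<in> carrier (EU_group F n)"
      by (rule closed)
        (use 9 nz prod_le_long_mem(2)[OF prod_le_whole[OF form_ideal_whole] 9(4) _ nz(1,3), of b]
          in \<open>auto simp: Omega_minus\<close>)
    moreover have "trv F n i (- i) a \<in> carrier (EU_group F n)"
      by (rule closed) (use 9 nz in \<open>auto simp: Omega_minus\<close>)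
    ultimately show ?case
      using G.m_closed[OF short[of i j "a * b"]]
      by (intro G.comm_eqI)
        (use 9 short trv_comm_long_short[OF 9, of b] in \<open>auto simp: mult_EU_group Omega_minus\<close>)
  qed
qed

end

text \<open>
  The abstract argument takes the elementary group as the ambient group, whereas the commutators in the
  theorem are formed in the general linear group.
\<close>

lemma (in group) commutator_subgroup_consistent:
  assumes H: "subgroup H G" and "X \<subseteq> H" "Y \<subseteq> H"
  shows "commutator_subgroup (G\<lparr>carrier := H\<rparr>) X Y = commutator_subgroup G X Y"
    and "commutator_subgroup G X Y \<subseteq> H"
proof -
  let ?S = "{x \<otimes> y \<otimes> inv x \<otimes> inv y | x y. x \<in> X \<and> y \<in> Y}"
  have S: "?S \<subseteq> H"
    using assms by (auto intro!: subgroup.m_closed[OF H] subgroup.m_inv_closed[OF H])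
  have "{x \<otimes> y \<otimes> inv\<^bsub>G\<lparr>carrier := H\<rparr>\<^esub> x \<otimes> inv\<^bsub>G\<lparr>carrier := H\<rparr>\<^esub> y | x y. x \<in> X \<and> y \<in> Y} = ?S"
  proof (intro Collect_cong arg_cong[where f = Ex] ext)
    fix z x y
    show "(z = x \<otimes> y \<otimes> inv\<^bsub>G\<lparr>carrier := H\<rparr>\<^esub> x \<otimes> inv\<^bsub>G\<lparr>carrier := H\<rparr>\<^esub> y \<and> x \<in> X \<and> y \<in> Y)
      = (z = x \<otimes> y \<otimes> inv x \<otimes> inv y \<and> x \<in> X \<and> y \<in> Y)"
      using m_inv_consistent[OF H subsetD[OF assms(2)]] m_inv_consistent[OF H subsetD[OF assms(3)]]
      by (auto simp del: m_inv_consistent)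
  qed
  then show "commutator_subgroup (G\<lparr>carrier := H\<rparr>) X Y = commutator_subgroup G X Y"
    using generate_consistent[OF S H] by (simp add: commutator_subgroup_def)
  show "commutator_subgroup G X Y \<subseteq> H"
    unfolding commutator_subgroup_def by (rule generate_subgroup_incl[OF S H])
qed

lemma (in group) bracketed_commutator_consistent:
  assumes H: "subgroup H G" and "length Xs = leaves b" "\<forall>X\<in>set Xs. X \<subseteq> H"
  shows "bracketed (commutator_subgroup (G\<lparr>carrier := H\<rparr>)) b Xs = bracketed (commutator_subgroup G) b Xs
    \<and> bracketed (commutator_subgroup G) b Xs \<subseteq> H"
  using assms(2,3)
proof (induction b arbitrary: Xs)
  case Single
  then show ?case by (cases Xs) auto
next
  case (Br b c)
  have "bracketed (commutator_subgroup (G\<lparr>carrier := H\<rparr>)) b (take (leaves b) Xs) =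
      bracketed (commutator_subgroup G) b (take (leaves b) Xs)
    \<and> bracketed (commutator_subgroup G) b (take (leaves b) Xs) \<subseteq> H"
    by (rule Br.IH(1)) (use Br.prems in \<open>auto dest: in_set_takeD\<close>)
  moreover have "bracketed (commutator_subgroup (G\<lparr>carrier := H\<rparr>)) c (drop (leaves b) Xs) =
      bracketed (commutator_subgroup G) c (drop (leaves b) Xs)
    \<and> bracketed (commutator_subgroup G) c (drop (leaves b) Xs) \<subseteq> H"
    by (rule Br.IH(2)) (use Br.prems in \<open>auto dest: in_set_dropD\<close>)
  ultimately show ?case using commutator_subgroup_consistent[OF H] by simp
qed

lemma (in form_ring) EU_eq_EE:
  assumes n: "4 \<le> n" and P: "form_ideal F P"
  shows "EU F n P = unitary_steinberg.EE F (EU_group F n) n (trv F n) P"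
    and "EU F n P \<subseteq> EU_abs F n"
proof -
  interpret S: unitary_steinberg F "EU_group F n" n "trv F n" by (rule steinberg_EU_group[OF n])
  have el: "S.elem P = elem_gens F n P"
    by (auto simp: S.elem_def elem_gens_def S.root_def)
  have sub: "elem_gens F n P \<subseteq> EU_abs F n"
    using S.elem_carrier[OF P] unfolding el by (simp add: EU_group_def)
  have "S.FU P = generate (EU_group F n) (elem_gens F n P)" by (simp add: S.FU_def el)
  also have "\<dots> = generate (GL n) (elem_gens F n P)"
    unfolding EU_group_def by (rule group.generate_consistent[OF group_GL sub subgroup_EU_abs])
  finally have "S.FU P = generate (GL n) (elem_gens F n P)" .
  then show eq: "EU F n P = S.EE P"
    by (simp add: EU_def S.EE_def normal_closure_def flip: EU_group_def)
  show "EU F n P \<subseteq> EU_abs F n"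
    unfolding eq using S.EE_carrier[OF P] by (simp add: EU_group_def)
qed

theorem theorem7:
  fixes F :: "('a::{ring, monoid_mult}) form_data"
    and n m s :: nat
    and I \<Gamma> :: "nat \<Rightarrow> 'a set"
    and b l r :: bracketing
  assumes "form_ring F"
    and "n \<ge> 4"
    and "m \<ge> 2"
    and "\<And>i. i \<in> {1..m} \<Longrightarrow> form_ideal F (I i, \<Gamma> i)"
    and "leaves b = m"
    and "b = Br l r"
    and "leaves l = s"
  shows "bracketed (commutator_subgroup (GL n)) b (map (\<lambda>i. EU F n (I i, \<Gamma> i)) [1..<m + 1]) =
    commutator_subgroup (GL n)
      (EU F n (bracketed (form_prod F) l (map (\<lambda>i. (I i, \<Gamma> i)) [1..<s + 1])))
      (EU F n (bracketed (form_prod F) r (map (\<lambda>i. (I i, \<Gamma> i)) [s + 1..<m + 1])))"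
proof -
  interpret form_ring F by (rule assms(1))
  interpret S: unitary_steinberg F "EU_group F n" n "trv F n" by (rule steinberg_EU_group[OF assms(2)])
  define xs where "xs = map (\<lambda>i. (I i, \<Gamma> i)) [1..<m + 1]"
  have len: "length xs = leaves (Br l r)" using assms(5,6) by (simp add: xs_def)
  have sm: "s \<le> m" using assms(5,6,7) by simp
  have ideals: "\<forall>P\<in>set xs. form_ideal F P" using assms(4) by (auto simp: xs_def)
  have halves: "take (leaves l) xs = map (\<lambda>i. (I i, \<Gamma> i)) [1..<s + 1]"
    "drop (leaves l) xs = map (\<lambda>i. (I i, \<Gamma> i)) [s + 1..<m + 1]"
    using sm assms(7) by (simp_all add: xs_def take_map drop_map take_upt drop_upt del: upt_Suc)
  have P: "form_ideal F (bracketed (form_prod F) l (take (leaves l) xs))"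
    "form_ideal F (bracketed (form_prod F) r (drop (leaves l) xs))"
    by (rule S.form_ideal_bracketed; use len ideals in \<open>auto dest: in_set_takeD in_set_dropD\<close>)+
  note EU = EU_eq_EE[OF assms(2)]
  have EUs: "map (EU F n) xs = map S.EE xs" using ideals EU(1) by auto
  have "bracketed (commutator_subgroup (GL n)) b (map (EU F n) xs)
      = bracketed (commutator_subgroup (EU_group F n)) b (map (EU F n) xs)"
    unfolding EU_group_def
    using group.bracketed_commutator_consistent[OF group_GL subgroup_EU_abs, of "map (EU F n) xs" b]
      len ideals EU(2) assms(6) by simp
  also have "\<dots> = commutator_subgroup (EU_group F n)
      (EU F n (bracketed (form_prod F) l (take (leaves l) xs)))
      (EU F n (bracketed (form_prod F) r (drop (leaves l) xs)))"
    unfolding EUs EU(1)[OF P(1)] EU(1)[OF P(2)] assms(6)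
    by (rule S.bracketed_commutator_EE[OF len ideals])
  also have "\<dots> = commutator_subgroup (GL n)
      (EU F n (bracketed (form_prod F) l (take (leaves l) xs)))
      (EU F n (bracketed (form_prod F) r (drop (leaves l) xs)))"
    unfolding EU_group_def
    by (rule group.commutator_subgroup_consistent(1)[OF group_GL subgroup_EU_abs EU(2)[OF P(1)] EU(2)[OF P(2)]])
  finally show ?thesis unfolding halves by (simp add: xs_def comp_def)
qed

end
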